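(* Let $G$ be a planar $3$-connected graph. Then every longest circuit of $G$ has a chord; that is, for every circuit $C$ of $G$ of maximum length among all circuits of $G$, there is an edge of $G$ that joins two vertices of $C$ and is not an edge of $C$.
   Context: Graphs are finite and simple. A circuit of a graph $G$ is a connected $2$-regular subgraph of $G$ (i.e. a cycle); a longest circuit is one with the maximum number of edges among all circuits of $G$. A chord of a circuit $C$ of $G$ is an edge of $G$ that joins two vertices of $C$ and is not an edge of $C$. A graph is $3$-connected if it has at least $4$ vertices and remains connected after deleting any set of at most $2$ vertices. A graph is planar if it can be embedded in the plane without edge crossings; by Kuratowski's theorem (in the form recalled by the paper) this is equivalent to having neither $K_5$ (the complete graph on five vertices) nor $K_{3,3}$ (the complete bipartite graph with both parts of size $3$) as a minor, where a minor is a graph obtained by a sequence of vertex deletions, edge deletions and edge contractions. *)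

theory Defs
  imports "HOL-Analysis.Analysis"
begin

text \<open>A graph is a pair of a vertex set and a set of edges, an edge being the set of its two ends.\<close>

type_synonym 'a ugraph = "'a set \<times> 'a set set"

abbreviation verts :: "'a ugraph \<Rightarrow> 'a set" where
  "verts G \<equiv> fst G"

abbreviation edges :: "'a ugraph \<Rightarrow> 'a set set" where
  "edges G \<equiv> snd G"

definition simple_graph :: "'a ugraph \<Rightarrow> bool" where
  "simple_graph G \<longleftrightarrow> finite (verts G) \<and> (\<forall>e\<in>edges G. e \<subseteq> verts G \<and> card e = 2)"

definition subgraph :: "'a ugraph \<Rightarrow> 'a ugraph \<Rightarrow> bool" where
  "subgraph H G \<longleftrightarrow> simple_graph H \<and> verts H \<subseteq> verts G \<and> edges H \<subseteq> edges G"

definition adjacency :: "'a ugraph \<Rightarrow> 'a rel" where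
  "adjacency G = {(u, v). {u, v} \<in> edges G}"

text \<open>The graph without vertices does not count as connected.\<close>

definition graph_connected :: "'a ugraph \<Rightarrow> bool" where
  "graph_connected G \<longleftrightarrow>
     verts G \<noteq> {} \<and> (\<forall>u\<in>verts G. \<forall>v\<in>verts G. (u, v) \<in> (adjacency G)\<^sup>*)"

definition delete_verts :: "'a ugraph \<Rightarrow> 'a set \<Rightarrow> 'a ugraph" where
  "delete_verts G S = (verts G - S, {e \<in> edges G. e \<inter> S = {}})"

definition three_connected :: "'a ugraph \<Rightarrow> bool" where
  "three_connected G \<longleftrightarrow> card (verts G) \<ge> 4 \<and>
     (\<forall>S. S \<subseteq> verts G \<and> card S \<le> 2 \<longrightarrow> graph_connected (delete_verts G S))"

definition vertex_degree :: "'a ugraph \<Rightarrow> 'a \<Rightarrow> nat" where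
  "vertex_degree G v = card {e \<in> edges G. v \<in> e}"

definition circuit :: "'a ugraph \<Rightarrow> 'a ugraph \<Rightarrow> bool" where
  "circuit G C \<longleftrightarrow> subgraph C G \<and> graph_connected C \<and> (\<forall>v\<in>verts C. vertex_degree C v = 2)"

definition longest_circuit :: "'a ugraph \<Rightarrow> 'a ugraph \<Rightarrow> bool" where
  "longest_circuit G C \<longleftrightarrow>
     circuit G C \<and> (\<forall>D. circuit G D \<longrightarrow> card (edges D) \<le> card (edges C))"

definition chord :: "'a ugraph \<Rightarrow> 'a ugraph \<Rightarrow> 'a set \<Rightarrow> bool" where
  "chord G C e \<longleftrightarrow> e \<in> edges G \<and> e \<subseteq> verts C \<and> e \<notin> edges C"

text \<open>
  An embedding in the plane, taken to be the type \<^typ>\<open>complex\<close>: vertices go to distinct points,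
  each edge to a Jordan arc between the images of its ends that passes through no other vertex,
  and two different edges meet at most at the image of a common end.
\<close>

definition plane_embedding ::
    "'a ugraph \<Rightarrow> ('a \<Rightarrow> complex) \<Rightarrow> ('a set \<Rightarrow> real \<Rightarrow> complex) \<Rightarrow> bool" where
  "plane_embedding G p \<gamma> \<longleftrightarrow>
     inj_on p (verts G) \<and>
     (\<forall>e\<in>edges G. arc (\<gamma> e) \<and> {pathstart (\<gamma> e), pathfinish (\<gamma> e)} = p ` e \<and>
        path_image (\<gamma> e) \<inter> p ` verts G \<subseteq> p ` e) \<and>
     (\<forall>e\<in>edges G. \<forall>f\<in>edges G. e \<noteq> f \<longrightarrow>
        path_image (\<gamma> e) \<inter> path_image (\<gamma> f) \<subseteq> p ` (e \<inter> f))"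

definition planar :: "'a ugraph \<Rightarrow> bool" where
  "planar G \<longleftrightarrow> (\<exists>p \<gamma>. plane_embedding G p \<gamma>)"

end

theory Submission
  imports Defs
begin

text \<open>
  Let a longest circuit have the vertices 0, ..., n - 1 in cyclic order and suppose that it has no
  chord. Each component of the rest of the graph (a bridge) is represented by the set of its feet on
  the circuit. By 3-connectedness every such set has at least three elements and every position is a
  foot; by the Jordan curve theorem the sets of two bridges on the same side of the circuit do not
  cross. As the circuit is longest, none of several reroutings through at most four bridges gains length.

  The contradiction comes from discharging. On either side the bridges cut the disc into faces. Call a
  face a leaf if it is bounded by one bridge and one run of t positions between consecutive feet of
  that bridge; the positions inside are feet of bridges on the other side only. By Euler's formula, if
  every leaf is to receive 3 units, every face with two bridges 0, and every run on a larger face gives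
  up 1 unit, then the total need exceeds the number of feet. A leaf has t units of its own. If
  t = 1 or t = 2, then it demands the missing ones from the runs of the other side that touch it at its
  ends, or that are squeezed to an edge inside it, and the failed reroutings show that all these
  demands can be met.
\<close>

section \<open>Noncrossing families on a ring\<close>

text \<open>Supply is counted per incidence. One side holds at most
  \<open>card (incidences s) + n - 2 * card (attached s)\<close> units, so over both sides the terms
  in \<open>n\<close> cancel and a position attached on both sides costs two units. This deficit
  pays for the ends of one-position leaves that lie on such positions, which is why neither side can
  be balanced alone. The tight case is a face with two bridges, which must break even: if one of its
  runs falls short, the other has to make up for it. The detours are made for this; they show that
  feet which create a shortage at one run keep the same two bridges at least four apart at the
  other. Cyclic order is awkward for noncrossing and nesting, so the ring is cut open. The face at
  the cut then has no corner, and on each side one demand may run over the cut without a recipient.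
  Euler's inequality leaves a surplus of 2 per side, which outweighs this loss of 1.\<close>

text \<open>
  Positions are 0, ..., n - 1 and a set in F s is the set of feet of a bridge on the side s. Each
  assumption from jump_left onwards says that one particular rerouting is not longer than the ring; the
  variants ending in after and before differ only in where the ring is cut open between n - 1 and 0.
\<close>

locale ring_system =
  fixes n :: nat and F :: "bool \<Rightarrow> nat set set"
  assumes finite_F: "finite (F s)"
    and sub: "B \<in> F s \<Longrightarrow> B \<subseteq> {..<n}"
    and card3: "B \<in> F s \<Longrightarrow> 3 \<le> card B"
    and noncross: "\<lbrakk>A \<in> F s; B \<in> F s; A \<noteq> B; a \<in> A; b \<in> A; x \<in> B; y \<in> B; a < x; x < b\<rbrakk> \<Longrightarrow> a \<le> y \<and> y \<le> b"
    and cover: "v < n \<Longrightarrow> \<exists>s. \<exists>B\<in>F s. v \<in> B"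
    and n_pos: "0 < n"
    and no_consecutive: "\<lbrakk>B \<in> F s; v \<in> B\<rbrakk> \<Longrightarrow> Suc v \<notin> B"
    and jump_left: "\<lbrakk>w \<in> F s; D \<in> F (\<not> s); a \<in> w; a + 2 \<in> w; a + 1 \<in> D; z \<in> D; a + 1 < z\<rbrakk> \<Longrightarrow> a + 5 \<le> z"
    and jump_right: "\<lbrakk>w \<in> F s; D \<in> F (\<not> s); c \<in> w; c + 2 \<in> w; c + 1 \<in> D; y \<in> D; y < c + 1\<rbrakk> \<Longrightarrow> y + 3 \<le> c"
    and jump_both: "\<lbrakk>w \<in> F s; w' \<in> F s; w \<noteq> w'; D \<in> F (\<not> s); a \<in> w; a + 2 \<in> w; a + 1 \<in> D;
        c \<in> w'; c + 2 \<in> w'; c + 1 \<in> D; a < c\<rbrakk> \<Longrightarrow> a + 6 \<le> c"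
    and detour_after: "\<lbrakk>w \<in> F s; P \<in> F (\<not> s); Q \<in> F (\<not> s); P \<noteq> Q; a \<in> w; v + 1 \<in> w; a + 1 \<in> P; v \<in> Q; a + 1 \<le> v;
        q \<in> Q; p \<in> P; v + 1 < q; q < p\<rbrakk> \<Longrightarrow> q + 4 \<le> p"
    and detour_before: "\<lbrakk>w \<in> F s; P \<in> F (\<not> s); Q \<in> F (\<not> s); P \<noteq> Q; a \<in> w; v + 1 \<in> w; a + 1 \<in> P; v \<in> Q; a + 1 \<le> v;
        q \<in> Q; p \<in> P; q < p; p < a\<rbrakk> \<Longrightarrow> q + 4 \<le> p"
    and left_detour_after: "\<lbrakk>w \<in> F s; P \<in> F s; Q \<in> F s; w \<noteq> P; w \<noteq> Q; P \<noteq> Q; D \<in> F (\<not> s); a \<in> w; a + 2 \<in> w;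
        a + 1 \<in> D; a + 5 \<in> D; a + 3 \<in> P; a + 4 \<in> Q; q \<in> Q; p \<in> P; a + 5 < q; q < p\<rbrakk> \<Longrightarrow> q + 4 \<le> p"
    and left_detour_before: "\<lbrakk>w \<in> F s; P \<in> F s; Q \<in> F s; w \<noteq> P; w \<noteq> Q; P \<noteq> Q; D \<in> F (\<not> s); a \<in> w; a + 2 \<in> w;
        a + 1 \<in> D; a + 5 \<in> D; a + 3 \<in> P; a + 4 \<in> Q; q \<in> Q; p \<in> P; q < p; p \<le> a\<rbrakk> \<Longrightarrow> q + 4 \<le> p"
    and right_detour_after: "\<lbrakk>w \<in> F s; P \<in> F s; Q \<in> F s; w \<noteq> P; w \<noteq> Q; P \<noteq> Q; D \<in> F (\<not> s); y + 3 \<in> w; y + 5 \<in> w;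
        y \<in> D; y + 4 \<in> D; y + 1 \<in> P; y + 2 \<in> Q; q \<in> Q; p \<in> P; y + 5 \<le> q; q < p\<rbrakk> \<Longrightarrow> q + 4 \<le> p"
    and right_detour_before: "\<lbrakk>w \<in> F s; P \<in> F s; Q \<in> F s; w \<noteq> P; w \<noteq> Q; P \<noteq> Q; D \<in> F (\<not> s); y + 3 \<in> w; y + 5 \<in> w;
        y \<in> D; y + 4 \<in> D; y + 1 \<in> P; y + 2 \<in> Q; q \<in> Q; p \<in> P; q < p; p < y\<rbrakk> \<Longrightarrow> q + 4 \<le> p"
begin

definition attached :: "bool \<Rightarrow> nat set" where "attached s = \<Union>(F s)"
definition mult :: "bool \<Rightarrow> nat \<Rightarrow> nat" where "mult s v = card {B \<in> F s. v \<in> B}"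
text \<open>
  The bridges of one side that share the foot v are ordered around v by their next foot in cyclic
  direction, those with a large key coming first after the positions below v. Hence an incidence (v, B) is
  a pinch if, just before B, the boundary of the face passes from another bridge to B directly at v.
\<close>

definition rot :: "nat \<Rightarrow> nat \<Rightarrow> nat" where "rot v x = (if v < x then x - v else x + n - v)"
definition key :: "nat \<Rightarrow> nat set \<Rightarrow> nat" where "key v B = Min (rot v ` (B - {v}))"
definition pinch :: "bool \<Rightarrow> nat \<Rightarrow> nat set \<Rightarrow> bool" where
  "pinch s v B \<longleftrightarrow> (\<exists>A\<in>F s. v \<in> A \<and> key v B < key v A)"
definition gap :: "bool \<Rightarrow> nat \<Rightarrow> nat" where "gap s v = card {u. u < v \<and> {u..<v} \<inter> attached s = {}}"
text \<open>
  A corner (y, B) stands for the face seen by B between its consecutive feet pred_in B y and y, with the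
  bridges in children s (y, B) on the opposite border; only the face at the cut of the ring has
  no corner. An incidence (v, B) stands for the run on the border of a face that ends at v just before B:
  that face is the corner (v, B) or, if v = Min B, the one at parent s B. The value pred_in B (Min B) is
  meaningless.
\<close>

definition pred_in :: "nat set \<Rightarrow> nat \<Rightarrow> nat" where "pred_in B y = Max {x \<in> B. x < y}"
definition incidences :: "bool \<Rightarrow> (nat \<times> nat set) set" where "incidences s = {(v, B). B \<in> F s \<and> v \<in> B}"
definition corners :: "bool \<Rightarrow> (nat \<times> nat set) set" where "corners s = {(v, B). B \<in> F s \<and> v \<in> B \<and> v \<noteq> Min B}"
definition candidates :: "bool \<Rightarrow> nat set \<Rightarrow> (nat \<times> nat set) set" where
  "candidates s A = {(y, B) \<in> corners s. B \<noteq> A \<and> A \<subseteq> {pred_in B y..y}}"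
definition parent :: "bool \<Rightarrow> nat set \<Rightarrow> (nat \<times> nat set) option" where
  "parent s A = (if candidates s A = {} then None else Some (arg_min_on (\<lambda>(y, B). y - pred_in B y) (candidates s A)))"
definition children :: "bool \<Rightarrow> nat \<times> nat set \<Rightarrow> nat set set" where "children s k = {A \<in> F s. parent s A = Some k}"

text \<open>
  A leaf with one inner position a + 1 demands one unit at either end. At an end that is a foot on both
  sides, this end pays. Otherwise, on the left, the pinch just before the leaf pays if there is one
  (pinch_demand), and else the run of the other side that ends at a + 1 (end_demand); on the right, the run of
  the other side that starts at a + 1 pays (start_demand). A leaf with two inner positions demands one unit from
  the empty run between them (edge_demand), and so does a leaf with three inner positions that has itself been
  asked for a unit, at the inner edge away from the asking end.
\<close>

definition leaf1 :: "bool \<Rightarrow> nat \<Rightarrow> bool" where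
  "leaf1 s a \<longleftrightarrow> a + 1 \<notin> attached s \<and> (\<exists>w\<in>F s. a \<in> w \<and> a + 2 \<in> w)"
definition leaf2 :: "bool \<Rightarrow> nat \<Rightarrow> bool" where
  "leaf2 s a \<longleftrightarrow> a + 1 \<notin> attached s \<and> a + 2 \<notin> attached s \<and> (\<exists>w\<in>F s. a \<in> w \<and> a + 3 \<in> w)"
definition leaf3 :: "bool \<Rightarrow> nat \<Rightarrow> bool" where
  "leaf3 s a \<longleftrightarrow> a + 1 \<notin> attached s \<and> a + 2 \<notin> attached s \<and> a + 3 \<notin> attached s \<and> (\<exists>w\<in>F s. a \<in> w \<and> a + 4 \<in> w)"

definition end_demand :: "bool \<Rightarrow> nat \<Rightarrow> bool" where
  "end_demand t v \<longleftrightarrow> (\<exists>a. v = Suc a \<and> a \<notin> attached t \<and> leaf1 (\<not> t) a \<and> mult (\<not> t) a = 1)"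
definition start_demand :: "bool \<Rightarrow> nat \<Rightarrow> bool" where
  "start_demand t v \<longleftrightarrow> (\<exists>a. leaf1 (\<not> t) a \<and> a + 2 < v \<and> {a + 2..<v} \<inter> attached t = {})"
definition edge_demand :: "bool \<Rightarrow> nat \<Rightarrow> bool" where
  "edge_demand t v \<longleftrightarrow> (\<exists>a. v = a + 2 \<and> leaf2 (\<not> t) a)
     \<or> (\<exists>y. v = y + 3 \<and> leaf3 (\<not> t) y \<and> start_demand (\<not> t) (y + 4))
     \<or> (\<exists>y. v = y + 2 \<and> leaf3 (\<not> t) y \<and> end_demand (\<not> t) (y + 4))"
definition pinch_demand :: "bool \<Rightarrow> nat \<Rightarrow> nat set \<Rightarrow> bool" where
  "pinch_demand s v B \<longleftrightarrow> leaf1 s v \<and> v + 2 \<in> B \<and> v \<notin> attached (\<not> s)"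
definition demand :: "bool \<Rightarrow> nat \<times> nat set \<Rightarrow> int" where
  "demand t = (\<lambda>(v, B). if pinch t v B then of_bool (pinch_demand t v B)
      else of_bool (end_demand t v) + of_bool (start_demand t v) + of_bool (edge_demand t v))"
text \<open>A pinch is a run without positions; its unit is the surplus of an additional incidence
  at the same foot.\<close>

definition weight :: "bool \<Rightarrow> nat \<times> nat set \<Rightarrow> int" where
  "weight t = (\<lambda>(v, B). if pinch t v B then 1 else int (gap t v))"
text \<open>Here \<open>t\<close> is the number of inner positions of a leaf. The values top it up
  to 3; for \<open>t = 3\<close> the leaf gets back just what is demanded from it.\<close>

definition issued :: "bool \<Rightarrow> nat \<times> nat set \<Rightarrow> int" where
  "issued s = (\<lambda>(y, B). let t = y - pred_in B y - 1 in
     if t = 1 then 2 else if t = 2 then 1 else if t = 3 then demand s (y, B) else 0)"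

section \<open>Corners and the nesting of bridges\<close>

lemma finite_B: "B \<in> F s \<Longrightarrow> finite B"
  using sub finite_subset by blast

lemma attached_iff: "v \<in> attached s \<longleftrightarrow> (\<exists>B\<in>F s. v \<in> B)"
  by (auto simp: attached_def)

lemma attached_less: "v \<in> attached s \<Longrightarrow> v < n"
  using sub by (auto simp: attached_def)

lemma B_less: "\<lbrakk>B \<in> F s; v \<in> B\<rbrakk> \<Longrightarrow> v < n"
  using sub by blast

lemma cover': "\<lbrakk>v < n; v \<notin> attached s\<rbrakk> \<Longrightarrow> v \<in> attached (\<not> s)"
  using cover[of v] by (cases s) (auto simp: attached_iff, (metis (full_types))+)

lemma third:
  assumes "B \<in> F s" obtains d where "d \<in> B" "d \<noteq> x" "d \<noteq> y"
proof -
  have "\<not> B \<subseteq> {x, y}"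
  proof
    assume "B \<subseteq> {x, y}"
    then have "card B \<le> card {x, y}" by (intro card_mono) auto
    also have "\<dots> \<le> 2" by (simp add: card_insert_if)
    finally show False using card3[OF assms] by simp
  qed
  then show ?thesis using that by blast
qed

lemma emptyD: "\<lbrakk>{x<..<y} \<inter> B = {}; e \<in> B\<rbrakk> \<Longrightarrow> e \<le> x \<or> y \<le> e" for x y e :: nat
  by (rule ccontr) (auto simp: disjoint_iff)

text \<open>With \<open>x\<close> and \<open>y\<close> shared and nothing between them, each bridge
  has all further feet outside; noncrossing in both directions then leaves no place for a foot of
  one that the other lacks. Hence a leaf is determined by its interval.\<close>

lemma corner_unique:
  assumes A: "A \<in> F s" and B: "B \<in> F s" and xy: "x < y" "x \<in> A" "y \<in> A" "x \<in> B" "y \<in> B"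
    and e: "{x<..<y} \<inter> A = {}" "{x<..<y} \<inter> B = {}"
  shows "A = B"
proof -
  have *: "A' \<subseteq> B'" if "A' \<in> F s" "B' \<in> F s" "A' \<noteq> B'" "x \<in> A'" "y \<in> A'" "x \<in> B'" "y \<in> B'"
      "{x<..<y} \<inter> A' = {}" "{x<..<y} \<inter> B' = {}" for A' B'
  proof
    fix u assume u: "u \<in> A'"
    show "u \<in> B'"
    proof (rule ccontr)
      assume un: "u \<notin> B'"
      then have uo: "u < x \<or> y < u" using emptyD[OF that(8) u] u un that by (metis order_le_less)
      obtain d where d: "d \<in> B'" "d \<noteq> x" "d \<noteq> y" using third[OF \<open>B' \<in> F s\<close>] by blast
      then have dout: "d < x \<or> y < d" using emptyD[OF that(9) d(1)] d by linarith
      have ne: "d \<noteq> u" using d un by blast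
      note nc1 = noncross[OF \<open>A' \<in> F s\<close> \<open>B' \<in> F s\<close> \<open>A' \<noteq> B'\<close>]
        and nc2 = noncross[OF \<open>B' \<in> F s\<close> \<open>A' \<in> F s\<close> \<open>A' \<noteq> B'\<close>[symmetric]]
      show False
        using uo dout ne xy(1) nc1[OF \<open>x \<in> A'\<close> u \<open>y \<in> B'\<close> d(1)] nc1[OF u \<open>y \<in> A'\<close> \<open>x \<in> B'\<close> d(1)]
          nc2[OF \<open>x \<in> B'\<close> d(1) \<open>y \<in> A'\<close> u] nc2[OF d(1) \<open>y \<in> B'\<close> \<open>x \<in> A'\<close> u]
        by linarith
    qed
  qed
  show ?thesis
  proof (rule ccontr)
    assume "A \<noteq> B"
    then show False using *[of A B] *[of B A] assms by blast
  qed
qed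

lemma cornersD:
  assumes "(y, B) \<in> corners s"
  shows "B \<in> F s" "y \<in> B" "pred_in B y \<in> B" "pred_in B y < y" "{pred_in B y<..<y} \<inter> B = {}"
proof -
  show B: "B \<in> F s" "y \<in> B" using assms by (auto simp: corners_def)
  have f: "finite B" using finite_B B by blast
  have "Min B \<in> B" using B f by (intro Min_in) auto
  then have "Min B \<in> {x \<in> B. x < y}"
    using assms f by (auto simp: corners_def order_less_le)
  then have ne: "{x \<in> B. x < y} \<noteq> {}" by blast
  have ff: "finite {x \<in> B. x < y}" using f by simp
  show "pred_in B y \<in> B" "pred_in B y < y" using Max_in[OF ff ne] by (auto simp: pred_in_def)
  show "{pred_in B y<..<y} \<inter> B = {}"
  proof (rule ccontr)
    assume "{pred_in B y<..<y} \<inter> B \<noteq> {}"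
    then obtain z where z: "z \<in> B" "pred_in B y < z" "z < y" by auto
    then have "z \<le> pred_in B y" unfolding pred_in_def using ff by (intro Max_ge) auto
    with z show False by simp
  qed
qed

lemma cornersI:
  assumes "B \<in> F s" "x \<in> B" "y \<in> B" "x < y" "{x<..<y} \<inter> B = {}"
  shows "(y, B) \<in> corners s" "pred_in B y = x"
proof -
  have f: "finite B" using finite_B assms by blast
  have "Min B \<le> x" using f assms by auto
  then show "(y, B) \<in> corners s" using assms by (auto simp: corners_def)
  have "z \<le> x" if "z \<in> B" "z < y" for z
    using emptyD[OF assms(5) that(1)] that(2) by simp
  then show "pred_in B y = x" unfolding pred_in_def using assms f by (intro Max_eqI) auto
qed

lemma Min_Max: assumes "B \<in> F s"
  shows "Min B \<in> B" "Max B \<in> B" "B \<subseteq> {Min B..Max B}" "Min B + 2 < Max B"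
proof -
  have f: "finite B" "B \<noteq> {}" using finite_B assms card3[OF assms] by auto
  show 1: "Min B \<in> B" "Max B \<in> B" using f by auto
  show 2: "B \<subseteq> {Min B..Max B}" using f by auto
  show "Min B + 2 < Max B"
  proof (rule ccontr)
    assume "\<not> Min B + 2 < Max B"
    then have "x = Min B \<or> x = Suc (Min B) \<or> x = Min B + 2" if "x \<in> B" for x
      using subsetD[OF 2 that] by auto
    then have "B \<subseteq> {Min B, Min B + 2}"
      using no_consecutive[OF assms 1(1)] by blast
    then have "card B \<le> card {Min B, Min B + 2}" by (intro card_mono) auto
    then show False using card3[OF assms] by simp
  qed
qed

lemma finite_incidences: "finite (incidences s)"
proof -
  have "incidences s \<subseteq> {..<n} \<times> F s" using sub by (auto simp: incidences_def)
  then show ?thesis using finite_F finite_subset by blast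
qed

lemma corners_subset: "corners s \<subseteq> incidences s" by (auto simp: incidences_def corners_def)
lemma finite_corners: "finite (corners s)" using corners_subset finite_incidences finite_subset by blast

lemma parent_Some:
  assumes "parent s A = Some (y, B)"
  shows "(y, B) \<in> corners s" "B \<noteq> A" "A \<subseteq> {pred_in B y..y}"
    "\<And>y' B'. (y', B') \<in> candidates s A \<Longrightarrow> y - pred_in B y \<le> y' - pred_in B' y'"
proof -
  have ne: "candidates s A \<noteq> {}" using assms by (auto simp: parent_def split: if_splits)
  have f: "finite (candidates s A)" by (rule finite_subset[OF _ finite_corners[of s]]) (auto simp: candidates_def)
  have e: "arg_min_on (\<lambda>(y, B). y - pred_in B y) (candidates s A) = (y, B)" using assms ne by (auto simp: parent_def)
  have "(y, B) \<in> candidates s A" using arg_min_if_finite(1)[OF f ne] e by metis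
  then show "(y, B) \<in> corners s" "B \<noteq> A" "A \<subseteq> {pred_in B y..y}" by (auto simp: candidates_def)
  fix y' B' assume "(y', B') \<in> candidates s A"
  then show "y - pred_in B y \<le> y' - pred_in B' y'"
    using arg_min_least[OF f ne, of "(y', B')" "\<lambda>(y, B). y - pred_in B y"] e by auto
qed

lemma inside_corner:
  assumes c: "(y, B) \<in> corners s" and A: "A \<in> F s" "u \<in> A" "pred_in B y < u" "u < y"
  shows "A \<noteq> B" "A \<subseteq> {pred_in B y..y}"
proof -
  note d = cornersD[OF c]
  show "A \<noteq> B" using A d(5) by auto
  then show "A \<subseteq> {pred_in B y..y}"
    using noncross[OF d(1) A(1) _ d(3,2) A(2) _ A(3,4)] by auto
qed

definition extent :: "nat set \<Rightarrow> nat" where "extent A = Max A - Min A"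

text \<open>\<open>B\<close> has a third foot, and it lies outside the corner, so the hull of
  \<open>B\<close> is strictly longer than the interval. This makes nesting well-founded.\<close>

lemma extent_less:
  assumes c: "(y, B) \<in> corners s" and A: "A \<in> F s" "A \<subseteq> {pred_in B y..y}"
  shows "extent A < extent B"
proof -
  note d = cornersD[OF c]
  have "Min A \<in> A" "Max A \<in> A" using Min_Max A by auto
  then have 1: "pred_in B y \<le> Min A" "Max A \<le> y" using A by auto
  have f: "finite B" using finite_B d by blast
  have 2: "Min B \<le> pred_in B y" "y \<le> Max B" using d f by auto
  obtain e where e: "e \<in> B" "e \<noteq> pred_in B y" "e \<noteq> y" using third[OF d(1)] by blast
  have "e < pred_in B y \<or> y < e" using e emptyD[OF d(5) e(1)] by linarith
  moreover have "Min B \<le> e" "e \<le> Max B" using e f by auto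
  ultimately have "Min B < pred_in B y \<or> y < Max B" by linarith
  then show ?thesis using 1 2 d(4) Min_Max(4)[OF A(1)] unfolding extent_def by linarith
qed

text \<open>One step of the descent into a corner: if \<open>A\<close> does not hang directly below
  \<open>(y, B)\<close>, its innermost corner belongs to another bridge lying in the same interval.
  This turns the minimum in \<open>parent\<close> into a tree structure.\<close>

lemma nest:
  assumes c: "(y, B) \<in> corners s" and A: "A \<in> F s" "A \<noteq> B" "A \<subseteq> {pred_in B y..y}"
  obtains "A \<in> children s (y, B)"
  | y2 B2 where "parent s A = Some (y2, B2)" "(y2, B2) \<in> corners s" "B2 \<noteq> B" "B2 \<subseteq> {pred_in B y..y}" "A \<subseteq> {pred_in B2 y2..y2}"
proof -
  note d = cornersD[OF c]
  have cd: "(y, B) \<in> candidates s A" using c A by (auto simp: candidates_def)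
  then have "candidates s A \<noteq> {}" by blast
  then obtain k where "parent s A = Some k" by (simp add: parent_def)
  then obtain y2 B2 where p: "parent s A = Some (y2, B2)" by (cases k) auto
  note ps = parent_Some[OF p] and d2 = cornersD[OF parent_Some(1)[OF p]]
  show ?thesis
  proof (cases "(y2, B2) = (y, B)")
    case True
    then show ?thesis using that(1) p A by (auto simp: children_def)
  next
    case False
    \<comment> \<open>The middle foot \<open>u\<close> of \<open>A\<close> is strictly inside both
      corners; two corners of the same bridge have disjoint interiors, hence \<open>B2\<close>
      differs from \<open>B\<close>.\<close>
    obtain u where u: "u \<in> A" "u \<noteq> Min A" "u \<noteq> Max A" using third[OF A(1)] by blast
    have "Min A < u" "u < Max A" using u Min_Max(3)[OF A(1)] by (auto simp: order_less_le)
    then have ui: "pred_in B y < u" "u < y" "pred_in B2 y2 < u" "u < y2"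
      using Min_Max(1,2)[OF A(1)] A(3) ps(3) by fastforce+
    have le: "y2 - pred_in B2 y2 \<le> y - pred_in B y" using ps(4)[OF cd] .
    have BB: "B2 \<noteq> B"
    proof
      assume eq: "B2 = B"
      then have "y2 \<noteq> y" using False by simp
      then consider "y2 < y" | "y < y2" by linarith
      then show False
      proof cases
        case 1 then have "y2 \<in> {pred_in B y<..<y} \<inter> B" using ui d2 eq by auto
        then show False using d(5) by auto
      next
        case 2 then have "y \<in> {pred_in B2 y2<..<y2} \<inter> B2" using ui d eq by auto
        then show False using d2(5) by auto
      qed
    qed
    have "B2 \<subseteq> {pred_in B y..y}"
    proof (cases "\<exists>z\<in>B2. pred_in B y < z \<and> z < y")
      case True
      then show ?thesis using inside_corner[OF c d2(1)] by blast
    next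
      \<comment> \<open>The corner of \<open>B2\<close> would contain that of \<open>B\<close>;
        minimal width makes the intervals equal, and \<open>corner_unique\<close> applies.\<close>
      case F: False
      then have "pred_in B2 y2 \<le> pred_in B y" "y \<le> y2" using d2 ui by (meson not_le order_less_trans)+
      then have "pred_in B2 y2 = pred_in B y" "y2 = y" using le d(4) d2(4) by linarith+
      then have "B2 = B" using corner_unique[OF d2(1) d(1), of "pred_in B y" y] d d2 by auto
      then show ?thesis using BB by simp
    qed
    then show ?thesis using that(2) p ps BB by blast
  qed
qed

text \<open>A foot inside would give bridges inside the interval; one of largest extent has no other
  bridge of the interval around it, so by \<open>nest\<close> it would be a child.\<close>

lemma leaf_unatt:
  assumes c: "(y, B) \<in> corners s" and "children s (y, B) = {}"
  shows "{pred_in B y<..<y} \<inter> attached s = {}"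
proof (rule ccontr)
  assume "{pred_in B y<..<y} \<inter> attached s \<noteq> {}"
  then obtain u A0 where u: "pred_in B y < u" "u < y" "A0 \<in> F s" "u \<in> A0" by (auto simp: attached_iff)
  let ?S = "{A \<in> F s. A \<noteq> B \<and> A \<subseteq> {pred_in B y..y}}"
  have f: "finite ?S" using finite_F by simp
  have "A0 \<in> ?S" using inside_corner[OF c u(3,4,1,2)] u by auto
  then have ne: "?S \<noteq> {}" by blast
  obtain A where A: "A \<in> ?S" "\<forall>A'\<in>?S. extent A' \<le> extent A"
  proof -
    have "Max (extent ` ?S) \<in> extent ` ?S" using f ne by (intro Max_in) auto
    then obtain A where "A \<in> ?S" "extent A = Max (extent ` ?S)" by (metis (lifting) imageE)
    then show ?thesis using that f by (metis (no_types, lifting) Max_ge finite_imageI imageI)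
  qed
  show False
  proof (rule nest[OF c, of A])
    show "A \<in> F s" "A \<noteq> B" "A \<subseteq> {pred_in B y..y}" using A by auto
    show "A \<in> children s (y, B) \<Longrightarrow> False" using assms by simp
    fix y2 B2 assume h: "(y2, B2) \<in> corners s" "B2 \<noteq> B" "B2 \<subseteq> {pred_in B y..y}" "A \<subseteq> {pred_in B2 y2..y2}"
    then have "B2 \<in> ?S" using cornersD(1)[OF h(1)] by simp
    then have "extent B2 \<le> extent A" using A(2) by blast
    then show False using extent_less[OF h(1) _ h(4)] A(1) by simp
  qed
qed

text \<open>Induction outwards: \<open>nest\<close> replaces \<open>A\<close> by a strictly longer
  bridge in the same interval until the only child is reached.\<close>

lemma one_child_nest:
  assumes c: "(y, B) \<in> corners s" and children: "children s (y, B) = {C}" and A: "A \<in> F s" "A \<noteq> B" "A \<subseteq> {pred_in B y..y}"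
  shows "A = C \<or> (\<exists>z. (z, C) \<in> corners s \<and> A \<subseteq> {pred_in C z..z})"
  using A
proof (induction "n - extent A" arbitrary: A rule: less_induct)
  case less
  show ?case
  proof (rule nest[OF c less(2,3,4)])
    assume "A \<in> children s (y, B)" then show ?thesis using children by simp
  next
    fix y2 B2 assume h: "(y2, B2) \<in> corners s" "B2 \<noteq> B" "B2 \<subseteq> {pred_in B y..y}" "A \<subseteq> {pred_in B2 y2..y2}"
    note d2 = cornersD[OF h(1)]
    have "extent A < extent B2" using extent_less[OF h(1) less(2) h(4)] .
    moreover have "extent B2 < n" using Min_Max(2)[OF d2(1)] sub[OF d2(1)] by (auto simp: extent_def less_imp_diff_less)
    ultimately have "n - extent B2 < n - extent A" by linarith
    from less(1)[OF this d2(1) h(2,3)] consider "B2 = C" | z where "(z, C) \<in> corners s" "B2 \<subseteq> {pred_in C z..z}" by blast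
    then show ?thesis
    proof cases
      case 1 then show ?thesis using h by blast
    next
      case 2
      then have "pred_in C z \<le> pred_in B2 y2" "y2 \<le> z" using d2 by auto
      then have "A \<subseteq> {pred_in C z..z}" using h(4) by force
      then show ?thesis using 2 by blast
    qed
  qed
qed

section \<open>Order of the bridges at a common foot, and faces with two bridges\<close>

lemma key_le: "\<lbrakk>B \<in> F s; x \<in> B; x \<noteq> v\<rbrakk> \<Longrightarrow> key v B \<le> rot v x"
  using finite_B[of B s] by (auto simp: key_def intro!: Min_le)

lemma key_ex: assumes "B \<in> F s" obtains x where "x \<in> B" "x \<noteq> v" "key v B = rot v x"
proof -
  have "key v B \<in> rot v ` (B - {v})" unfolding key_def
    using third[OF assms, of v v] finite_B[OF assms] by (intro Min_in) auto
  then show ?thesis using that by auto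
qed

text \<open>Not being a pinch means having the largest key at \<open>y\<close>. A bridge at
  \<open>y\<close> with a larger key has its next foot later in cyclic order than \<open>B\<close>;
  with no foot in the corner it would have to cross \<open>B\<close>.\<close>

lemma nonpinch_corner:
  assumes c: "(y, B) \<in> corners s" and n: "\<And>A. \<lbrakk>A \<in> F s; y \<in> A; A \<noteq> B\<rbrakk> \<Longrightarrow> A \<inter> {pred_in B y<..<y} = {}"
  shows "\<not> pinch s y B"
proof
  assume "pinch s y B"
  then obtain A where A: "A \<in> F s" "y \<in> A" "key y B < key y A" by (auto simp: pinch_def)
  note d = cornersD[OF c]
  have ne: "A \<noteq> B" using A by auto
  note e = n[OF A(1,2) ne]
  obtain b where b: "b \<in> B" "b \<noteq> y" "key y B = rot y b" using key_ex[OF d(1)] by blast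
  let ?x = "pred_in B y"
  have xA: "?x \<notin> A" using corner_unique[OF A(1) d(1), of ?x y] d A ne e by blast
  obtain a where a: "a \<in> A" "a \<noteq> y" using third[OF A(1), of y y] by blast
  have ao: "a < ?x \<or> y < a" using a emptyD[of ?x y A a] e xA by (metis Int_commute order_le_less)
  have bo: "b \<le> ?x \<or> y < b" using b emptyD[OF d(5) b(1)] by linarith
  have lt: "rot y b < rot y a" using key_le[OF A(1) a] b A(3) by simp
  have bl: "a < n" "b < n" "y < n" using B_less A a d b by blast+
  have "y < a \<Longrightarrow> y < b \<Longrightarrow> b < a" "\<not> y < a \<Longrightarrow> \<not> y < b \<Longrightarrow> b < a" using lt by (simp_all add: rot_def)
  then have ab: "y < a \<Longrightarrow> y < b \<Longrightarrow> b < a" "a < ?x \<Longrightarrow> b \<le> ?x \<Longrightarrow> b < a" using d(4) by auto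
  note nc1 = noncross[OF A(1) d(1) ne] and nc2 = noncross[OF d(1) A(1) ne[symmetric]]
  show False
  proof (cases "y < b")
    case True
    then show False using ao ab(1) nc1[OF A(2) a(1) b(1) d(3)] nc1[OF a(1) A(2) d(3) b(1)] d(4) by linarith
  next
    case False
    then have "\<not> y < a" using lt bl d(4) by (auto simp: rot_def)
    then show False using False ao bo ab(2) nc2[OF b(1) d(3) a(1) A(2)] d(4) by linarith
  qed
qed

lemma leaf_nonpinch:
  assumes c: "(y, B) \<in> corners s" and "{pred_in B y<..<y} \<inter> attached s = {}"
  shows "\<not> pinch s y B"
  using assms by (intro nonpinch_corner) (auto simp: attached_def)

text \<open>Every other bridge inside the corner lies in a corner of the only child, so nothing
  comes between \<open>B\<close> and \<open>C\<close> along the two runs of the face, from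
  \<open>pred_in B y\<close> to \<open>Min C\<close> and from \<open>Max C\<close> to
  \<open>y\<close>. A run shrinks to a point exactly when it is a pinch.\<close>

lemma one_child:
  assumes c: "(y, B) \<in> corners s" and children: "children s (y, B) = {C}"
  defines "x \<equiv> pred_in B y" and "l \<equiv> Min C" and "r \<equiv> Max C"
  shows "C \<in> F s" "C \<noteq> B" "x \<le> l" "l + 2 < r" "r \<le> y" "{x<..<l} \<inter> attached s = {}" "{r<..<y} \<inter> attached s = {}"
    "x < l \<Longrightarrow> \<not> pinch s l C" "x = l \<Longrightarrow> pinch s l C" "r < y \<Longrightarrow> \<not> pinch s y B" "r = y \<Longrightarrow> pinch s y B"
proof -
  note d = cornersD[OF c]
  have "C \<in> children s (y, B)" using children by simp
  then have p: "C \<in> F s" "parent s C = Some (y, B)" by (auto simp: children_def)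
  show C: "C \<in> F s" by fact
  show CB: "C \<noteq> B" using parent_Some(2)[OF p(2)] by blast
  have Cs: "C \<subseteq> {x..y}" using parent_Some(3)[OF p(2)] by (simp add: x_def)
  note mm = Min_Max[OF C, folded l_def r_def]
  show xl: "x \<le> l" and ry: "r \<le> y" using mm Cs by auto
  show lr: "l + 2 < r" using mm by simp
  have cn: "A = C \<or> (\<exists>z. (z, C) \<in> corners s \<and> A \<subseteq> {pred_in C z..z})" if "A \<in> F s" "u \<in> A" "x < u" "u < y" for A u
    using one_child_nest[OF c children that(1)] inside_corner[OF c that(1,2)] that x_def by auto
  have cn2: "A \<subseteq> {l..r}" if "A \<in> F s" "u \<in> A" "x < u" "u < y" for A u
  proof -
    from cn[OF that] consider "A = C" | z where "(z, C) \<in> corners s" "A \<subseteq> {pred_in C z..z}" by blast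
    then show ?thesis
    proof cases
      case 2
      then have "l \<le> pred_in C z" "z \<le> r" using cornersD[OF 2(1)] mm(3) by auto
      then show ?thesis using 2 by force
    qed (use mm in simp)
  qed
  have cn3: "l \<le> u \<and> u \<le> r" if "A \<in> F s" "u \<in> A" "x < u" "u < y" for A u
    using cn2[OF that] that(2) by auto
  show "{x<..<l} \<inter> attached s = {}"
  proof (rule ccontr)
    assume "{x<..<l} \<inter> attached s \<noteq> {}"
    then obtain u A where "A \<in> F s" "u \<in> A" "x < u" "u < l" by (auto simp: attached_iff)
    then show False using cn3[of A u] lr ry by linarith
  qed
  show "{r<..<y} \<inter> attached s = {}"
  proof (rule ccontr)
    assume "{r<..<y} \<inter> attached s \<noteq> {}"
    then obtain u A where "A \<in> F s" "u \<in> A" "r < u" "u < y" by (auto simp: attached_iff)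
    then show False using cn3[of A u] lr xl by linarith
  qed
  \<comment> \<open>A bridge at \<open>l\<close> other than \<open>C\<close> lies in the corner of
    \<open>C\<close> that starts at \<open>l\<close>, so its key is smaller than that of
    \<open>C\<close>.\<close>
  show "\<not> pinch s l C" if xl1: "x < l"
  proof
    assume "pinch s l C"
    then obtain A where A: "A \<in> F s" "l \<in> A" "key l C < key l A" by (auto simp: pinch_def)
    have "A \<noteq> C" using A by auto
    moreover have ly: "l < y" using lr ry by linarith
    ultimately obtain z where z: "(z, C) \<in> corners s" "A \<subseteq> {pred_in C z..z}" using cn[OF A(1,2) xl1 ly] by blast
    note dz = cornersD[OF z(1)]
    have pl: "pred_in C z = l" using dz mm A z by (metis atLeastAtMost_iff le_antisym subsetD)
    obtain e where e: "e \<in> A" "e \<noteq> l" "e \<noteq> z" using third[OF A(1)] by blast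
    have el: "l < e" "e < z" using e z pl by (auto simp: order_less_le)
    have "key l A \<le> e - l" using key_le[OF A(1) e(1,2)] el by (simp add: rot_def)
    moreover obtain f where f: "f \<in> C" "f \<noteq> l" "key l C = rot l f" using key_ex[OF C] by blast
    then have "l < f" using mm by (auto simp: order_less_le)
    moreover have "z \<le> f" using emptyD[OF dz(5) f(1)] pl \<open>l < f\<close> by simp
    ultimately show False using A(3) f el by (auto simp: rot_def)
  qed
  \<comment> \<open>\<open>B\<close> has no foot strictly between \<open>l\<close> and
    \<open>y\<close>, while \<open>C\<close> does, so \<open>B\<close> has the larger key at
    \<open>l\<close>.\<close>
  show "pinch s l C" if xe: "x = l"
  proof -
    obtain f where f: "f \<in> B" "f \<noteq> l" "key l B = rot l f" using key_ex[OF d(1)] by blast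
    have "f < n" "l < n" "y < n" using B_less d f mm C by blast+
    moreover have "f < l \<or> y \<le> f" using f emptyD[OF d(5) f(1)] xe[unfolded x_def] by linarith
    ultimately have 1: "y - l \<le> key l B" using f by (auto simp: rot_def)
    obtain e where e: "e \<in> C" "e \<noteq> l" "e \<noteq> y" using third[OF C] by blast
    then have "l < e" "e < y" using Cs mm by (auto simp: order_less_le)
    then have "key l C < y - l" using key_le[OF C e(1,2)] by (simp add: rot_def)
    then show ?thesis using 1 d xe x_def unfolding pinch_def by (metis order_less_le_trans)
  qed
  show "\<not> pinch s y B" if "r < y"
  proof (rule nonpinch_corner[OF c])
    fix A assume A: "A \<in> F s" "y \<in> A" "A \<noteq> B"
    show "A \<inter> {pred_in B y<..<y} = {}"
    proof (rule ccontr)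
      assume "A \<inter> {pred_in B y<..<y} \<noteq> {}"
      then obtain u where "u \<in> A" "x < u" "u < y" by (auto simp: x_def)
      then show False using cn2[OF A(1)] A(2) that by fastforce
    qed
  qed
  \<comment> \<open>Going on from \<open>y\<close>, the third foot of \<open>B\<close> comes up
    before the cyclic order reaches \<open>x\<close>, hence before any foot of
    \<open>C\<close>.\<close>
  show "pinch s y B" if re: "r = y"
  proof -
    obtain f where f: "f \<in> C" "f \<noteq> y" "key y C = rot y f" using key_ex[OF C] by blast
    have fy: "l \<le> f" "f < y" using f mm re by (auto simp: order_less_le)
    obtain b where b: "b \<in> B" "b \<noteq> x" "b \<noteq> y" using third[OF d(1)] by blast
    have "b < x \<or> y < b" using b emptyD[OF d(5) b(1)] unfolding x_def by linarith
    moreover have "b < n" "y < n" using B_less d b by blast+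
    ultimately have "rot y b < rot y f" using fy xl d(4)[folded x_def] by (auto simp: rot_def)
    then have "key y B < key y C" using key_le[OF d(1) b(1,3)] f by simp
    then show ?thesis using C mm(2) re unfolding pinch_def by blast
  qed
qed

end

section \<open>Demands on runs and the balance of a single face\<close>

context ring_system begin

text \<open>
  Holds for the run from u to v if it cannot meet the demands on it; in a face with two bridges
  the other run is then long enough to pay for both.
\<close>

definition separated :: "bool \<Rightarrow> nat \<Rightarrow> nat \<Rightarrow> bool" where
  "separated t u v \<longleftrightarrow> (\<forall>P\<in>F t. \<forall>Q\<in>F t. P \<noteq> Q \<longrightarrow> u \<in> P \<longrightarrow> v \<in> Q \<longrightarrow>
     (\<forall>p\<in>P. \<forall>q\<in>Q. (v < q \<and> q < p \<or> q < p \<and> p < u) \<longrightarrow> q + 4 \<le> p))"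

text \<open>Bridges have no consecutive feet, so \<open>q = v + 1\<close> and
  \<open>p + 1 = u\<close> cannot occur; the remaining cases are those of the detours.\<close>

lemma separatedI:
  assumes "\<And>P Q p q. \<lbrakk>P \<in> F t; Q \<in> F t; P \<noteq> Q; u \<in> P; v \<in> Q; p \<in> P; q \<in> Q; v + 1 < q; q < p\<rbrakk> \<Longrightarrow> q + 4 \<le> p"
    and "\<And>P Q p q. \<lbrakk>P \<in> F t; Q \<in> F t; P \<noteq> Q; u \<in> P; v \<in> Q; p \<in> P; q \<in> Q; q < p; p + 1 < u\<rbrakk> \<Longrightarrow> q + 4 \<le> p"
  shows "separated t u v"
  unfolding separated_def
proof (intro ballI impI)
  fix P Q p q assume h: "P \<in> F t" "Q \<in> F t" "P \<noteq> Q" "u \<in> P" "v \<in> Q" "p \<in> P" "q \<in> Q"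
    and c: "v < q \<and> q < p \<or> q < p \<and> p < u"
  from no_consecutive[OF h(2,5)] h(7) have "q \<noteq> Suc v" by blast
  moreover from no_consecutive[OF h(1,6)] h(4) have "u \<noteq> Suc p" by blast
  ultimately have "v + 1 < q \<and> q < p \<or> q < p \<and> p + 1 < u" using c by linarith
  then show "q + 4 \<le> p" using assms h by blast
qed

lemma separatedD: "\<lbrakk>separated t u v; P \<in> F t; Q \<in> F t; P \<noteq> Q; u \<in> P; v \<in> Q; p \<in> P; q \<in> Q;
   v < q \<and> q < p \<or> q < p \<and> p < u\<rbrakk> \<Longrightarrow> q + 4 \<le> p"
  unfolding separated_def by blast

lemma gap_eq: assumes "u \<in> attached t" "u < v" "{u<..<v} \<inter> attached t = {}" shows "gap t v = v - u - 1"
proof -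
  have "{w. w < v \<and> {w..<v} \<inter> attached t = {}} = {u<..<v}"
  proof (intro set_eqI iffI)
    fix w assume "w \<in> {w. w < v \<and> {w..<v} \<inter> attached t = {}}"
    then have w: "w < v" "{w..<v} \<inter> attached t = {}" by auto
    then have "u \<notin> {w..<v}" using assms(1) by blast
    then show "w \<in> {u<..<v}" using w assms by auto
  next
    fix w assume "w \<in> {u<..<v}"
    then have "{w..<v} \<subseteq> {u<..<v}" by auto
    then show "w \<in> {w. w < v \<and> {w..<v} \<inter> attached t = {}}" using assms(3) \<open>w \<in> _\<close> by auto
  qed
  then show ?thesis by (simp add: gap_def)
qed

lemma gap_pos: assumes "v = Suc a" "a \<notin> attached t" shows "0 < gap t v"
proof -
  have "{a..<v} \<inter> attached t = {}" using assms by (auto simp: less_Suc_eq_le)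
  then have "a \<in> {u. u < v \<and> {u..<v} \<inter> attached t = {}}" using assms by auto
  then show ?thesis unfolding gap_def by (auto simp: card_gt_0_iff)
qed

lemma leaf_less: "leaf1 s a \<Longrightarrow> a + 2 < n" "leaf2 s a \<Longrightarrow> a + 3 < n" "leaf3 s a \<Longrightarrow> a + 4 < n"
  unfolding leaf1_def leaf2_def leaf3_def using B_less by blast+

lemma leaf1_attached: "leaf1 s a \<Longrightarrow> a + 1 \<in> attached (\<not> s)" using cover'[of "a + 1" s] leaf_less(1)[of s a] by (auto simp: leaf1_def)
lemma leaf1_attached': "leaf1 (\<not> s) a \<Longrightarrow> a + 1 \<in> attached s" using leaf1_attached[of "\<not> s" a] by simp
lemma leaf2_attached: "leaf2 (\<not> s) a \<Longrightarrow> a + 1 \<in> attached s \<and> a + 2 \<in> attached s"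
  using cover'[of "a + 1" "\<not> s"] cover'[of "a + 2" "\<not> s"] leaf_less(2)[of "\<not> s" a] by (auto simp: leaf2_def)
lemma leaf3_attached: "leaf3 (\<not> s) a \<Longrightarrow> a + 1 \<in> attached s \<and> a + 2 \<in> attached s \<and> a + 3 \<in> attached s"
  using cover'[of "a + 1" "\<not> s"] cover'[of "a + 2" "\<not> s"] cover'[of "a + 3" "\<not> s"] leaf_less(3)[of "\<not> s" a]
  by (auto simp: leaf3_def)

lemma edge_demand_attached: "edge_demand t v \<Longrightarrow> \<exists>u. v = Suc u \<and> u \<in> attached t \<and> v \<in> attached t"
  unfolding edge_demand_def using leaf2_attached[of t] leaf3_attached[of t] by (auto simp: numeral_eq_Suc)

lemma end_demand_attached: "end_demand t v \<Longrightarrow> \<exists>a. v = Suc a \<and> a \<notin> attached t \<and> v \<in> attached t"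
  unfolding end_demand_def using leaf1_attached'[of t] by auto

lemma start_demandE:
  assumes "start_demand t v" "u \<in> attached t" "u < v" "{u<..<v} \<inter> attached t = {}"
  obtains a where "u = a + 1" "leaf1 (\<not> t) a" "a + 3 \<le> v"
proof -
  obtain a where a: "leaf1 (\<not> t) a" "a + 2 < v" "{a + 2..<v} \<inter> attached t = {}" using assms(1) by (auto simp: start_demand_def)
  have 1: "a + 1 \<in> attached t" using leaf1_attached'[OF a(1)] .
  have "u \<notin> {a + 2..<v}" using a assms by blast
  moreover have "a + 1 \<notin> {u<..<v}" using 1 assms by blast
  ultimately have "u = a + 1" using assms(3) a(2) by auto
  then show ?thesis using that a by auto
qed

text \<open>Of the four places only \<open>x + 1\<close> and \<open>x + 3\<close> avoid consecutive
  feet, too few for a bridge. This excludes bridges that noncrossing squeezes into a short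
  interval.\<close>

lemma two_elems:
  assumes "A \<in> F s" "A \<subseteq> {x..z}" "y \<in> A" "y = x + 1" "z \<le> x + 3" shows False
proof -
  have "x \<notin> A" "x + 2 \<notin> A" using no_consecutive[OF assms(1), of x] no_consecutive[OF assms(1), of "x + 1"] assms(3,4) by auto
  then have "a = x + 1 \<or> a = x + 3" if "a \<in> A" for a
  proof -
    have "a = x \<or> a = x + 1 \<or> a = x + 2 \<or> a = x + 3" using subsetD[OF assms(2) that] assms(5) by auto
    then show ?thesis using that \<open>x \<notin> A\<close> \<open>x + 2 \<notin> A\<close> by auto
  qed
  then have "A \<subseteq> {x + 1, x + 3}" by blast
  then have "card A \<le> card {x + 1, x + 3}" by (intro card_mono) auto
  then show False using card3[OF assms(1)] by simp
qed

text \<open>An empty run from which a unit is demanded is enclosed by the feet of a bridge of the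
  other side, so entering at \<open>u\<close> through \<open>P\<close> and leaving at
  \<open>v\<close> through \<open>Q\<close> gives a detour. The three kinds of
  \<open>edge_demand\<close> correspond to the three pairs of detour assumptions.\<close>

lemma separated_edge_demand:
  assumes "edge_demand t v" "v = Suc u" shows "separated t u v"
proof -
  from assms(1) consider a where "v = a + 2" "leaf2 (\<not> t) a"
    | y where "v = y + 3" "leaf3 (\<not> t) y" "start_demand (\<not> t) (y + 4)"
    | y where "v = y + 2" "leaf3 (\<not> t) y" "end_demand (\<not> t) (y + 4)" unfolding edge_demand_def by blast
  then show ?thesis
  proof cases
    case 1
    then obtain w where w: "w \<in> F (\<not> t)" "a \<in> w" "a + 3 \<in> w" by (auto simp: leaf2_def)
    have e: "u = a + 1" "a + 1 \<le> v" "v + 1 = a + 3" using assms 1 by auto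
    note w3 = w(3)[folded e(3)]
    show ?thesis
    proof (rule separatedI)
      fix P Q p q assume h: "P \<in> F t" "Q \<in> F t" "P \<noteq> Q" "u \<in> P" "v \<in> Q" "p \<in> P" "q \<in> Q" "v + 1 < q" "q < p"
      show "q + 4 \<le> p" by (rule detour_after[where s = "\<not> t", unfolded not_not, OF w(1) h(1,2,3) w(2) w3 h(4)[unfolded e(1)] h(5) e(2) h(7,6,8,9)])
    next
      fix P Q p q assume h: "P \<in> F t" "Q \<in> F t" "P \<noteq> Q" "u \<in> P" "v \<in> Q" "p \<in> P" "q \<in> Q" "q < p" "p + 1 < u"
      show "q + 4 \<le> p" using h(9) e(1) by (intro detour_before[where s = "\<not> t", unfolded not_not, OF w(1) h(1,2,3) w(2) w3 h(4)[unfolded e(1)] h(5) e(2) h(7,6,8)]) simp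
    qed
  next
    \<comment> \<open>The asking leaf of side \<open>t\<close> sits at \<open>a\<close> with
      \<open>y = a + 1\<close>; its bridge \<open>w\<close> and the bridge \<open>D\<close> carry
      the circuit past the run, which is \<open>a + 3\<close>, \<open>a + 4\<close>.\<close>
    case 2
    then obtain D where D: "D \<in> F (\<not> t)" "y \<in> D" "y + 4 \<in> D" "y + 1 \<notin> attached (\<not> t)" "y + 2 \<notin> attached (\<not> t)" "y + 3 \<notin> attached (\<not> t)"
      by (auto simp: leaf3_def)
    have e1: "{y<..<y + 4} \<inter> attached (\<not> t) = {}"
    proof (rule ccontr)
      assume "\<not> ?thesis"
      then obtain x where "x \<in> attached (\<not> t)" "y < x" "x < y + 4" by auto
      then have "x = y + 1 \<or> x = y + 2 \<or> x = y + 3" by linarith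
      then show False using D \<open>x \<in> _\<close> by auto
    qed
    obtain a where a: "y = a + 1" "leaf1 t a" using start_demandE[OF 2(3), of y] e1 D by (auto simp: attached_iff)
    then obtain w where w: "w \<in> F t" "a \<in> w" "a + 2 \<in> w" by (auto simp: leaf1_def)
    have e: "u = a + 3" "v = a + 4" using a 2 assms by auto
    have D': "a + 1 \<in> D" "a + 5 \<in> D" using D(2,3) a(1) by (simp_all add: eval_nat_numeral)
    \<comment> \<open>\<open>w\<close> has the foot \<open>a + 2\<close> next to
      \<open>a + 3\<close>, so it is not \<open>P\<close>; if it were \<open>Q\<close>, it would
      squeeze \<open>P\<close> into the places from \<open>a + 2\<close> to
      \<open>a + 4\<close>.\<close>
    have ne: "w \<noteq> P \<and> w \<noteq> Q" if h: "P \<in> F t" "Q \<in> F t" "P \<noteq> Q" "u \<in> P" "v \<in> Q" for P Q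
    proof -
      have "w \<noteq> P" using no_consecutive[OF w(1,3)] h(4) e by (auto simp: eval_nat_numeral)
      moreover have "w \<noteq> Q"
      proof
        assume "w = Q"
        then have "P \<subseteq> {a + 2..a + 4}" using noncross[OF w(1) h(1) \<open>w \<noteq> P\<close> w(3), of "a + 4" u] h e by auto
        from two_elems[OF h(1) this h(4)] show False using e by simp
      qed
      ultimately show ?thesis by blast
    qed
    show ?thesis
    proof (rule separatedI)
      fix P Q p q assume h: "P \<in> F t" "Q \<in> F t" "P \<noteq> Q" "u \<in> P" "v \<in> Q" "p \<in> P" "q \<in> Q" "v + 1 < q" "q < p"
      have "a + 5 < q" using h(8) e by simp
      then show "q + 4 \<le> p" using ne[OF h(1-5)] h(9)
        by (intro left_detour_after[OF w(1) h(1,2) _ _ h(3) D(1) w(2,3) D' h(4)[unfolded e] h(5)[unfolded e] h(7,6)]) simp_all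
    next
      fix P Q p q assume h: "P \<in> F t" "Q \<in> F t" "P \<noteq> Q" "u \<in> P" "v \<in> Q" "p \<in> P" "q \<in> Q" "q < p" "p + 1 < u"
      have "p \<noteq> y" using D a h(1,6) leaf1_def by (auto simp: attached_iff)
      then have "p \<le> a" using h(9) e a by simp
      then show "q + 4 \<le> p" using ne[OF h(1-5)] h(8)
        by (intro left_detour_before[OF w(1) h(1,2) _ _ h(3) D(1) w(2,3) D' h(4)[unfolded e] h(5)[unfolded e] h(7,6)]) simp_all
    qed
  next
    \<comment> \<open>Mirror image: the asking leaf starts at \<open>y + 3\<close>, and the run is
      \<open>y + 1\<close>, \<open>y + 2\<close>.\<close>
    case 3
    then obtain D where D: "D \<in> F (\<not> t)" "y \<in> D" "y + 4 \<in> D" by (auto simp: leaf3_def)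
    from 3 have l: "leaf1 t (y + 3)" unfolding end_demand_def by (auto simp: eval_nat_numeral)
    then obtain w where w: "w \<in> F t" "y + 3 \<in> w" "y + 5 \<in> w" by (auto simp: leaf1_def eval_nat_numeral)
    have e: "u = y + 1" "v = y + 2" using 3 assms by auto
    have ne: "w \<noteq> P \<and> w \<noteq> Q" if h: "P \<in> F t" "Q \<in> F t" "P \<noteq> Q" "u \<in> P" "v \<in> Q" for P Q
    proof -
      have "w \<noteq> Q" using no_consecutive[OF h(2,5)] w(2) e by (auto simp: eval_nat_numeral)
      moreover have "w \<noteq> P"
      proof
        assume "w = P"
        then have "Q \<subseteq> {y + 1..y + 3}" using noncross[OF w(1) h(2) \<open>w \<noteq> Q\<close>, of "y + 1" "y + 3" v] h e w by auto
        from two_elems[OF h(2) this h(5)] show False using e by simp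
      qed
      ultimately show ?thesis by blast
    qed
    show ?thesis
    proof (rule separatedI)
      fix P Q p q assume h: "P \<in> F t" "Q \<in> F t" "P \<noteq> Q" "u \<in> P" "v \<in> Q" "p \<in> P" "q \<in> Q" "v + 1 < q" "q < p"
      have "q \<noteq> y + 4" using l h(2,7) by (auto simp: leaf1_def attached_iff eval_nat_numeral)
      then have "y + 5 \<le> q" using h e by simp
      then show "q + 4 \<le> p" using ne[OF h(1-5)] h(9)
        by (intro right_detour_after[OF w(1) h(1,2) _ _ h(3) D(1) w(2,3) D(2,3) h(4)[unfolded e] h(5)[unfolded e] h(7,6)]) simp_all
    next
      fix P Q p q assume h: "P \<in> F t" "Q \<in> F t" "P \<noteq> Q" "u \<in> P" "v \<in> Q" "p \<in> P" "q \<in> Q" "q < p" "p + 1 < u"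
      have "p < y" using h(9) e by simp
      then show "q + 4 \<le> p" using ne[OF h(1-5)] h(8)
        by (intro right_detour_before[OF w(1) h(1,2) _ _ h(3) D(1) w(2,3) D(2,3) h(4)[unfolded e] h(5)[unfolded e] h(7,6)]) simp_all
    qed
  qed
qed

text \<open>The condition \<open>mult = 1\<close> in \<open>end_demand\<close> is made for this: the
  leaves at both ends of a run with one position share the foot \<open>u + 1\<close>, so they belong
  to one bridge \<open>w\<close>. It has feet just before \<open>u\<close> and just after
  \<open>v\<close>, and the detours apply. With several bridges at that foot the left demand goes to
  a pinch instead.\<close>

lemma separated_end_start:
  assumes "end_demand t v" "start_demand t v" "v = u + 2" "u \<in> attached t" "{u<..<v} \<inter> attached t = {}" shows "separated t u v"
proof -
  obtain a where a: "u = a + 1" "leaf1 (\<not> t) a" using start_demandE[OF assms(2,4) _ assms(5)] assms(3) by auto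
  from assms(1,3) have E: "leaf1 (\<not> t) (u + 1)" "mult (\<not> t) (u + 1) = 1" by (auto simp: end_demand_def)
  obtain w where w: "w \<in> F (\<not> t)" "a \<in> w" "a + 2 \<in> w" using a by (auto simp: leaf1_def)
  obtain w' where w': "w' \<in> F (\<not> t)" "u + 1 \<in> w'" "u + 3 \<in> w'" using E by (auto simp: leaf1_def numeral_eq_Suc)
  obtain W where W: "{B \<in> F (\<not> t). u + 1 \<in> B} = {W}"
    using E(2) unfolding mult_def by (rule card_1_singletonE)
  have "w \<in> {B \<in> F (\<not> t). u + 1 \<in> B}" "w' \<in> {B \<in> F (\<not> t). u + 1 \<in> B}" using w w' a by auto
  then have "w = w'" unfolding W by simp
  then have w3: "v + 1 \<in> w" using w' assms(3) by (auto simp: eval_nat_numeral)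
  have e: "u = a + 1" "a + 1 \<le> v" using a assms(3) by auto
  show ?thesis
  proof (rule separatedI)
    fix P Q p q assume h: "P \<in> F t" "Q \<in> F t" "P \<noteq> Q" "u \<in> P" "v \<in> Q" "p \<in> P" "q \<in> Q" "v + 1 < q" "q < p"
    show "q + 4 \<le> p" by (rule detour_after[where s = "\<not> t", unfolded not_not, OF w(1) h(1,2,3) w(2) w3 h(4)[unfolded e(1)] h(5) e(2) h(7,6,8,9)])
  next
    fix P Q p q assume h: "P \<in> F t" "Q \<in> F t" "P \<noteq> Q" "u \<in> P" "v \<in> Q" "p \<in> P" "q \<in> Q" "q < p" "p + 1 < u"
    show "q + 4 \<le> p" using h(9) e(1) by (intro detour_before[where s = "\<not> t", unfolded not_not, OF w(1) h(1,2,3) w(2) w3 h(4)[unfolded e(1)] h(5) e(2) h(7,6,8)]) simp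
  qed
qed

definition net :: "bool \<Rightarrow> nat \<times> nat set \<Rightarrow> int" where "net t i = weight t i - demand t i"

text \<open>Only few demands fit a run, depending on its number of inner positions: with none, just
  \<open>edge_demand\<close>; with one, just \<open>end_demand\<close> and
  \<open>start_demand\<close>; with two or more, again at most these two. So a run lacks at most one
  unit.\<close>

lemma net_run:
  assumes "u \<in> attached t" "u < v" "{u<..<v} \<inter> attached t = {}" "\<not> pinch t v B"
  shows "- 1 \<le> net t (v, B)" "net t (v, B) < 0 \<Longrightarrow> separated t u v" "u + 4 \<le> v \<Longrightarrow> 1 \<le> net t (v, B)"
proof -
  have g: "net t (v, B) = int (v - u - 1) - (of_bool (end_demand t v) + of_bool (start_demand t v) + of_bool (edge_demand t v))"
    using assms gap_eq[OF assms(1-3)] by (simp add: net_def weight_def demand_def)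
  consider "v = u + 1" | "v = u + 2" | "u + 3 \<le> v" using assms(2) by linarith
  then have "- 1 \<le> net t (v, B) \<and> (net t (v, B) < 0 \<longrightarrow> separated t u v) \<and> (u + 4 \<le> v \<longrightarrow> 1 \<le> net t (v, B))"
  proof cases
    case 1
    have "\<not> end_demand t v" using end_demand_attached[of t v] assms 1 by auto
    moreover have "\<not> start_demand t v"
    proof
      assume "start_demand t v"
      then obtain a where "u = a + 1" "a + 3 \<le> v" using start_demandE[OF _ assms(1-3)] by blast
      then show False using 1 by simp
    qed
    moreover have "edge_demand t v \<Longrightarrow> separated t u v" using separated_edge_demand[of t v u] 1 by simp
    ultimately show ?thesis using 1 g by (auto simp: of_bool_def)
  next
    case 2
    have "u + 1 \<in> {u<..<v}" using 2 by simp
    then have "u + 1 \<notin> attached t" using assms(3) by blast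
    then have "\<not> edge_demand t v" using edge_demand_attached[of t v] 2 by auto
    then show ?thesis using 2 g separated_end_start[of t v u] assms by (auto simp: of_bool_def)
  next
    case 3
    have "v - 1 \<in> {u<..<v}" using 3 by auto
    then have "v - 1 \<notin> attached t" using assms(3) by blast
    then have "\<not> edge_demand t v" using edge_demand_attached[of t v] by auto
    then show ?thesis using 3 g by (auto simp: of_bool_def)
  qed
  then show "- 1 \<le> net t (v, B)" "net t (v, B) < 0 \<Longrightarrow> separated t u v" "u + 4 \<le> v \<Longrightarrow> 1 \<le> net t (v, B)" by auto
qed

lemma net_pinch: "pinch t v B \<Longrightarrow> net t (v, B) = 1 - of_bool (pinch_demand t v B)"
  by (simp add: net_def weight_def demand_def)

lemma net_ge: "- 1 \<le> net t (v, B)"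
proof (cases "pinch t v B")
  case True then show ?thesis by (simp add: net_pinch)
next
  case np: False
  show ?thesis
  proof (cases "\<exists>u\<in>attached t. u < v")
    case True
    let ?S = "{u \<in> attached t. u < v}"
    have f: "finite ?S" "?S \<noteq> {}" using True by auto
    have m: "Max ?S \<in> ?S" using Max_in[OF f] .
    have "{Max ?S<..<v} \<inter> attached t = {}"
    proof (rule ccontr)
      assume "\<not> ?thesis"
      then have "\<exists>z. Max ?S < z \<and> z < v \<and> z \<in> attached t" unfolding disjoint_iff greaterThanLessThan_iff by blast
      then obtain z where z: "z \<in> ?S" "Max ?S < z" by blast
      then show False using Max_ge[OF f(1) z(1)] by linarith
    qed
    then show ?thesis using net_run(1)[of "Max ?S" t v B] m np by simp
  next
    \<comment> \<open>Below the first attached position no run starts, so only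
      \<open>end_demand\<close> can occur, and it comes with an unattached position.\<close>
    case False
    have "\<not> edge_demand t v" using edge_demand_attached[of t v] False by blast
    moreover have "\<not> start_demand t v"
    proof
      assume "start_demand t v"
      then obtain a where "leaf1 (\<not> t) a" "a + 2 < v" by (auto simp: start_demand_def)
      then show False using leaf1_attached'[of t a] False by force
    qed
    moreover have "end_demand t v \<Longrightarrow> 0 < gap t v" using end_demand_attached[of t v] gap_pos by blast
    ultimately show ?thesis using np by (auto simp: net_def weight_def demand_def of_bool_def)
  qed
qed

definition face :: "bool \<Rightarrow> nat \<times> nat set \<Rightarrow> int" where
  "face s k = net s k + (\<Sum>A\<in>children s k. net s (Min A, A))"

lemma finite_children: "finite (children s k)" using finite_F by (simp add: children_def)

text \<open>By the jumps, a demand on a leaf with \<open>t\<close> inner positions forces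
  \<open>t >= 3\<close>, and two demands force \<open>t >= 5\<close>. So 3 units remain once the
  issued ones are added: for \<open>t = 3\<close> the demanded unit is refunded, and for
  \<open>t = 4\<close> there is at most one demand.\<close>

lemma leaf_run:
  assumes c: "(y, B) \<in> corners s" and e: "{pred_in B y<..<y} \<inter> attached s = {}"
  shows "3 \<le> net s (y, B) + issued s (y, B)"
proof -
  note d = cornersD[OF c]
  let ?x = "pred_in B y"
  have xa: "?x \<in> attached s" and ya: "y \<in> attached s" using d by (auto simp: attached_iff)
  have np: "\<not> pinch s y B" using leaf_nonpinch[OF c e] .
  have "y \<noteq> Suc ?x" using no_consecutive[OF d(1,3)] d(2) by auto
  then have t1: "?x + 2 \<le> y" using d(4) by linarith
  have "y - 1 \<in> {?x<..<y}" using t1 by auto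
  then have "y - 1 \<notin> attached s" using e by blast
  then have nZ: "\<not> edge_demand s y" using edge_demand_attached[of s y] by auto
  define t where "t = y - ?x - 1"
  have demand_eq: "demand s (y, B) = of_bool (end_demand s y) + of_bool (start_demand s y)" using np nZ by (simp add: demand_def)
  have g: "net s (y, B) = int t - (of_bool (end_demand s y) + of_bool (start_demand s y))"
    using np demand_eq gap_eq[OF xa d(4) e] by (simp add: net_def weight_def t_def)
  have E: "3 \<le> t" if "end_demand s y"
  proof -
    obtain a w where a: "y = Suc a" "w \<in> F (\<not> s)" "a \<in> w" "a + 2 \<in> w" using \<open>end_demand s y\<close> by (auto simp: end_demand_def leaf1_def)
    then have "?x + 3 \<le> a" using jump_right[of w "\<not> s" B a ?x] d by simp
    then show ?thesis using a t_def by simp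
  qed
  have S: "3 \<le> t" if "start_demand s y"
  proof -
    obtain a where a: "?x = a + 1" "leaf1 (\<not> s) a" using start_demandE[OF \<open>start_demand s y\<close> xa d(4) e] by blast
    then obtain w where "w \<in> F (\<not> s)" "a \<in> w" "a + 2 \<in> w" by (auto simp: leaf1_def)
    then have "a + 5 \<le> y" using jump_left[of w "\<not> s" B a y] d a by simp
    then show ?thesis using a t_def by simp
  qed
  have ES: "5 \<le> t" if "end_demand s y" "start_demand s y"
  proof -
    obtain c w' where c: "y = Suc c" "w' \<in> F (\<not> s)" "c \<in> w'" "c + 2 \<in> w'" using \<open>end_demand s y\<close> by (auto simp: end_demand_def leaf1_def)
    obtain a where a: "?x = a + 1" "leaf1 (\<not> s) a" using start_demandE[OF \<open>start_demand s y\<close> xa d(4) e] by blast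
    then obtain w where w: "w \<in> F (\<not> s)" "a \<in> w" "a + 2 \<in> w" by (auto simp: leaf1_def)
    show ?thesis
    proof (cases "w = w'")
      case False
      have "a + 6 \<le> c" using jump_both[of w "\<not> s" w' B a c] False w c d a by simp
      then show ?thesis using a c t_def by simp
    next
      \<comment> \<open>If one bridge makes both demands, position \<open>?x + 2\<close> is a foot
        of another bridge on that side, enclosed between the feet \<open>?x + 1\<close> and
        \<open>c\<close> of \<open>w\<close>; for \<open>t < 5\<close> there is no room for
        it.\<close>
      case True
      have t3: "3 \<le> t" using S that by simp
      show ?thesis
      proof (rule ccontr)
        assume "\<not> 5 \<le> t"
        then have cle: "c \<le> ?x + 4" "?x + 3 \<le> c" using c t_def t3 by auto
        have "?x + 2 \<in> {?x<..<y}" using cle c by auto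
        then have "?x + 2 \<notin> attached s" using e by blast
        then have "?x + 2 \<in> attached (\<not> s)" using cover'[of "?x + 2" s] attached_less[OF ya] cle c by auto
        then obtain A where A: "A \<in> F (\<not> s)" "?x + 2 \<in> A" by (auto simp: attached_iff)
        have wx: "?x + 1 \<in> w" using w a by (simp add: numeral_eq_Suc)
        have "w \<noteq> A" using no_consecutive[OF w(1) wx] A by auto
        then have "A \<subseteq> {?x + 1..c}" using noncross[OF w(1) A(1) _ wx _ A(2)] True c cle by auto
        from two_elems[OF A(1) this A(2)] show False using cle by simp
      qed
    qed
  qed
  have "1 \<le> t" using t1 t_def by simp
  moreover have "issued s (y, B) = (if t = 1 then 2 else if t = 2 then 1 else if t = 3 then demand s (y, B) else 0)"
    by (simp add: issued_def Let_def t_def)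
  ultimately show ?thesis using g E S ES demand_eq by (cases "end_demand s y"; cases "start_demand s y") auto
qed

text \<open>A shortage at one run makes it separated, and the separation is read off at the other
  run, where the same two bridges meet: that run has at least three inner positions, or it is a
  pinch free of demand. Either way it contributes at least 1.\<close>

lemma two_face:
  assumes c: "(y, B) \<in> corners s" and children: "children s (y, B) = {C}"
  shows "0 \<le> net s (y, B) + net s (Min C, C)"
proof -
  note d = cornersD[OF c] and o = one_child[OF c children]
  let ?x = "pred_in B y" and ?l = "Min C" and ?r = "Max C"
  note m = Min_Max[OF o(1)]
  have xa: "?x \<in> attached s" and ra: "?r \<in> attached s" using d o(1) m by (auto simp: attached_iff)
  have O1: "1 \<le> net s (y, B)" if "separated s ?x ?l"
  proof (cases "?r < y")
    case True
    have "?r + 4 \<le> y" using separatedD[OF that d(1) o(1) o(2)[symmetric] d(3) m(1) d(2) m(2)] o(3,4,5) True by linarith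
    then show ?thesis using net_run(3)[OF ra True o(7) o(10)[OF True]] by simp
  next
    case False
    then have ry: "?r = y" using o(5) by simp
    \<comment> \<open>The demand would put \<open>y + 2\<close> into \<open>B\<close>, only two
      beyond \<open>Max C = y\<close>; separation requires four.\<close>
    have "\<not> pinch_demand s y B"
    proof
      assume "pinch_demand s y B"
      then have "y + 2 \<in> B" by (simp add: pinch_demand_def)
      from separatedD[OF that d(1) o(1) o(2)[symmetric] d(3) m(1) this m(2)] show False using ry o(4) by simp
    qed
    then show ?thesis using net_pinch[OF o(11)[OF ry]] by simp
  qed
  have O2: "1 \<le> net s (?l, C)" if "separated s ?r y"
  proof (cases "?x < ?l")
    case True
    have "?x + 4 \<le> ?l" using separatedD[OF that o(1) d(1) o(2) m(2) d(2) m(1) d(3)] o(3,4,5) True by linarith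
    then show ?thesis using net_run(3)[OF xa True o(6) o(8)[OF True]] by simp
  next
    case False
    then have xl: "?x = ?l" using o(3) by simp
    have "\<not> pinch_demand s ?l C"
    proof
      assume "pinch_demand s ?l C"
      then have "?l + 2 \<in> C" by (simp add: pinch_demand_def)
      from separatedD[OF that o(1) d(1) o(2) m(2) d(2) this d(3)] show False using xl o(4) by simp
    qed
    then show ?thesis using net_pinch[OF o(9)[OF xl]] by simp
  qed
  have g1: "- 1 \<le> net s (?l, C)" "- 1 \<le> net s (y, B)" using net_ge by blast+
  have s1: "separated s ?x ?l" if "net s (?l, C) < 0"
  proof (cases "?x < ?l")
    case True
    then show ?thesis using net_run(2)[OF xa True o(6) o(8)[OF True] that] by simp
  next
    case False
    then have "pinch s ?l C" using o(3,9) by simp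
    then show ?thesis using net_pinch that by (auto simp: of_bool_def split: if_splits)
  qed
  have s2: "separated s ?r y" if "net s (y, B) < 0"
  proof (cases "?r < y")
    case True
    then show ?thesis using net_run(2)[OF ra True o(7) o(10)[OF True] that] by simp
  next
    case False
    then have "pinch s y B" using o(5,11) by simp
    then show ?thesis using net_pinch that by (auto simp: of_bool_def split: if_splits)
  qed
  show ?thesis using g1 s1 s2 O1 O2 by linarith
qed

lemma face_ge:
  assumes "k \<in> corners s"
  shows "3 - 3 * int (card (children s k)) \<le> face s k + (if children s k = {} then issued s k else 0)"
proof -
  obtain y B where k: "k = (y, B)" by (cases k)
  note c = assms[unfolded k]
  consider "card (children s k) = 0" | "card (children s k) = 1" | "2 \<le> card (children s k)" by linarith
  then show ?thesis
  proof cases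
    case 1
    then have "children s k = {}" using finite_children by simp
    then show ?thesis using leaf_run[OF c] leaf_unatt[OF c] k by (simp add: face_def)
  next
    case 2
    then obtain C where C: "children s k = {C}" by (auto simp: card_1_singleton_iff)
    then show ?thesis using two_face[OF c, of C] k by (simp add: face_def)
  next
    \<comment> \<open>With \<open>c >= 2\<close> children all \<open>c + 1\<close> runs may lack a
      unit, because \<open>c + 1 <= 3 * c - 3\<close>.\<close>
    case 3
    have "(\<Sum>A\<in>children s k. (- 1 :: int)) \<le> (\<Sum>A\<in>children s k. net s (Min A, A))" using net_ge by (intro sum_mono) auto
    moreover have "- 1 \<le> net s k" using net_ge k by simp
    moreover have "children s k \<noteq> {}" using 3 by auto
    ultimately show ?thesis using 3 by (simp add: face_def)
  qed
qed

end

section \<open>Counting\<close>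

context ring_system begin

text \<open>Equal keys mean the same next foot \<open>x\<close>. Above \<open>v\<close> this is a
  shared corner; if the next foot is reached only over the cut, all feet lie from \<open>x\<close>
  to \<open>v\<close>, and noncrossing makes every inner foot of one bridge equal to every inner
  foot of the other.\<close>

lemma key_inj:
  assumes A: "A \<in> F s" "v \<in> A" and B: "B \<in> F s" "v \<in> B" and k: "key v A = key v B" shows "A = B"
proof -
  obtain x where x: "x \<in> A" "x \<noteq> v" "key v A = rot v x" using key_ex[OF A(1)] by blast
  obtain y where y: "y \<in> B" "y \<noteq> v" "key v B = rot v y" using key_ex[OF B(1)] by blast
  have lt: "v < n" "x < n" "y < n" using A B x y B_less by blast+
  have "rot v x = rot v y" using x y k by simp
  then have xy: "x = y" using lt x(2) y(2) by (auto simp: rot_def split: if_splits)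
  have mA: "rot v x \<le> rot v z" if "z \<in> A" "z \<noteq> v" for z using key_le[OF A(1) that] x by simp
  have mB: "rot v x \<le> rot v z" if "z \<in> B" "z \<noteq> v" for z using key_le[OF B(1) that] y xy by simp
  show ?thesis
  proof (cases "v < x")
    case True
    have "{v<..<x} \<inter> A = {}" "{v<..<x} \<inter> B = {}"
      using mA mB True by (force simp: rot_def)+
    then show ?thesis using corner_unique[OF A(1) B(1) True] A B x y xy by blast
  next
    case False
    then have xv: "x < v" using x by simp
    have bA: "x \<le> z \<and> z \<le> v" if "z \<in> A" for z
      using mA[OF that] xv B_less[OF A(1) that] lt by (cases "z = v") (auto simp: rot_def split: if_splits)
    have bB: "x \<le> z \<and> z \<le> v" if "z \<in> B" for z
      using mB[OF that] xv B_less[OF B(1) that] lt by (cases "z = v") (auto simp: rot_def split: if_splits)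
    show ?thesis
    proof (rule ccontr)
      assume ne: "A \<noteq> B"
      have eq: "d = e" if "d \<in> A" "d \<noteq> x" "d \<noteq> v" "e \<in> B" "e \<noteq> x" "e \<noteq> v" for d e
      proof -
        have *: "x < d" "d < v" "x < e" "e < v" using that bA[OF that(1)] bB[OF that(4)] by auto
        have "\<not> e < d" using noncross[OF A(1) B(1) ne x(1) that(1,4) B(2)] * by linarith
        moreover have "\<not> d < e" using noncross[OF B(1) A(1) ne[symmetric] _ that(4,1) A(2)] y xy * by fastforce
        ultimately show ?thesis by simp
      qed
      obtain d where d: "d \<in> A" "d \<noteq> x" "d \<noteq> v" using third[OF A(1)] by blast
      obtain e where e: "e \<in> B" "e \<noteq> x" "e \<noteq> v" using third[OF B(1)] by blast
      have "A = {x, v, d}" using eq[OF _ _ _ e] d x A by blast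
      moreover have "B = {x, v, d}" using eq[OF d] e eq[OF d e] y xy B by blast
      ultimately show False using ne by simp
    qed
  qed
qed

text \<open>Around \<open>v\<close> this is the incidence with the largest key, the one that closes
  the run below \<open>v\<close>; there is just one for each attached position.\<close>

definition firsts :: "bool \<Rightarrow> (nat \<times> nat set) set" where "firsts s = {(v, B) \<in> incidences s. \<not> pinch s v B}"

lemma firsts_subset: "firsts s \<subseteq> incidences s" by (auto simp: firsts_def)
lemma finite_firsts: "finite (firsts s)" using firsts_subset finite_incidences finite_subset by blast

lemma inj_on_firsts: "inj_on fst (firsts s)"
proof (rule inj_onI)
  fix i j assume h: "i \<in> firsts s" "j \<in> firsts s" "fst i = fst j"
  obtain v A B where ij: "i = (v, A)" "j = (v, B)" using h(3) by (cases i; cases j) auto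
  have "A \<in> F s" "v \<in> A" "B \<in> F s" "v \<in> B" "\<not> key v A < key v B" "\<not> key v B < key v A"
    using h ij by (auto simp: firsts_def incidences_def pinch_def)
  then have "A = B" using key_inj[of A s v B] by linarith
  then show "i = j" using ij by simp
qed

lemma fst_firsts: "fst ` firsts s = attached s"
proof
  show "fst ` firsts s \<subseteq> attached s" by (auto simp: firsts_def incidences_def attached_iff)
  show "attached s \<subseteq> fst ` firsts s"
  proof
    fix v assume "v \<in> attached s"
    then have ne: "{B \<in> F s. v \<in> B} \<noteq> {}" by (auto simp: attached_iff)
    have f: "finite {B \<in> F s. v \<in> B}" using finite_F by simp
    have "Max (key v ` {B \<in> F s. v \<in> B}) \<in> key v ` {B \<in> F s. v \<in> B}" using f ne by (intro Max_in) auto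
    then obtain B where B: "B \<in> F s" "v \<in> B" "Max (key v ` {B \<in> F s. v \<in> B}) = key v B" by auto
    have "key v A \<le> key v B" if "A \<in> F s" "v \<in> A" for A unfolding B(3)[symmetric] using f that by (intro Max_ge) auto
    then have "\<not> pinch s v B" unfolding pinch_def by force
    then have "(v, B) \<in> firsts s" using B by (auto simp: firsts_def incidences_def)
    then show "v \<in> fst ` firsts s" by force
  qed
qed

lemma finite_attached: "finite (attached s)"
  using attached_less by (intro finite_subset[of "attached s" "{..<n}"]) auto

lemma sum_incidences_split:
  fixes f g :: "nat \<Rightarrow> int"
  shows "(\<Sum>(v, B)\<in>incidences s. if pinch s v B then h (v, B) else g v)
    = (\<Sum>i\<in>incidences s - firsts s. h i) + (\<Sum>v\<in>attached s. g v)"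
proof -
  have "(\<Sum>(v, B)\<in>incidences s. if pinch s v B then h (v, B) else g v)
      = (\<Sum>(v, B)\<in>incidences s - firsts s. if pinch s v B then h (v, B) else g v) + (\<Sum>(v, B)\<in>firsts s. if pinch s v B then h (v, B) else g v)"
    using sum.subset_diff[OF firsts_subset finite_incidences] .
  also have "(\<Sum>(v, B)\<in>firsts s. if pinch s v B then h (v, B) else g v) = (\<Sum>i\<in>firsts s. g (fst i))"
    by (intro sum.cong) (auto simp: firsts_def)
  also have "\<dots> = (\<Sum>v\<in>attached s. g v)" using sum.reindex[OF inj_on_firsts, of g s] fst_firsts[of s] by simp
  also have "(\<Sum>(v, B)\<in>incidences s - firsts s. if pinch s v B then h (v, B) else g v) = (\<Sum>i\<in>incidences s - firsts s. h i)"
    by (intro sum.cong) (auto simp: firsts_def)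
  finally show ?thesis .
qed

text \<open>There are \<open>card (incidences s) - card (attached s)\<close> pinches, and the runs
  counted by \<open>gap\<close> are disjoint sets of unattached positions. Only the positions above
  the last attached one are left out.\<close>

lemma sum_weight: "(\<Sum>i\<in>incidences s. weight s i) \<le> int (card (incidences s)) + int n - 2 * int (card (attached s))"
proof -
  have "(\<Sum>i\<in>incidences s. weight s i) = (\<Sum>(v, B)\<in>incidences s. if pinch s v B then (\<lambda>_. 1) (v, B) else int (gap s v))"
    by (intro sum.cong) (auto simp: weight_def)
  also have "\<dots> = int (card (incidences s - firsts s)) + (\<Sum>v\<in>attached s. int (gap s v))"
    by (subst sum_incidences_split) simp
  also have "card (incidences s - firsts s) = card (incidences s) - card (attached s)"
    using card_Diff_subset[OF finite_firsts firsts_subset] card_image[OF inj_on_firsts] fst_firsts by metis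
  finally have 1: "(\<Sum>i\<in>incidences s. weight s i) = int (card (incidences s) - card (attached s)) + int (\<Sum>v\<in>attached s. gap s v)" by simp
  have 2: "card (attached s) \<le> card (incidences s)"
    using card_mono[OF finite_incidences firsts_subset] card_image[OF inj_on_firsts] fst_firsts by metis
  let ?G = "\<lambda>v. {u. u < v \<and> {u..<v} \<inter> attached s = {}}"
  have "(\<Sum>v\<in>attached s. gap s v) = card (\<Union>v\<in>attached s. ?G v)"
    unfolding gap_def
  proof (rule card_UN_disjoint[symmetric])
    show "finite (attached s)" using finite_attached .
    show "\<forall>v\<in>attached s. finite (?G v)" by simp
    show "\<forall>i\<in>attached s. \<forall>j\<in>attached s. i \<noteq> j \<longrightarrow> ?G i \<inter> ?G j = {}"
    proof (intro ballI impI)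
      fix i j assume ij: "i \<in> attached s" "j \<in> attached s" "i \<noteq> j"
      show "?G i \<inter> ?G j = {}"
      proof (rule ccontr)
        assume "\<not> ?thesis"
        then obtain u where u: "u < i" "u < j" "{u..<i} \<inter> attached s = {}" "{u..<j} \<inter> attached s = {}" by auto
        then have "j \<notin> {u..<i}" "i \<notin> {u..<j}" using ij by blast+
        then show False using u ij by auto
      qed
    qed
  qed
  also have "\<dots> \<le> card ({..<n} - attached s)"
  proof (rule card_mono)
    show "(\<Union>v\<in>attached s. ?G v) \<subseteq> {..<n} - attached s"
    proof
      fix u assume "u \<in> (\<Union>v\<in>attached s. ?G v)"
      then obtain v where v: "v \<in> attached s" "u < v" "{u..<v} \<inter> attached s = {}" by auto
      then have "u \<notin> attached s" by auto
      then show "u \<in> {..<n} - attached s" using attached_less[OF v(1)] v by simp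
    qed
  qed simp
  also have "\<dots> = n - card (attached s)" using attached_less[of _ s] by (subst card_Diff_subset[OF finite_attached]) auto
  finally have 3: "(\<Sum>v\<in>attached s. gap s v) \<le> n - card (attached s)" .
  have "card (attached s) \<le> n" using card_mono[of "{..<n}" "attached s"] attached_less[of _ s] by auto
  then show ?thesis using 1 2 3 by linarith
qed

lemma sum_of_bool: "finite A \<Longrightarrow> (\<Sum>v\<in>A. of_bool (P v)) = int (card {v \<in> A. P v})"
  by (induction A rule: finite_induct) (auto simp: Collect_conv_if card_insert_if conj_disj_distribR Collect_disj_eq intro!: arg_cong[of _ _ card])

lemma sum_demand:
  "int (card {v. end_demand s v}) + int (card {v \<in> attached s. start_demand s v}) + int (card {v. edge_demand s v})
     + int (card {a. leaf1 s a \<and> a \<notin> attached (\<not> s) \<and> mult s a \<noteq> 1}) \<le> (\<Sum>i\<in>incidences s. demand s i)"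
proof -
  let ?P = "\<lambda>(v, B). pinch_demand s v B"
  have "(\<Sum>i\<in>incidences s. demand s i) = (\<Sum>(v, B)\<in>incidences s. if pinch s v B then (\<lambda>i. of_bool (?P i)) (v, B)
      else (of_bool (end_demand s v) + of_bool (start_demand s v) + of_bool (edge_demand s v)))"
    by (intro sum.cong) (auto simp: demand_def)
  also have "\<dots> = (\<Sum>i\<in>incidences s - firsts s. of_bool (?P i)) + (\<Sum>v\<in>attached s. of_bool (end_demand s v) + of_bool (start_demand s v) + of_bool (edge_demand s v))"
    by (rule sum_incidences_split)
  also have "(\<Sum>v\<in>attached s. of_bool (end_demand s v) + of_bool (start_demand s v) + of_bool (edge_demand s v))
      = int (card {v \<in> attached s. end_demand s v}) + int (card {v \<in> attached s. start_demand s v}) + int (card {v \<in> attached s. edge_demand s v})"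
    by (simp only: sum.distrib sum_of_bool[OF finite_attached])
  also have "{v \<in> attached s. end_demand s v} = {v. end_demand s v}" using end_demand_attached by blast
  also have "{v \<in> attached s. edge_demand s v} = {v. edge_demand s v}" using edge_demand_attached by blast
  also have "(\<Sum>i\<in>incidences s - firsts s. of_bool (?P i)) = int (card {i \<in> incidences s - firsts s. ?P i})"
    using finite_incidences by (intro sum_of_bool) simp
  finally have E: "(\<Sum>i\<in>incidences s. demand s i) = int (card {i \<in> incidences s - firsts s. ?P i})
      + (int (card {v. end_demand s v}) + int (card {v \<in> attached s. start_demand s v}) + int (card {v. edge_demand s v}))" .
  have "card {a. leaf1 s a \<and> a \<notin> attached (\<not> s) \<and> mult s a \<noteq> 1} \<le> card {i \<in> incidences s - firsts s. ?P i}"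
  proof (rule surj_card_le)
    show "finite {i \<in> incidences s - firsts s. ?P i}" using finite_incidences by simp
    show "{a. leaf1 s a \<and> a \<notin> attached (\<not> s) \<and> mult s a \<noteq> 1} \<subseteq> fst ` {i \<in> incidences s - firsts s. ?P i}"
    proof
      fix a assume "a \<in> {a. leaf1 s a \<and> a \<notin> attached (\<not> s) \<and> mult s a \<noteq> 1}"
      then have a: "leaf1 s a" "a \<notin> attached (\<not> s)" "mult s a \<noteq> 1" by auto
      then obtain w where w: "w \<in> F s" "a \<in> w" "a + 2 \<in> w" "a + 1 \<notin> attached s" by (auto simp: leaf1_def)
      have "\<exists>A\<in>F s. a \<in> A \<and> A \<noteq> w"
      proof (rule ccontr)
        assume "\<not> ?thesis"
        then have "{B \<in> F s. a \<in> B} = {w}" using w by blast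
        then show False using a(3) by (simp add: mult_def)
      qed
      then obtain A where A: "A \<in> F s" "a \<in> A" "A \<noteq> w" by blast
      \<comment> \<open>The next foot of \<open>w\<close> after \<open>a\<close> is at distance 2,
        and no bridge can have a nearer one since \<open>a + 1\<close> is unattached; so
        \<open>w\<close> has the smaller key of the two and is a pinch.\<close>
      have kw: "key a w \<le> 2" using key_le[OF w(1,3), of a] by (simp add: rot_def)
      obtain x where x: "x \<in> A" "x \<noteq> a" "key a A = rot a x" using key_ex[OF A(1)] by blast
      have "x \<noteq> a + 1" using w A x by (auto simp: attached_iff)
      moreover have "x < n" "a + 2 < n" using B_less A x w by blast+
      ultimately have "2 \<le> key a A" using x by (auto simp: rot_def)
      moreover have "key a w \<noteq> key a A" using key_inj[OF w(1,2) A(1,2)] A(3) by blast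
      ultimately have "key a w < key a A" using kw by linarith
      then have "pinch s a w" using A unfolding pinch_def by blast
      then have "(a, w) \<in> {i \<in> incidences s - firsts s. ?P i}" using w a by (auto simp: firsts_def incidences_def pinch_demand_def)
      then show "a \<in> fst ` {i \<in> incidences s - firsts s. ?P i}" by force
    qed
  qed
  then show ?thesis unfolding E by linarith
qed

section \<open>Summing over the faces of one side\<close>

definition roots :: "bool \<Rightarrow> nat set set" where "roots s = {A \<in> F s. parent s A = None}"
definition leaves :: "bool \<Rightarrow> (nat \<times> nat set) set" where "leaves s = {k \<in> corners s. children s k = {}}"

lemma sum_children:
  fixes f :: "nat set \<Rightarrow> int"
  shows "(\<Sum>A\<in>F s. f A) = (\<Sum>A\<in>roots s. f A) + (\<Sum>k\<in>corners s. \<Sum>A\<in>children s k. f A)"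
proof -
  have "(\<Sum>k\<in>corners s. \<Sum>A\<in>children s k. f A) = (\<Sum>A\<in>(\<Union>k\<in>corners s. children s k). f A)"
    using finite_corners finite_children by (intro sum.UNION_disjoint[symmetric]) (auto simp: children_def)
  also have "(\<Union>k\<in>corners s. children s k) = F s - roots s"
  proof -
    have "parent s A = Some k \<Longrightarrow> k \<in> corners s" for A k using parent_Some(1) by (cases k) auto
    then have "parent s A = None \<or> (\<exists>k\<in>corners s. parent s A = Some k)" for A by (cases "parent s A") auto
    then show ?thesis by (force simp: children_def roots_def)
  qed
  finally show ?thesis using sum.subset_diff[of "roots s" "F s" f] finite_F by (auto simp: roots_def)
qed

lemma roots_nonempty: assumes "F s \<noteq> {}" shows "roots s \<noteq> {}"
proof -
  have "Max (extent ` F s) \<in> extent ` F s" using assms finite_F by (intro Max_in) auto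
  then obtain A where A: "A \<in> F s" "extent A = Max (extent ` F s)" by auto
  have "parent s A = None"
  proof (rule ccontr)
    assume "parent s A \<noteq> None"
    then obtain y B where p: "parent s A = Some (y, B)" by auto
    have c: "(y, B) \<in> corners s" using parent_Some(1)[OF p] .
    have "extent A < extent B" using extent_less[OF c A(1) parent_Some(3)[OF p]] .
    moreover have "extent B \<le> extent A" unfolding A(2) using cornersD(1)[OF c] finite_F by (intro Max_ge) auto
    ultimately show False by simp
  qed
  then show ?thesis using A by (auto simp: roots_def)
qed

text \<open>
  Euler's formula in disguise: the corners have 3 - 3 c units, c being the number of children, so they sum to
  3 (R - k) - 3 (k - number of roots) for k bridges with R feet in total, and R is at least 3 k.
\<close>

lemma side_sum:
  assumes "F s \<noteq> {}"
  shows "int (card (incidences s)) + 2 \<le> (\<Sum>i\<in>incidences s. net s i) + (\<Sum>k\<in>leaves s. issued s k)"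
proof -
  let ?M = "(\<lambda>B. (Min B, B)) ` F s"
  have split: "incidences s = corners s \<union> ?M" "corners s \<inter> ?M = {}"
    using Min_Max(1) by (auto simp: incidences_def corners_def)
  have inj: "inj_on (\<lambda>B. (Min B, B)) (F s)" by (auto simp: inj_on_def)
  have fM: "finite ?M" using finite_F by simp
  have "(\<Sum>i\<in>incidences s. net s i) = (\<Sum>k\<in>corners s. net s k) + (\<Sum>B\<in>F s. net s (Min B, B))"
  proof -
    have "(\<Sum>i\<in>incidences s. net s i) = (\<Sum>k\<in>corners s. net s k) + (\<Sum>i\<in>?M. net s i)"
      unfolding split(1) by (rule sum.union_disjoint[OF finite_corners fM split(2)])
    then show ?thesis using sum.reindex[OF inj, of "net s"] by (simp add: o_def)
  qed
  also have "(\<Sum>B\<in>F s. net s (Min B, B)) = (\<Sum>B\<in>roots s. net s (Min B, B)) + (\<Sum>k\<in>corners s. \<Sum>B\<in>children s k. net s (Min B, B))"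
    by (rule sum_children)
  finally have 1: "(\<Sum>i\<in>incidences s. net s i) = (\<Sum>k\<in>corners s. face s k) + (\<Sum>B\<in>roots s. net s (Min B, B))"
    by (simp add: face_def sum.distrib)
  have 2: "(\<Sum>k\<in>leaves s. issued s k) = (\<Sum>k\<in>corners s. if children s k = {} then issued s k else 0)"
    unfolding leaves_def using finite_corners by (simp add: sum.inter_filter)
  have "(\<Sum>k\<in>corners s. 3 - 3 * int (card (children s k))) \<le> (\<Sum>k\<in>corners s. face s k + (if children s k = {} then issued s k else 0))"
    using face_ge by (intro sum_mono)
  then have 3: "3 * int (card (corners s)) - 3 * (\<Sum>k\<in>corners s. int (card (children s k))) \<le> (\<Sum>k\<in>corners s. face s k) + (\<Sum>k\<in>leaves s. issued s k)"
    unfolding 2 by (simp add: sum_subtractf sum_distrib_left sum.distrib)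
  have 4: "int (card (F s)) = int (card (roots s)) + (\<Sum>k\<in>corners s. int (card (children s k)))"
    using sum_children[of "\<lambda>_. 1" s] by simp
  \<comment> \<open>The first feet of the roots end runs of the face at the cut, which has no
    corner; each of them is granted a shortage of 1.\<close>
  have 5: "(\<Sum>B\<in>roots s. (- 1 :: int)) \<le> (\<Sum>B\<in>roots s. net s (Min B, B))" using net_ge by (intro sum_mono) auto
  have 6: "card (incidences s) = card (corners s) + card (F s)"
    unfolding split(1) using card_Un_disjoint[OF finite_corners fM split(2)] card_image[OF inj] by simp
  have "card (incidences s) = (\<Sum>B\<in>F s. card B)"
  proof -
    have "incidences s = (\<lambda>(B, v). (v, B)) ` Sigma (F s) (\<lambda>B. B)" by (auto simp: incidences_def image_iff)
    then have "card (incidences s) = card (Sigma (F s) (\<lambda>B. B))" by (simp add: card_image inj_on_def)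
    then show ?thesis using finite_F finite_B by simp
  qed
  moreover have "(\<Sum>B\<in>F s. 3) \<le> (\<Sum>B\<in>F s. card B)" using card3 by (intro sum_mono)
  ultimately have 7: "3 * card (F s) \<le> card (incidences s)" by simp
  have "finite (roots s)" using finite_F by (simp add: roots_def)
  then have "1 \<le> card (roots s)" using roots_nonempty[OF assms] by (simp add: Suc_le_eq card_gt_0_iff)
  then show ?thesis using 1 3 4 5 6 7 by simp
qed

section \<open>Matching the issued units with the demands\<close>

lemma finite_leaf: "finite {a. leaf1 s a \<and> P a}" "finite {a. leaf2 s a \<and> P a}" "finite {a. leaf3 s a \<and> P a}"
proof -
  have "a < n" if "leaf1 s a \<or> leaf2 s a \<or> leaf3 s a" for a using leaf_less[of s a] that by linarith
  then have "{a. leaf1 s a \<and> P a} \<subseteq> {..<n}" "{a. leaf2 s a \<and> P a} \<subseteq> {..<n}" "{a. leaf3 s a \<and> P a} \<subseteq> {..<n}" by auto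
  then show "finite {a. leaf1 s a \<and> P a}" "finite {a. leaf2 s a \<and> P a}" "finite {a. leaf3 s a \<and> P a}"
    using finite_subset[OF _ finite_lessThan] by blast+
qed

lemma finite_demand: "finite {v. end_demand s v}" "finite {v. edge_demand s v}"
proof -
  have "{v. end_demand s v} \<subseteq> attached s" "{v. edge_demand s v} \<subseteq> attached s" using end_demand_attached edge_demand_attached by blast+
  then show "finite {v. end_demand s v}" "finite {v. edge_demand s v}" using finite_subset[OF _ finite_attached] by blast+
qed

text \<open>Leaves with the same interval are equal by \<open>corner_unique\<close>, so for a fixed
  width \<open>d\<close> they can be counted by their left foot.\<close>

lemma card_leaf:
  assumes "\<And>y B. \<lbrakk>(y, B) \<in> leaves s; Q (y, B)\<rbrakk> \<Longrightarrow> y = pred_in B y + d \<and> pred_in B y \<in> T" and "finite T"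
  shows "card {k \<in> leaves s. Q k} \<le> card T"
proof (rule card_inj_on_le[of "\<lambda>(y, B). pred_in B y"])
  show "inj_on (\<lambda>(y, B). pred_in B y) {k \<in> leaves s. Q k}"
  proof (rule inj_onI)
    fix i j assume h: "i \<in> {k \<in> leaves s. Q k}" "j \<in> {k \<in> leaves s. Q k}" and e: "(case i of (y, B) \<Rightarrow> pred_in B y) = (case j of (y, B) \<Rightarrow> pred_in B y)"
    obtain y A z B where ij: "i = (y, A)" "j = (z, B)" by (cases i; cases j) auto
    have c: "(y, A) \<in> corners s" "(z, B) \<in> corners s" using h ij by (auto simp: leaves_def)
    have eq: "y = z" using assms(1)[of y A] assms(1)[of z B] h ij e by auto
    note d1 = cornersD[OF c(1)] and d2 = cornersD[OF c(2)]
    have p: "pred_in B z = pred_in A y" using e ij by simp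
    have "pred_in A y \<in> B" "y \<in> B" "{pred_in A y<..<y} \<inter> B = {}" using d2 p eq by simp_all
    from corner_unique[OF d1(1) d2(1) d1(4) d1(3,2) this(1,2) d1(5) this(3)] have "A = B" .
    then show "i = j" using ij eq by simp
  qed
  show "(\<lambda>(y, B). pred_in B y) ` {k \<in> leaves s. Q k} \<subseteq> T" using assms(1) by auto
qed (fact assms)

lemma sum_issued:
  "(\<Sum>k\<in>leaves s. issued s k) \<le> 2 * int (card {a. leaf1 s a}) + int (card {a. leaf2 s a})
     + int (card {y. leaf3 s y \<and> end_demand s (y + 4)}) + int (card {y. leaf3 s y \<and> start_demand s (y + 4)})"
proof -
  define t where "t = (\<lambda>(y, B). y - pred_in B y - 1)"
  have fL: "finite (leaves s)" using finite_corners by (simp add: leaves_def)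
  have leaf_empty: "{pred_in B y<..<y} \<inter> attached s = {}" "(y, B) \<in> corners s" if "(y, B) \<in> leaves s" for y B
    using leaf_unatt that by (auto simp: leaves_def)
  have "issued s k = 2 * of_bool (t k = 1) + of_bool (t k = 2) + of_bool (t k = 3 \<and> end_demand s (fst k)) + of_bool (t k = 3 \<and> start_demand s (fst k))"
    if k: "k \<in> leaves s" for k
  proof -
    obtain y B where yB: "k = (y, B)" by (cases k)
    note e = leaf_empty[OF k[unfolded yB]]
    have "demand s k = of_bool (end_demand s y) + of_bool (start_demand s y)" if "t k = 3"
    proof -
      \<comment> \<open>The position before \<open>y\<close> is inside the leaf and unattached,
        whereas \<open>edge_demand\<close> needs an attached one there.\<close>
      have "y - 1 \<in> {pred_in B y<..<y}" using that yB by (auto simp: t_def)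
      then have "y - 1 \<notin> attached s" using e by blast
      then have "\<not> edge_demand s y" using edge_demand_attached[of s y] by auto
      then show ?thesis using leaf_nonpinch[OF e(2,1)] yB by (simp add: demand_def)
    qed
    then show ?thesis using yB by (auto simp: issued_def t_def Let_def)
  qed
  then have "(\<Sum>k\<in>leaves s. issued s k) = (\<Sum>k\<in>leaves s. 2 * of_bool (t k = 1) + of_bool (t k = 2)
      + of_bool (t k = 3 \<and> end_demand s (fst k)) + of_bool (t k = 3 \<and> start_demand s (fst k)))"
    by (intro sum.cong) auto
  also have "\<dots> = 2 * int (card {k \<in> leaves s. t k = 1}) + int (card {k \<in> leaves s. t k = 2})
      + int (card {k \<in> leaves s. t k = 3 \<and> end_demand s (fst k)}) + int (card {k \<in> leaves s. t k = 3 \<and> start_demand s (fst k)})"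
    by (simp add: sum.distrib sum_of_bool[OF fL] flip: sum_distrib_left)
  finally have eq: "(\<Sum>k\<in>leaves s. issued s k) = \<dots>" .
  have un: "u \<notin> attached s" if "(y, B) \<in> leaves s" "pred_in B y < u" "u < y" for y B u using leaf_empty[OF that(1)] that by auto
  have c1: "card {k \<in> leaves s. t k = 1} \<le> card {a. leaf1 s a}"
  proof (rule card_leaf[where d = 2])
    fix y B assume h: "(y, B) \<in> leaves s" "t (y, B) = 1"
    note d = cornersD[OF leaf_empty(2)[OF h(1)]]
    have y: "y = pred_in B y + 2" using h by (simp add: t_def)
    moreover have "pred_in B y + 1 \<notin> attached s" using un[OF h(1)] y by simp
    ultimately have "leaf1 s (pred_in B y)" unfolding leaf1_def using d by auto
    then show "y = pred_in B y + 2 \<and> pred_in B y \<in> {a. leaf1 s a}" using y by simp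
  qed (use finite_leaf(1)[of s "\<lambda>_. True"] in simp)
  have c2: "card {k \<in> leaves s. t k = 2} \<le> card {a. leaf2 s a}"
  proof (rule card_leaf[where d = 3])
    fix y B assume h: "(y, B) \<in> leaves s" "t (y, B) = 2"
    note d = cornersD[OF leaf_empty(2)[OF h(1)]]
    have y: "y = pred_in B y + 3" using h by (simp add: t_def)
    moreover have "pred_in B y + 1 \<notin> attached s" "pred_in B y + 2 \<notin> attached s" using un[OF h(1)] y by simp_all
    ultimately have "leaf2 s (pred_in B y)" unfolding leaf2_def using d by auto
    then show "y = pred_in B y + 3 \<and> pred_in B y \<in> {a. leaf2 s a}" using y by simp
  qed (use finite_leaf(2)[of s "\<lambda>_. True"] in simp)
  have l3: "y = pred_in B y + 4 \<and> leaf3 s (pred_in B y)" if h: "(y, B) \<in> leaves s" "t (y, B) = 3" for y B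
  proof -
    note d = cornersD[OF leaf_empty(2)[OF h(1)]]
    have y: "y = pred_in B y + 4" using h by (simp add: t_def)
    moreover have "pred_in B y + 1 \<notin> attached s" "pred_in B y + 2 \<notin> attached s" "pred_in B y + 3 \<notin> attached s" using un[OF h(1)] y by simp_all
    ultimately have "leaf3 s (pred_in B y)" unfolding leaf3_def using d by auto
    then show ?thesis using y by simp
  qed
  have c3: "card {k \<in> leaves s. t k = 3 \<and> end_demand s (fst k)} \<le> card {y. leaf3 s y \<and> end_demand s (y + 4)}"
  proof (rule card_leaf[where d = 4])
    fix y B assume h: "(y, B) \<in> leaves s" "t (y, B) = 3 \<and> end_demand s (fst (y, B))"
    then show "y = pred_in B y + 4 \<and> pred_in B y \<in> {y. leaf3 s y \<and> end_demand s (y + 4)}" using l3[of y B] by (metis fst_conv mem_Collect_eq)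
  qed (rule finite_leaf(3))
  have c4: "card {k \<in> leaves s. t k = 3 \<and> start_demand s (fst k)} \<le> card {y. leaf3 s y \<and> start_demand s (y + 4)}"
  proof (rule card_leaf[where d = 4])
    fix y B assume h: "(y, B) \<in> leaves s" "t (y, B) = 3 \<and> start_demand s (fst (y, B))"
    then show "y = pred_in B y + 4 \<and> pred_in B y \<in> {y. leaf3 s y \<and> start_demand s (y + 4)}" using l3[of y B] by (metis fst_conv mem_Collect_eq)
  qed (rule finite_leaf(3))
  show ?thesis unfolding eq using c1 c2 c3 c4 by linarith
qed

text \<open>The charged edges are pairwise distinct: two leaves charging the same edge would
  overlap, with an end of one among the unattached inner positions of the other.\<close>

lemma count_edge_demand:
  "card {a. leaf2 s a} + card {y. leaf3 s y \<and> end_demand s (y + 4)} + card {y. leaf3 s y \<and> start_demand s (y + 4)} \<le> card {v. edge_demand (\<not> s) v}"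
proof -
  let ?A = "(\<lambda>a. a + 2) ` {a. leaf2 s a}" and ?B = "(\<lambda>y. y + 2) ` {y. leaf3 s y \<and> end_demand s (y + 4)}"
    and ?C = "(\<lambda>y. y + 3) ` {y. leaf3 s y \<and> start_demand s (y + 4)}"
  have in2: "a \<in> attached s" "a + 3 \<in> attached s" "a + 1 \<notin> attached s" if "leaf2 s a" for a using that by (auto simp: leaf2_def attached_iff)
  have in3: "a \<in> attached s" "a + 1 \<notin> attached s" "a + 3 \<notin> attached s" if "leaf3 s a" for a using that by (auto simp: leaf3_def attached_iff)
  have f: "finite ?A" "finite ?B" "finite ?C" using finite_leaf(2)[of s "\<lambda>_. True"] finite_leaf(3) by auto
  have d1: "?A \<inter> ?B = {}"
  proof (rule ccontr)
    assume "\<not> ?thesis"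
    then obtain a where "leaf2 s a" "leaf3 s a" by auto
    then show False using in2(2)[of a] in3(3)[of a] by blast
  qed
  have d2: "(?A \<union> ?B) \<inter> ?C = {}"
  proof -
    have "False" if "leaf3 s y" "y + 3 = a + 2" "leaf2 s a \<or> leaf3 s a" for y a
    proof -
      have "a = y + 1" using that by simp
      then show False using in2[of a] in3[of a] in3[of y] that by auto
    qed
    note n = this
    show ?thesis
    proof (rule ccontr)
      assume "\<not> ?thesis"
      then obtain x where x: "x \<in> ?A \<union> ?B" "x \<in> ?C" by blast
      then obtain y where y: "x = y + 3" "leaf3 s y" by blast
      from x(1) obtain a where "x = a + 2" "leaf2 s a \<or> leaf3 s a" by blast
      then show False using n[of y a] y by simp
    qed
  qed
  have "card (?A \<union> ?B \<union> ?C) = card ?A + card ?B + card ?C"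
    using card_Un_disjoint[OF _ f(3) d2] card_Un_disjoint[OF f(1,2) d1] f by simp
  also have "\<dots> = card {a. leaf2 s a} + card {y. leaf3 s y \<and> end_demand s (y + 4)} + card {y. leaf3 s y \<and> start_demand s (y + 4)}"
    by (subst (1 2 3) card_image) (auto intro!: inj_onI)
  finally have "card {a. leaf2 s a} + card {y. leaf3 s y \<and> end_demand s (y + 4)} + card {y. leaf3 s y \<and> start_demand s (y + 4)} = card (?A \<union> ?B \<union> ?C)" by simp
  also have "\<dots> \<le> card {v. edge_demand (\<not> s) v}"
    by (rule card_mono[OF finite_demand(2)]) (auto simp: edge_demand_def)
  finally show ?thesis .
qed

lemma count_left:
  "card {a. leaf1 s a} \<le> card {a. leaf1 s a \<and> a \<in> attached (\<not> s)} + card {v. end_demand (\<not> s) v}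
     + card {a. leaf1 s a \<and> a \<notin> attached (\<not> s) \<and> mult s a \<noteq> 1}"
proof -
  let ?A = "{a. leaf1 s a \<and> a \<in> attached (\<not> s)}" and ?B = "{a. leaf1 s a \<and> a \<notin> attached (\<not> s) \<and> mult s a = 1}"
    and ?C = "{a. leaf1 s a \<and> a \<notin> attached (\<not> s) \<and> mult s a \<noteq> 1}"
  have U: "{a. leaf1 s a} = ?A \<union> ?B \<union> ?C" by blast
  have "card {a. leaf1 s a} \<le> card ?A + card ?B + card ?C"
    unfolding U using card_Un_le[of "?A \<union> ?B" ?C] card_Un_le[of ?A ?B] by linarith
  moreover have "card ?B \<le> card {v. end_demand (\<not> s) v}"
    by (rule card_inj_on_le[of Suc, OF _ _ finite_demand(1)]) (auto simp: end_demand_def)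
  ultimately show ?thesis by linarith
qed

text \<open>The recipient of a demand to the right is the next attached position of the other side.
  A leaf near the cut may have none, but at most one leaf does: the position \<open>a + 1\<close> of
  any such leaf is attached on the other side and would serve every leaf further left. This accounts
  for the summand 1.\<close>

lemma count_right:
  "card {a. leaf1 s a} \<le> card {a. leaf1 s a \<and> a + 2 \<in> attached (\<not> s)} + card {v \<in> attached (\<not> s). start_demand (\<not> s) v} + 1"
proof -
  let ?A = "{a. leaf1 s a \<and> a + 2 \<in> attached (\<not> s)}"
  let ?B = "{a. leaf1 s a \<and> a + 2 \<notin> attached (\<not> s) \<and> (\<exists>v\<in>attached (\<not> s). a + 2 < v)}"
  let ?C = "{a. leaf1 s a \<and> a + 2 \<notin> attached (\<not> s) \<and> \<not> (\<exists>v\<in>attached (\<not> s). a + 2 < v)}"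
  have U: "{a. leaf1 s a} = ?A \<union> ?B \<union> ?C" by blast
  have "card {a. leaf1 s a} \<le> card ?A + card ?B + card ?C"
    unfolding U using card_Un_le[of "?A \<union> ?B" ?C] card_Un_le[of ?A ?B] by linarith
  moreover have "card ?C \<le> 1"
  proof -
    have "a = b" if "a \<in> ?C" "b \<in> ?C" for a b
    proof -
      have *: "a' \<le> b'" if "a' \<in> ?C" "b' \<in> ?C" for a' b'
      proof (rule ccontr)
        assume "\<not> a' \<le> b'"
        moreover have "a' + 1 \<in> attached (\<not> s)" using leaf1_attached that by blast
        moreover have "b' + 2 \<notin> attached (\<not> s)" using that by blast
        ultimately have "b' + 2 < a' + 1 \<or> a' + 1 = b' + 2" by linarith
        then show False using that \<open>a' + 1 \<in> _\<close> by (metis (lifting) mem_Collect_eq)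
      qed
      show ?thesis using *[OF that] *[OF that(2,1)] by simp
    qed
    then show ?thesis using finite_leaf(1) by (simp add: card_le_Suc0_iff_eq)
  qed
  moreover have "card ?B \<le> card {v \<in> attached (\<not> s). start_demand (\<not> s) v}"
  proof -
    define nx where "nx a = (LEAST v. v \<in> attached (\<not> s) \<and> a + 2 < v)" for a
    have nx: "nx a \<in> attached (\<not> s)" "a + 2 < nx a" "{a + 2..<nx a} \<inter> attached (\<not> s) = {}" if a: "a \<in> ?B" for a
    proof -
      obtain v where "v \<in> attached (\<not> s) \<and> a + 2 < v" using a by blast
      from LeastI[of "\<lambda>v. v \<in> attached (\<not> s) \<and> a + 2 < v", OF this]
      show 1: "nx a \<in> attached (\<not> s)" "a + 2 < nx a" unfolding nx_def by auto
      have "u \<notin> attached (\<not> s)" if "a + 2 \<le> u" "u < nx a" for u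
      proof
        assume u: "u \<in> attached (\<not> s)"
        then have "u \<noteq> a + 2" using a by blast
        then have "nx a \<le> u" unfolding nx_def using u that by (intro Least_le) auto
        then show False using that by simp
      qed
      then show "{a + 2..<nx a} \<inter> attached (\<not> s) = {}" by (auto simp: disjoint_iff)
    qed
    show ?thesis
    proof (rule card_inj_on_le[of nx])
      show "inj_on nx ?B"
      proof (rule inj_onI)
        fix a b assume h: "a \<in> ?B" "b \<in> ?B" "nx a = nx b"
        have *: "a' \<le> b'" if "a' \<in> ?B" "b' \<in> ?B" "nx a' = nx b'" for a' b'
        proof (rule ccontr)
          assume l: "\<not> a' \<le> b'"
          have "a' + 1 \<in> attached (\<not> s)" using leaf1_attached that by blast
          moreover have "a' + 1 \<in> {b' + 2..<nx b'}" using l nx(2)[OF that(1)] that(3) by auto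
          ultimately show False using nx(3)[OF that(2)] by blast
        qed
        show "a = b" using *[OF h] *[OF h(2,1) h(3)[symmetric]] by simp
      qed
      show "nx ` ?B \<subseteq> {v \<in> attached (\<not> s). start_demand (\<not> s) v}"
      proof (intro image_subsetI CollectI conjI)
        fix a assume a: "a \<in> ?B"
        show "nx a \<in> attached (\<not> s)" using nx[OF a] by blast
        show "start_demand (\<not> s) (nx a)" unfolding start_demand_def not_not using nx[OF a] a by blast
      qed
      show "finite {v \<in> attached (\<not> s). start_demand (\<not> s) v}" using finite_attached by simp
    qed
  qed
  ultimately show ?thesis by linarith
qed

text \<open>The inner position \<open>a + 1\<close> is unattached on the leaf's own side and
  attached on the other, so \<open>a\<close> cannot start leaves of both sides. Hence a common foot
  is charged at most once as a left end (\<open>d = 0\<close>) and once as a right end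
  (\<open>d = 2\<close>).\<close>

lemma count_both:
  assumes d: "d = 0 \<or> d = 2"
  shows "card {a. leaf1 True a \<and> a + d \<in> attached False} + card {a. leaf1 False a \<and> a + d \<in> attached True} \<le> card (attached True \<inter> attached False)"
proof -
  let ?A = "(\<lambda>a. a + d) ` {a. leaf1 True a \<and> a + d \<in> attached False}" and ?B = "(\<lambda>a. a + d) ` {a. leaf1 False a \<and> a + d \<in> attached True}"
  have "?A \<inter> ?B = {}"
  proof -
    have "\<not> (leaf1 True a \<and> leaf1 False a)" for a using leaf1_attached[of True a] by (auto simp: leaf1_def)
    then show ?thesis by auto
  qed
  then have "card ?A + card ?B = card (?A \<union> ?B)" using finite_leaf(1) by (intro card_Un_disjoint[symmetric]) auto
  also have "\<dots> \<le> card (attached True \<inter> attached False)"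
    using finite_attached d by (intro card_mono) (auto simp: leaf1_def attached_iff)
  finally show ?thesis by (subst (asm) (1 2) card_image) (auto intro!: inj_onI)
qed

text \<open>A bridge of least extent has a childless first corner, so the position after its first
  foot is attached on the other side only. Thus a bridge on one side forces one on the
  other.\<close>

lemma F_nonempty: "F s \<noteq> {}"
proof -
  have step: "F (\<not> s) \<noteq> {}" if ne0: "F s \<noteq> {}" for s
  proof -
    obtain A where A: "A \<in> F s" "\<forall>A'\<in>F s. extent A \<le> extent A'"
    proof -
      have "Min (extent ` F s) \<in> extent ` F s" using ne0 finite_F by (intro Min_in) auto
      then obtain A where "A \<in> F s" "extent A = Min (extent ` F s)" by auto
      then show ?thesis using that finite_F by auto
    qed
    define x where "x = Min A"
    note m = Min_Max[OF A(1)]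
    let ?T = "{z \<in> A. x < z}"
    have fA: "finite A" using finite_B[OF A(1)] .
    have ne: "?T \<noteq> {}" using m unfolding x_def by force
    define y where "y = Min ?T"
    have y: "y \<in> A" "x < y" using Min_in[of ?T] ne fA by (auto simp: y_def)
    have e: "{x<..<y} \<inter> A = {}"
    proof (rule ccontr)
      assume "\<not> ?thesis"
      then have "\<exists>z. z \<in> ?T \<and> z < y" by auto
      then obtain z where z: "z \<in> ?T" "z < y" by blast
      have "finite ?T" using fA by simp
      from Min_le[OF this z(1)] show False using z(2) by (simp add: y_def)
    qed
    note c = cornersI[OF A(1) _ y(1,2) e]
    have xA: "x \<in> A" using m by (simp add: x_def)
    have "children s (y, A) = {}"
    proof (rule ccontr)
      assume "\<not> ?thesis"
      then obtain C where "C \<in> F s" "parent s C = Some (y, A)" by (auto simp: children_def)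
      then show False using extent_less[OF c(1)[OF xA] _ parent_Some(3)] A(2) by force
    qed
    then have "{x<..<y} \<inter> attached s = {}" using leaf_unatt[OF c(1)[OF xA]] c(2)[OF xA] by simp
    moreover have "y \<noteq> Suc x" using no_consecutive[OF A(1) xA] y by auto
    then have "x + 1 \<in> {x<..<y}" using y by auto
    ultimately have "x + 1 \<notin> attached s" by blast
    then have "x + 1 \<in> attached (\<not> s)" using cover'[of "x + 1" s] B_less[OF A(1) y(1)] y by simp
    then show ?thesis by (auto simp: attached_iff)
  qed
  obtain t where "F t \<noteq> {}" using cover[OF n_pos] by blast
  then show ?thesis using step[of t] by (cases "s = t") auto
qed

lemma card_attached: "n + card (attached True \<inter> attached False) = card (attached True) + card (attached False)"
proof -
  have "attached True \<union> attached False = {..<n}"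
  proof
    show "attached True \<union> attached False \<subseteq> {..<n}" using attached_less by blast
    show "{..<n} \<subseteq> attached True \<union> attached False" using cover'[of _ True] by auto
  qed
  then show ?thesis using card_Un_Int[OF finite_attached[of True] finite_attached[of False]] by simp
qed

text \<open>Let \<open>c\<close> be the number of common feet. Over both sides the issued units
  exceed the demands by at least \<open>2 * c + 4\<close> according to Euler, but by at most
  \<open>2 * c + 2\<close> according to the matching.\<close>

theorem no_ring_system: False
proof -
  have net: "(\<Sum>i\<in>incidences s. net s i) = (\<Sum>i\<in>incidences s. weight s i) - (\<Sum>i\<in>incidences s. demand s i)" for s
    by (simp add: net_def sum_subtractf)
  note T = side_sum[OF F_nonempty, of True] sum_weight[of True] sum_demand[of True] sum_issued[of True] net[of True]
  note U = side_sum[OF F_nonempty, of False] sum_weight[of False] sum_demand[of False] sum_issued[of False] net[of False]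
  note c = count_edge_demand[of True] count_edge_demand[of False] count_left[of True] count_left[of False]
    count_right[of True] count_right[of False] count_both[of 0] count_both[of 2] card_attached
  show False using T U c by simp
qed

end

section \<open>Cycles through positions and bridges\<close>

text \<open>An item is a position of the ring, or the bridge with feet B on side s, given as Inr (s, B).\<close>

type_synonym item = "nat + bool \<times> nat set"

fun item_adj :: "nat \<Rightarrow> (bool \<Rightarrow> nat set set) \<Rightarrow> item \<Rightarrow> item \<Rightarrow> bool" where
  "item_adj n F (Inl i) (Inl j) \<longleftrightarrow> i < n \<and> j < n \<and> (j = Suc i \<or> i = Suc j \<or> i = 0 \<and> j = n - 1 \<or> j = 0 \<and> i = n - 1)"
| "item_adj n F (Inl i) (Inr (s, B)) \<longleftrightarrow> B \<in> F s \<and> i \<in> B"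
| "item_adj n F (Inr (s, B)) (Inl i) \<longleftrightarrow> B \<in> F s \<and> i \<in> B"
| "item_adj n F (Inr _) (Inr _) \<longleftrightarrow> False"

abbreviation up :: "nat \<Rightarrow> nat \<Rightarrow> item list" where "up a b \<equiv> map Inl [a..<b]"
abbreviation dn :: "nat \<Rightarrow> nat \<Rightarrow> item list" where "dn a b \<equiv> rev (map Inl [a..<b])"

lemma successively_up: "b \<le> n \<Longrightarrow> successively (item_adj n F) (up a b)"
proof (induction b)
  case (Suc b)
  then show ?case by (cases "a < b") (auto simp: successively_append_iff last_map)
qed simp

lemma item_adj_sym: "item_adj n F x y = item_adj n F y x"
  by (cases "(n, F, x, y)" rule: item_adj.cases) auto

lemma successively_dn: "b \<le> n \<Longrightarrow> successively (\<lambda>x y. item_adj n F y x) (up a b)"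
  using successively_up[of b n F a] by (subst item_adj_sym)

lemma distinct_up: "distinct (up a b)"
  by (simp add: distinct_map)

text \<open>Abstract form of the longest circuit: a bridge counts as one item, although a real
  detour through it may visit more vertices. Each rerouting assumption of \<open>ring_system\<close>
  thus becomes the comparison of one explicit cyclic list with \<open>n\<close>.\<close>

locale ring_items =
  fixes n :: nat and F :: "bool \<Rightarrow> nat set set"
  assumes finite_F: "finite (F s)"
    and sub: "B \<in> F s \<Longrightarrow> B \<subseteq> {..<n}"
    and card3: "B \<in> F s \<Longrightarrow> 3 \<le> card B"
    and noncross: "\<lbrakk>A \<in> F s; B \<in> F s; A \<noteq> B; a \<in> A; b \<in> A; x \<in> B; y \<in> B; a < x; x < b\<rbrakk> \<Longrightarrow> a \<le> y \<and> y \<le> b"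
    and cover: "v < n \<Longrightarrow> \<exists>s. \<exists>B\<in>F s. v \<in> B"
    and n3: "3 \<le> n"
    and no_long_cycle: "\<lbrakk>xs = Inl i # ys; successively (item_adj n F) xs; item_adj n F (last xs) (Inl i); distinct xs; 3 \<le> length xs\<rbrakk>
       \<Longrightarrow> length xs \<le> n"
begin

lemma no_long_cycle':
  assumes "successively (item_adj n F) xs" "item_adj n F (last xs) (hd xs)" "distinct xs" "hd xs = Inl i" "xs \<noteq> []"
  shows "length xs \<le> n"
proof (cases "3 \<le> length xs")
  case True
  then show ?thesis using no_long_cycle[of xs i "tl xs"] assms by (cases xs) auto
qed (use n3 in simp)

lemmas s_simps = successively_append_iff successively_Cons successively_up successively_dn distinct_up hd_append hd_map hd_rev last_map last_rev

lemma less: "\<lbrakk>B \<in> F s; v \<in> B\<rbrakk> \<Longrightarrow> v < n" using sub by blast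

text \<open>Otherwise the bridge could be inserted between \<open>v\<close> and
  \<open>Suc v\<close>.\<close>

lemma no_consecutive: assumes "B \<in> F s" "v \<in> B" shows "Suc v \<notin> B"
proof
  assume v: "Suc v \<in> B"
  have "Suc v < n" using less assms v by blast
  then have "length (up (Suc v) n @ up 0 (Suc v) @ [Inr (s, B)]) \<le> n"
    by (intro no_long_cycle'[where i = "Suc v"]) (use assms v in \<open>auto simp: s_simps simp del: upt_Suc\<close>)
  then show False using \<open>Suc v < n\<close> by simp
qed

text \<open>The tour follows the ring from \<open>z\<close> to \<open>a\<close>, takes
  \<open>w\<close> to \<open>a + 2\<close>, steps back to \<open>a + 1\<close> and takes
  \<open>D\<close> to \<open>z\<close>. It gains two bridges and misses only the positions strictly
  between \<open>a + 2\<close> and \<open>z\<close>.\<close>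

lemma jump_left: assumes "w \<in> F s" "D \<in> F (\<not> s)" "a \<in> w" "a + 2 \<in> w" "a + 1 \<in> D" "z \<in> D" "a + 1 < z"
  shows "a + 5 \<le> z"
proof (rule ccontr)
  assume n: "\<not> a + 5 \<le> z"
  have "z \<noteq> a + 2" using no_consecutive[OF assms(2,5)] assms by auto
  then have z: "a + 2 < z" "z < n" using assms less by auto
  then have "length (up z n @ up 0 (a + 1) @ [Inr (s, w), Inl (a + 2), Inl (a + 1), Inr (\<not> s, D)]) \<le> n"
    by (intro no_long_cycle'[where i = z]) (use assms in \<open>auto simp: s_simps simp del: upt_Suc\<close>)
  then show False using n z by simp
qed

lemma jump_right: assumes "w \<in> F s" "D \<in> F (\<not> s)" "c \<in> w" "c + 2 \<in> w" "c + 1 \<in> D" "y \<in> D" "y < c + 1"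
  shows "y + 3 \<le> c"
proof (rule ccontr)
  assume n: "\<not> y + 3 \<le> c"
  have "y \<noteq> c" using no_consecutive[OF assms(2,6)] assms by auto
  then have z: "y < c" "c + 2 < n" using assms less by auto
  then have "length (up (c + 2) n @ up 0 (y + 1) @ [Inr (\<not> s, D), Inl (c + 1), Inl c, Inr (s, w)]) \<le> n"
    by (intro no_long_cycle'[where i = "c + 2"]) (use assms in \<open>auto simp: s_simps simp del: upt_Suc\<close>)
  then show False using n z by simp
qed

lemma jump_both: assumes "w \<in> F s" "w' \<in> F s" "w \<noteq> w'" "D \<in> F (\<not> s)" "a \<in> w" "a + 2 \<in> w" "a + 1 \<in> D"
  "c \<in> w'" "c + 2 \<in> w'" "c + 1 \<in> D" "a < c"
  shows "a + 6 \<le> c"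
proof (rule ccontr)
  assume n: "\<not> a + 6 \<le> c"
  \<comment> \<open>Keeps the two jumps apart: the tour is free of repetitions only if
    \<open>a + 2 < c\<close>.\<close>
  have "a + 5 \<le> c + 1" using jump_left[OF assms(1,4,5,6,7,10)] assms(11) by simp
  then have z: "a + 2 < c" "c + 2 < n" using assms less by auto
  then have "length (up (c + 2) n @ up 0 (a + 1) @ [Inr (s, w), Inl (a + 2), Inl (a + 1), Inr (\<not> s, D),
      Inl (c + 1), Inl c, Inr (s, w')]) \<le> n"
    by (intro no_long_cycle'[where i = "c + 2"]) (use assms in \<open>auto simp: s_simps simp del: upt_Suc\<close>)
  then show False using n z by simp
qed

text \<open>The tour drops the circuit edges after \<open>a\<close> and after \<open>v\<close>,
  reconnects the pieces by \<open>w\<close>, \<open>P\<close> and \<open>Q\<close>, and traverses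
  some of them backwards. It gains three bridges and misses the positions strictly between
  \<open>q\<close> and \<open>p\<close>.\<close>

lemma detour_after: assumes "w \<in> F s" "P \<in> F (\<not> s)" "Q \<in> F (\<not> s)" "P \<noteq> Q" "a \<in> w" "v + 1 \<in> w" "a + 1 \<in> P" "v \<in> Q" "a + 1 \<le> v"
  "q \<in> Q" "p \<in> P" "v + 1 < q" "q < p"
  shows "q + 4 \<le> p"
proof (rule ccontr)
  assume n: "\<not> q + 4 \<le> p"
  have z: "p < n" using assms less by auto
  then have "length (dn 0 (a + 1) @ dn p n @ [Inr (\<not> s, P)] @ up (a + 1) (v + 1) @ [Inr (\<not> s, Q)] @ dn (v + 1) (q + 1)
      @ [Inr (s, w)]) \<le> n"
    by (intro no_long_cycle'[where i = a]) (use assms in \<open>auto simp: s_simps simp del: upt_Suc\<close>)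
  then show False using n z assms by simp
qed

lemma detour_before: assumes "w \<in> F s" "P \<in> F (\<not> s)" "Q \<in> F (\<not> s)" "P \<noteq> Q" "a \<in> w" "v + 1 \<in> w" "a + 1 \<in> P" "v \<in> Q" "a + 1 \<le> v"
  "q \<in> Q" "p \<in> P" "q < p" "p < a"
  shows "q + 4 \<le> p"
proof (rule ccontr)
  assume n: "\<not> q + 4 \<le> p"
  have z: "v + 1 < n" using assms less by auto
  then have "length (dn p (a + 1) @ [Inr (\<not> s, P)] @ up (a + 1) (v + 1) @ [Inr (\<not> s, Q)] @ dn 0 (q + 1) @ dn (v + 1) n
      @ [Inr (s, w)]) \<le> n"
    by (intro no_long_cycle'[where i = a]) (use assms in \<open>auto simp: s_simps simp del: upt_Suc\<close>)
  then show False using n z assms by simp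
qed

lemma left_detour_after: assumes "w \<in> F s" "P \<in> F s" "Q \<in> F s" "w \<noteq> P" "w \<noteq> Q" "P \<noteq> Q" "D \<in> F (\<not> s)" "a \<in> w" "a + 2 \<in> w"
  "a + 1 \<in> D" "a + 5 \<in> D" "a + 3 \<in> P" "a + 4 \<in> Q" "q \<in> Q" "p \<in> P" "a + 5 < q" "q < p"
  shows "q + 4 \<le> p"
proof (rule ccontr)
  assume n: "\<not> q + 4 \<le> p"
  have z: "p < n" using assms less by auto
  then have "length (up (a + 5) (q + 1) @ [Inr (s, Q), Inl (a + 4), Inl (a + 3), Inr (s, P)] @ up p n @ up 0 (a + 1)
      @ [Inr (s, w), Inl (a + 2), Inl (a + 1), Inr (\<not> s, D)]) \<le> n"
    by (intro no_long_cycle'[where i = "a + 5"]) (use assms in \<open>auto simp: s_simps simp del: upt_Suc\<close>)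
  then show False using n z assms by simp
qed

lemma left_detour_before: assumes "w \<in> F s" "P \<in> F s" "Q \<in> F s" "w \<noteq> P" "w \<noteq> Q" "P \<noteq> Q" "D \<in> F (\<not> s)" "a \<in> w" "a + 2 \<in> w"
  "a + 1 \<in> D" "a + 5 \<in> D" "a + 3 \<in> P" "a + 4 \<in> Q" "q \<in> Q" "p \<in> P" "q < p" "p \<le> a"
  shows "q + 4 \<le> p"
proof (rule ccontr)
  assume n: "\<not> q + 4 \<le> p"
  have z: "a + 5 < n" using assms less by auto
  then have "length (up (a + 5) n @ up 0 (q + 1) @ [Inr (s, Q), Inl (a + 4), Inl (a + 3), Inr (s, P)] @ up p (a + 1)
      @ [Inr (s, w), Inl (a + 2), Inl (a + 1), Inr (\<not> s, D)]) \<le> n"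
    by (intro no_long_cycle'[where i = "a + 5"]) (use assms in \<open>auto simp: s_simps simp del: upt_Suc\<close>)
  then show False using n z assms by simp
qed

lemma right_detour_after: assumes "w \<in> F s" "P \<in> F s" "Q \<in> F s" "w \<noteq> P" "w \<noteq> Q" "P \<noteq> Q" "D \<in> F (\<not> s)" "y + 3 \<in> w" "y + 5 \<in> w"
  "y \<in> D" "y + 4 \<in> D" "y + 1 \<in> P" "y + 2 \<in> Q" "q \<in> Q" "p \<in> P" "y + 5 \<le> q" "q < p"
  shows "q + 4 \<le> p"
proof (rule ccontr)
  assume n: "\<not> q + 4 \<le> p"
  have z: "p < n" using assms less by auto
  then have "length (up (y + 5) (q + 1) @ [Inr (s, Q), Inl (y + 2), Inl (y + 1), Inr (s, P)] @ up p n @ up 0 (y + 1)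
      @ [Inr (\<not> s, D), Inl (y + 4), Inl (y + 3), Inr (s, w)]) \<le> n"
    by (intro no_long_cycle'[where i = "y + 5"]) (use assms in \<open>auto simp: s_simps simp del: upt_Suc\<close>)
  then show False using n z assms by simp
qed

lemma right_detour_before: assumes "w \<in> F s" "P \<in> F s" "Q \<in> F s" "w \<noteq> P" "w \<noteq> Q" "P \<noteq> Q" "D \<in> F (\<not> s)" "y + 3 \<in> w" "y + 5 \<in> w"
  "y \<in> D" "y + 4 \<in> D" "y + 1 \<in> P" "y + 2 \<in> Q" "q \<in> Q" "p \<in> P" "q < p" "p < y"
  shows "q + 4 \<le> p"
proof (rule ccontr)
  assume n: "\<not> q + 4 \<le> p"
  have z: "y + 5 < n" using assms less by auto
  then have "length (up (y + 5) n @ up 0 (q + 1) @ [Inr (s, Q), Inl (y + 2), Inl (y + 1), Inr (s, P)] @ up p (y + 1)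
      @ [Inr (\<not> s, D), Inl (y + 4), Inl (y + 3), Inr (s, w)]) \<le> n"
    by (intro no_long_cycle'[where i = "y + 5"]) (use assms in \<open>auto simp: s_simps simp del: upt_Suc\<close>)
  then show False using n z assms by simp
qed

lemma no_ring_items: False
proof -
  interpret ring_system n F
    by unfold_locales (fact finite_F sub card3 noncross cover no_consecutive jump_left jump_right jump_both detour_after detour_before left_detour_after left_detour_before right_detour_after right_detour_before | use n3 in simp)+
  show False by (rule no_ring_system)
qed

end

section \<open>Circuits as lists\<close>

definition cyc_edges :: "'a list \<Rightarrow> 'a set set" where
  "cyc_edges ys = (\<lambda>i. {ys ! i, ys ! (Suc i mod length ys)}) ` {..<length ys}"

lemma inj_on_cyc_edges:
  assumes "distinct ys" "3 \<le> length ys"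
  shows "inj_on (\<lambda>i. {ys ! i, ys ! (Suc i mod length ys)}) {..<length ys}"
proof (rule inj_onI)
  fix i j assume h: "i \<in> {..<length ys}" "j \<in> {..<length ys}"
    and e: "{ys ! i, ys ! (Suc i mod length ys)} = {ys ! j, ys ! (Suc j mod length ys)}"
  let ?m = "length ys"
  have l: "Suc i mod ?m < ?m" "Suc j mod ?m < ?m" using assms by (auto intro!: mod_less_divisor)
  have nth: "ys ! a = ys ! b \<longleftrightarrow> a = b" if "a < ?m" "b < ?m" for a b using assms(1) that by (simp add: nth_eq_iff_index_eq)
  from e have "ys ! i = ys ! j \<or> ys ! i = ys ! (Suc j mod ?m) \<and> ys ! (Suc i mod ?m) = ys ! j"
    by (auto simp: doubleton_eq_iff)
  then have "i = j \<or> i = Suc j mod ?m \<and> Suc i mod ?m = j" using h l nth by simp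
  then show "i = j" using h assms(2) by (auto simp: mod_Suc split: if_splits)
qed

lemma card_cyc_edges: "\<lbrakk>distinct ys; 3 \<le> length ys\<rbrakk> \<Longrightarrow> card (cyc_edges ys) = length ys"
  unfolding cyc_edges_def by (simp add: card_image inj_on_cyc_edges)

lemma circuit_of_list:
  assumes G: "simple_graph G" and d: "distinct ys" and m: "3 \<le> length ys" and e: "cyc_edges ys \<subseteq> edges G"
  shows "circuit G (set ys, cyc_edges ys)"
proof -
  let ?m = "length ys" and ?E = "cyc_edges ys"
  have lt: "Suc i mod ?m < ?m" for i using m by (auto intro!: mod_less_divisor)
  have nth: "ys ! a = ys ! b \<longleftrightarrow> a = b" if "a < ?m" "b < ?m" for a b using d that by (simp add: nth_eq_iff_index_eq)
  have E: "{ys ! i, ys ! (Suc i mod ?m)} \<in> ?E" if "i < ?m" for i using that by (auto simp: cyc_edges_def)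
  have sub: "u \<subseteq> set ys \<and> card u = 2" if uE: "u \<in> ?E" for u
  proof -
    obtain i where i: "i < ?m" "u = {ys ! i, ys ! (Suc i mod ?m)}" using uE by (auto simp: cyc_edges_def)
    have "i \<noteq> Suc i mod ?m" using i m by (auto simp: mod_Suc)
    then show ?thesis using i lt nth by (auto simp: card_insert_if)
  qed
  have sg: "simple_graph (set ys, ?E)" using sub by (auto simp: simple_graph_def)
  have "set ys \<subseteq> verts G"
  proof
    fix v assume "v \<in> set ys"
    then obtain i where i: "i < ?m" "v = ys ! i" by (auto simp: in_set_conv_nth)
    then have "{v, ys ! (Suc i mod ?m)} \<in> edges G" using E[OF i(1)] e by auto
    then show "v \<in> verts G" using G by (auto simp: simple_graph_def)
  qed
  then have subg: "subgraph (set ys, ?E) G" using sg e by (simp add: subgraph_def)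
  have sym: "sym (adjacency (set ys, ?E))" by (auto simp: sym_def adjacency_def insert_commute)
  have r: "(ys ! 0, ys ! i) \<in> (adjacency (set ys, ?E))\<^sup>*" if "i < ?m" for i
    using that
  proof (induction i)
    case (Suc i)
    then have "(ys ! i, ys ! Suc i) \<in> adjacency (set ys, ?E)" using E[of i] by (simp add: adjacency_def)
    then show ?case using Suc by (meson Suc_lessD rtrancl.rtrancl_into_rtrancl)
  qed simp
  have conn: "graph_connected (set ys, ?E)"
    unfolding graph_connected_def
  proof (intro conjI ballI)
    show "verts (set ys, ?E) \<noteq> {}" using m by auto
    fix u v assume "u \<in> verts (set ys, ?E)" "v \<in> verts (set ys, ?E)"
    then obtain i j where "i < ?m" "u = ys ! i" "j < ?m" "v = ys ! j" by (auto simp: in_set_conv_nth)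
    then show "(u, v) \<in> (adjacency (set ys, ?E))\<^sup>*" using r[of i] r[of j] symD[OF sym_rtrancl[OF sym]]
      by (meson rtrancl_trans)
  qed
  have "vertex_degree (set ys, ?E) v = 2" if "v \<in> set ys" for v
  proof -
    obtain i where i: "i < ?m" "v = ys ! i" using \<open>v \<in> set ys\<close> by (auto simp: in_set_conv_nth)
    define p where "p = (if i = 0 then ?m - 1 else i - 1)"
    have p: "p < ?m" "Suc p mod ?m = i" "p \<noteq> i" using i m by (auto simp: p_def)
    have pu: "j = p" if "j < ?m" "Suc j mod ?m = i" for j using that i by (auto simp: p_def mod_Suc split: if_splits)
    let ?f = "\<lambda>i. {ys ! i, ys ! (Suc i mod ?m)}"
    have "{e \<in> ?E. v \<in> e} = ?f ` {i, p}"
    proof (intro set_eqI iffI)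
      fix e assume "e \<in> {e \<in> ?E. v \<in> e}"
      then obtain j where j: "j < ?m" "e = ?f j" "v \<in> e" by (auto simp: cyc_edges_def)
      then have "j = i \<or> Suc j mod ?m = i" using nth i lt by auto
      then show "e \<in> ?f ` {i, p}" using j pu by blast
    next
      fix e assume "e \<in> ?f ` {i, p}"
      then show "e \<in> {e \<in> ?E. v \<in> e}" using i p E by auto
    qed
    moreover have "card (?f ` {i, p}) = 2"
      using inj_on_subset[OF inj_on_cyc_edges[OF d m], of "{i, p}"] i p by (simp add: card_image)
    ultimately show ?thesis by (simp add: vertex_degree_def)
  qed
  then show ?thesis using subg conn by (simp add: circuit_def)
qed

lemma degree_neighbours:
  assumes "simple_graph C"
  shows "vertex_degree C v = card {u. {v, u} \<in> edges C}"
proof -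
  have "bij_betw (\<lambda>u. {v, u}) {u. {v, u} \<in> edges C} {e \<in> edges C. v \<in> e}"
  proof (rule bij_betwI')
    fix x y show "({v, x} = {v, y}) = (x = y)" by (auto simp: doubleton_eq_iff)
  next
    fix x assume "x \<in> {u. {v, u} \<in> edges C}" then show "{v, x} \<in> {e \<in> edges C. v \<in> e}" by simp
  next
    fix e assume e: "e \<in> {e \<in> edges C. v \<in> e}"
    then have "card e = 2" using assms by (auto simp: simple_graph_def)
    then obtain a b where "e = {a, b}" by (auto simp: card_2_iff)
    then show "\<exists>x\<in>{u. {v, u} \<in> edges C}. e = {v, x}" using e by (auto simp: insert_commute)
  qed
  then show ?thesis unfolding vertex_degree_def by (simp add: bij_betw_same_card)
qed

lemma edge_neq: "\<lbrakk>simple_graph C; {u, v} \<in> edges C\<rbrakk> \<Longrightarrow> u \<noteq> v"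
  by (auto simp: simple_graph_def)

lemma edge_verts: "\<lbrakk>simple_graph C; {u, v} \<in> edges C\<rbrakk> \<Longrightarrow> u \<in> verts C \<and> v \<in> verts C"
  by (auto simp: simple_graph_def)

text \<open>Take a longest path. Its last vertex has both neighbours on it, and the one other than
  its predecessor must be the first vertex, since an inner vertex would get degree 3. The cycle so
  obtained is closed under adjacency, and connectedness makes it everything.\<close>

lemma list_of_circuit:
  assumes "circuit G C"
  obtains ys where "distinct ys" "3 \<le> length ys" "set ys = verts C" "cyc_edges ys = edges C"
proof -
  have sg: "simple_graph C" and conn: "graph_connected C" and deg: "\<And>v. v \<in> verts C \<Longrightarrow> vertex_degree C v = 2"
    using assms by (auto simp: circuit_def subgraph_def)
  let ?N = "\<lambda>v. {u. {v, u} \<in> edges C}"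
  have fin: "finite (verts C)" using sg by (simp add: simple_graph_def)
  have N2: "card (?N v) = 2" if "v \<in> verts C" for v using deg[OF that] degree_neighbours[OF sg] by simp
  let ?A = "\<lambda>u v. {u, v} \<in> edges C"
  let ?P = "\<lambda>xs. distinct xs \<and> xs \<noteq> [] \<and> set xs \<subseteq> verts C \<and> successively ?A xs"
  obtain v0 where v0: "v0 \<in> verts C" using conn by (auto simp: graph_connected_def)
  have "\<exists>xs. ?P xs \<and> (\<forall>zs. ?P zs \<longrightarrow> length zs \<le> length xs)"
  proof (rule ex_has_greatest_nat)
    show "?P [v0]" using v0 by simp
    show "\<forall>zs. ?P zs \<longrightarrow> length zs < Suc (card (verts C))"
      using fin by (metis card_mono distinct_card less_Suc_eq_le)
  qed
  then obtain xs where xs: "distinct xs" "xs \<noteq> []" "set xs \<subseteq> verts C" "successively ?A xs"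
    and mx: "\<And>zs. ?P zs \<Longrightarrow> length zs \<le> length xs" by blast
  have step: "{xs ! i, xs ! Suc i} \<in> edges C" if "Suc i < length xs" for i
    using successively_nth[OF xs(4) that] .
  define k where "k = length xs - 1"
  have kl: "length xs = Suc k" using xs by (simp add: k_def)
  have nth: "xs ! a = xs ! b \<longleftrightarrow> a = b" if "a \<le> k" "b \<le> k" for a b using xs(1) that kl by (simp add: nth_eq_iff_index_eq)
  have zk: "last xs = xs ! k" using xs by (simp add: last_conv_nth k_def)
  have inV: "xs ! i \<in> verts C" if "i \<le> k" for i using xs(3) that kl by (simp add: subset_iff)
  have Nk: "?N (xs ! k) \<subseteq> set xs"
  proof
    fix w assume "w \<in> ?N (xs ! k)"
    then have w: "{xs ! k, w} \<in> edges C" by simp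
    show "w \<in> set xs"
    proof (rule ccontr)
      assume n: "w \<notin> set xs"
      have "?P (xs @ [w])" using xs n w zk edge_verts[OF sg w] by (simp add: successively_append_iff)
      from mx[OF this] show False by simp
    qed
  qed
  have Nidx: "\<exists>i<k. u = xs ! i" if "u \<in> ?N (xs ! k)" for u
  proof -
    have "u \<in> set xs" using Nk that by blast
    then obtain i where i: "i \<le> k" "u = xs ! i" using kl by (metis in_set_conv_nth less_Suc_eq_le)
    moreover have "u \<noteq> xs ! k" using that edge_neq[OF sg] by force
    ultimately show ?thesis by (metis order_le_less)
  qed
  obtain a b where ab: "?N (xs ! k) = {a, b}" "a \<noteq> b" using N2[OF inV[of k]] by (auto simp: card_2_iff)
  obtain i j where ij: "i < k" "a = xs ! i" "j < k" "b = xs ! j" using Nidx[of a] Nidx[of b] ab by blast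
  have k2: "2 \<le> k" using ij ab by (cases "k = 1") auto
  have prev: "{xs ! k, xs ! (k - 1)} \<in> edges C" using step[of "k - 1"] kl k2 by (simp add: insert_commute)
  then have "xs ! (k - 1) \<in> {a, b}" using ab by blast
  then have "\<exists>j. j < k - 1 \<and> {xs ! k, xs ! j} \<in> edges C"
  proof
    assume "xs ! (k - 1) = a"
    then have "j \<noteq> k - 1" using ab ij by auto
    then show ?thesis using ij ab by (intro exI[of _ j]) auto
  next
    assume "xs ! (k - 1) \<in> {b}"
    then have "i \<noteq> k - 1" using ab ij by auto
    then show ?thesis using ij ab by (intro exI[of _ i]) auto
  qed
  then obtain j where j: "j < k - 1" "{xs ! k, xs ! j} \<in> edges C" by blast
  have j0: "j = 0"
  proof (rule ccontr)
    assume "j \<noteq> 0"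
    have "{xs ! (j - 1), xs ! (j + 1), xs ! k} \<subseteq> ?N (xs ! j)"
      using step[of "j - 1"] step[of j] j \<open>j \<noteq> 0\<close> kl by (auto simp: insert_commute)
    moreover have N: "card (?N (xs ! j)) = 2" using N2[OF inV[of j]] j by simp
    moreover have "finite (?N (xs ! j))" using N by (intro card_ge_0_finite) simp
    ultimately have "card {xs ! (j - 1), xs ! (j + 1), xs ! k} \<le> 2" by (metis card_mono)
    moreover have "xs ! (j - 1) \<noteq> xs ! (j + 1)" "xs ! (j - 1) \<noteq> xs ! k" "xs ! (j + 1) \<noteq> xs ! k"
      using nth[of "j - 1" "j + 1"] nth[of "j - 1" k] nth[of "j + 1" k] j \<open>j \<noteq> 0\<close> by auto
    then have "card {xs ! (j - 1), xs ! (j + 1), xs ! k} = 3" by simp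
    ultimately show False by simp
  qed
  have m: "3 \<le> length xs" using k2 kl by simp
  have cyc: "{xs ! i, xs ! (Suc i mod length xs)} \<in> edges C" if "i < length xs" for i
    using step[of i] j j0 kl that by (cases "i = k") auto
  have csub: "cyc_edges xs \<subseteq> edges C" using cyc by (auto simp: cyc_edges_def)
  have Nin: "u \<in> set xs \<and> {v, u} \<in> cyc_edges xs" if "v \<in> set xs" "{v, u} \<in> edges C" for v u
  proof -
    obtain i where i: "i < length xs" "v = xs ! i" using \<open>v \<in> set xs\<close> by (auto simp: in_set_conv_nth)
    define p where "p = (if i = 0 then k else i - 1)"
    have p: "p < length xs" "Suc p mod length xs = i" "p \<noteq> Suc i mod length xs"
      using i kl k2 by (auto simp: p_def mod_Suc)
    have s: "Suc i mod length xs < length xs" using kl by (auto intro!: mod_less_divisor)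
    have e1: "{v, xs ! (Suc i mod length xs)} \<in> cyc_edges xs" using i by (auto simp: cyc_edges_def)
    have e2: "{v, xs ! p} \<in> cyc_edges xs"
    proof -
      have "{xs ! p, xs ! (Suc p mod length xs)} \<in> cyc_edges xs" using p by (auto simp: cyc_edges_def)
      then show ?thesis using p i by (simp add: insert_commute)
    qed
    have "{xs ! (Suc i mod length xs), xs ! p} \<subseteq> ?N v" using e1 e2 csub by auto
    moreover have "card (?N v) = 2" using N2 xs(3) that(1) by blast
    moreover have "card {xs ! (Suc i mod length xs), xs ! p} = 2" using xs(1) p s by (simp add: nth_eq_iff_index_eq card_insert_if)
    moreover have "finite (?N v)" using \<open>card (?N v) = 2\<close> by (intro card_ge_0_finite) simp
    ultimately have "?N v = {xs ! (Suc i mod length xs), xs ! p}" by (metis card_subset_eq)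
    then have "u = xs ! (Suc i mod length xs) \<or> u = xs ! p" using that(2) by auto
    then show ?thesis using e1 e2 p s by auto
  qed
  have reach: "v \<in> set xs" if "(u, v) \<in> (adjacency C)\<^sup>*" "u \<in> set xs" for u v
    using that by (induction rule: rtrancl_induct) (auto simp: adjacency_def dest: Nin)
  have "set xs = verts C"
  proof
    show "verts C \<subseteq> set xs"
    proof
      fix v assume "v \<in> verts C"
      then have "(xs ! 0, v) \<in> (adjacency C)\<^sup>*" using conn inV[of 0] by (simp add: graph_connected_def)
      then show "v \<in> set xs" using reach kl by simp
    qed
  qed (fact xs)
  moreover have "edges C \<subseteq> cyc_edges xs"
  proof
    fix e assume e: "e \<in> edges C"
    then have "card e = 2" using sg by (auto simp: simple_graph_def)
    then obtain u v where uv: "e = {u, v}" by (auto simp: card_2_iff)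
    then have "u \<in> set xs" using edge_verts[OF sg, of u v] e \<open>set xs = verts C\<close> by simp
    then show "e \<in> cyc_edges xs" using Nin e uv by blast
  qed
  ultimately show ?thesis using that[OF xs(1) m] csub by blast
qed

text \<open>If the new endpoint is already on the path, the path is cut off there, so no repetition
  arises.\<close>

lemma rtrancl_list:
  assumes "(u, v) \<in> R\<^sup>*"
  shows "\<exists>ps. ps \<noteq> [] \<and> distinct ps \<and> hd ps = u \<and> last ps = v \<and> successively (\<lambda>x y. (x, y) \<in> R) ps \<and> set ps \<subseteq> R\<^sup>* `` {u}"
  using assms
proof (induction rule: rtrancl_induct)
  case base
  show ?case by (intro exI[of _ "[u]"]) auto
next
  case (step y z)
  then obtain ps where ps: "ps \<noteq> []" "distinct ps" "hd ps = u" "last ps = y" "successively (\<lambda>x y. (x, y) \<in> R) ps"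
    "set ps \<subseteq> R\<^sup>* `` {u}" by blast
  show ?case
  proof (cases "z \<in> set ps")
    case False
    have "(u, z) \<in> R\<^sup>*" using step by auto
    then show ?thesis using ps step False by (intro exI[of _ "ps @ [z]"]) (auto simp: successively_append_iff)
  next
    case True
    then obtain as bs where "ps = as @ z # bs" by (auto simp: in_set_conv_decomp)
    then show ?thesis using ps by (intro exI[of _ "as @ [z]"]) (auto simp: successively_append_iff hd_append split: if_splits)
  qed
qed

section \<open>Bridges of a longest chordless circuit\<close>

locale chordless_cycle =
  fixes G :: "'a ugraph" and ys :: "'a list"
  assumes simple: "simple_graph G" and three: "three_connected G"
    and dist: "distinct ys" and len: "3 \<le> length ys" and cyc: "cyc_edges ys \<subseteq> edges G"
    and longest: "\<lbrakk>distinct zs; 3 \<le> length zs; cyc_edges zs \<subseteq> edges G\<rbrakk> \<Longrightarrow> length zs \<le> length ys"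
    and chordless: "\<lbrakk>e \<in> edges G; e \<subseteq> set ys\<rbrakk> \<Longrightarrow> e \<in> cyc_edges ys"
begin

abbreviation "n \<equiv> length ys"

definition component :: "'a \<Rightarrow> 'a set" where
  "component v = (adjacency (delete_verts G (set ys)))\<^sup>* `` {v}"
definition bridges :: "'a set set" where "bridges = component ` (verts G - set ys)"
definition feet :: "'a set \<Rightarrow> nat set" where "feet B = {i. i < n \<and> (\<exists>u\<in>B. {ys ! i, u} \<in> edges G)}"

lemma adj_H: "(x, y) \<in> adjacency (delete_verts G (set ys)) \<longleftrightarrow> {x, y} \<in> edges G \<and> x \<notin> set ys \<and> y \<notin> set ys"
  by (auto simp: adjacency_def delete_verts_def)

lemma sym_H: "sym ((adjacency (delete_verts G (set ys)))\<^sup>*)"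
  by (intro sym_rtrancl) (auto simp: sym_def adj_H insert_commute)

lemma component_self: "v \<in> component v" by (simp add: component_def)

lemma component_eq: "u \<in> component v \<Longrightarrow> component u = component v"
  unfolding component_def by (auto intro: rtrancl_trans dest: symD[OF sym_H])

lemma bridge_component: "\<lbrakk>B \<in> bridges; u \<in> B\<rbrakk> \<Longrightarrow> B = component u"
  using component_eq by (auto simp: bridges_def)

lemma bridges_disjoint: "\<lbrakk>A \<in> bridges; B \<in> bridges; u \<in> A; u \<in> B\<rbrakk> \<Longrightarrow> A = B"
  using bridge_component by blast

lemma bridge_subset: assumes "B \<in> bridges" shows "B \<subseteq> verts G - set ys"
proof
  fix u assume u: "u \<in> B"
  obtain v where v: "B = component v" "v \<in> verts G - set ys" using assms by (auto simp: bridges_def)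
  have "(v, u) \<in> (adjacency (delete_verts G (set ys)))\<^sup>*" using u v by (simp add: component_def)
  then show "u \<in> verts G - set ys"
    using v(2) by (induction rule: rtrancl_induct) (auto simp: adj_H dest: edge_verts[OF simple])
qed

lemma bridge_closed: "\<lbrakk>B \<in> bridges; u \<in> B; {u, w} \<in> edges G; w \<notin> set ys\<rbrakk> \<Longrightarrow> w \<in> B"
proof -
  assume h: "B \<in> bridges" "u \<in> B" "{u, w} \<in> edges G" "w \<notin> set ys"
  have "u \<notin> set ys" using bridge_subset[OF h(1)] h(2) by blast
  then have "(u, w) \<in> adjacency (delete_verts G (set ys))" using h by (simp add: adj_H)
  then show "w \<in> B" using bridge_component[OF h(1,2)] by (auto simp: component_def)
qed

lemma verts_ys: "set ys \<subseteq> verts G"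
  using circuit_of_list[OF simple dist len cyc] by (auto simp: circuit_def subgraph_def)

lemma finite_V: "finite (verts G)" using simple by (simp add: simple_graph_def)

lemma bridge_list:
  assumes "B \<in> bridges" "u \<in> B" "v \<in> B"
  shows "\<exists>ps. ps \<noteq> [] \<and> distinct ps \<and> hd ps = u \<and> last ps = v \<and> successively (\<lambda>x y. {x, y} \<in> edges G) ps \<and> set ps \<subseteq> B"
proof -
  have "(u, v) \<in> (adjacency (delete_verts G (set ys)))\<^sup>*" using assms bridge_component[of B u] by (simp add: component_def)
  from rtrancl_list[OF this] obtain ps where ps: "ps \<noteq> []" "distinct ps" "hd ps = u" "last ps = v"
    "successively (\<lambda>x y. (x, y) \<in> adjacency (delete_verts G (set ys))) ps" "set ps \<subseteq> component u"
    by (auto simp: component_def)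
  moreover have "successively (\<lambda>x y. {x, y} \<in> edges G) ps"
    by (rule successively_mono[OF ps(5)]) (simp add: adj_H)
  ultimately show ?thesis using bridge_component[of B u] assms by blast
qed

text \<open>Otherwise deleting the feet, at most two vertices, would separate the bridge from some
  remaining vertex of the circuit, which has at least three.\<close>

lemma three_feet: assumes B: "B \<in> bridges" shows "3 \<le> card (feet B)"
proof (rule ccontr)
  assume "\<not> 3 \<le> card (feet B)"
  then have c: "card (feet B) \<le> 2" by simp
  let ?S = "(\<lambda>i. ys ! i) ` feet B"
  have f: "finite (feet B)" by (simp add: feet_def)
  have cS: "card ?S \<le> 2" using card_image_le[OF f, of "\<lambda>i. ys ! i"] c by simp
  have Sys: "?S \<subseteq> set ys" by (auto simp: feet_def)
  have conn: "graph_connected (delete_verts G ?S)" using three cS Sys verts_ys by (auto simp: three_connected_def)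
  obtain u where u: "u \<in> B" using B component_self by (auto simp: bridges_def)
  have "card (set ys) = n" using dist by (simp add: distinct_card)
  then have "\<not> set ys \<subseteq> ?S" using cS len f card_mono[of ?S "set ys"] by auto
  then obtain w where w: "w \<in> set ys" "w \<notin> ?S" by blast
  have uG: "u \<in> verts G - set ys" using bridge_subset[OF B] u by blast
  then have "u \<in> verts (delete_verts G ?S)" using Sys by (auto simp: delete_verts_def)
  moreover have "w \<in> verts (delete_verts G ?S)" using w verts_ys by (auto simp: delete_verts_def)
  ultimately have "(u, w) \<in> (adjacency (delete_verts G ?S))\<^sup>*"
    using conn unfolding graph_connected_def by blast
  then have "w \<in> B"
  proof (induction rule: rtrancl_induct)
    case (step x y)
    then have e: "{x, y} \<in> edges G" "y \<notin> ?S" by (auto simp: adjacency_def delete_verts_def)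
    have "y \<notin> set ys"
    proof
      assume "y \<in> set ys"
      then obtain i where i: "i < n" "y = ys ! i" by (auto simp: in_set_conv_nth)
      then have "i \<in> feet B" using e step by (auto simp: feet_def insert_commute)
      then show False using e i by blast
    qed
    then show ?case using bridge_closed[OF B step.IH e(1)] by blast
  qed (fact u)
  then show False using bridge_subset[OF B] w by blast
qed

text \<open>Otherwise deleting the neighbours would isolate \<open>v\<close> while a further vertex
  is left.\<close>

lemma degree_three:
  assumes v: "v \<in> verts G" shows "3 \<le> card {u. {v, u} \<in> edges G}"
proof (rule ccontr)
  let ?N = "{u. {v, u} \<in> edges G}"
  assume "\<not> 3 \<le> card ?N"
  then have c: "card ?N \<le> 2" by simp
  have N: "?N \<subseteq> verts G" using edge_verts[OF simple] by blast
  have conn: "graph_connected (delete_verts G ?N)" using three c N by (auto simp: three_connected_def)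
  have vN: "v \<notin> ?N" using edge_neq[OF simple, of v v] by auto
  have "card (insert v ?N) \<le> 3" using c finite_subset[OF N finite_V] vN by simp
  moreover have "4 \<le> card (verts G)" using three by (simp add: three_connected_def)
  ultimately have "\<not> verts G \<subseteq> insert v ?N" using card_mono[of "insert v ?N" "verts G"] finite_subset[OF N finite_V] by auto
  then obtain w where w: "w \<in> verts G" "w \<noteq> v" "w \<notin> ?N" by blast
  then have "(v, w) \<in> (adjacency (delete_verts G ?N))\<^sup>*" using conn v vN by (auto simp: graph_connected_def delete_verts_def)
  then have "w = v"
    by (induction rule: rtrancl_induct) (auto simp: adjacency_def delete_verts_def)
  then show False using w by simp
qed

text \<open>Of the at least three edges at a position just two belong to the circuit; as there are
  no chords, any other leads into a bridge.\<close>

lemma foot_exists: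
  assumes i: "i < n" obtains B where "B \<in> bridges" "i \<in> feet B"
proof -
  let ?v = "ys ! i"
  let ?N = "{u. {?v, u} \<in> edges G}"
  have v: "?v \<in> set ys" using i by simp
  have circ: "circuit G (set ys, cyc_edges ys)" using circuit_of_list[OF simple dist len cyc] .
  then have "simple_graph (set ys, cyc_edges ys)" by (simp add: circuit_def subgraph_def)
  from degree_neighbours[OF this, of ?v] have "card {u. {?v, u} \<in> cyc_edges ys} = 2"
    using circ v by (simp add: circuit_def)
  then have c2: "card {u. {?v, u} \<in> cyc_edges ys} = 2" "finite {u. {?v, u} \<in> cyc_edges ys}" by (auto intro: card_ge_0_finite)
  have "3 \<le> card ?N" using degree_three v verts_ys by blast
  have "\<not> ?N \<subseteq> {u. {?v, u} \<in> cyc_edges ys}"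
  proof
    assume "?N \<subseteq> {u. {?v, u} \<in> cyc_edges ys}"
    from card_mono[OF c2(2) this] show False using c2(1) \<open>3 \<le> card ?N\<close> by linarith
  qed
  then obtain u where u: "{?v, u} \<in> edges G" "{?v, u} \<notin> cyc_edges ys" by blast
  then have "u \<notin> set ys" using chordless v by auto
  then have "component u \<in> bridges" using edge_verts[OF simple u(1)] by (auto simp: bridges_def)
  moreover have "i \<in> feet (component u)" using u i component_self by (auto simp: feet_def)
  ultimately show ?thesis using that by blast
qed

lemma finite_bridges: "finite bridges" using finite_V by (simp add: bridges_def)

end

text \<open>\<open>side\<close> is arbitrary here: topology enters the combinatorial part only
  through this one assumption about alternating feet.\<close>

locale sided_cycle = chordless_cycle +
  fixes side :: "'a set \<Rightarrow> bool"
  assumes crossing: "\<lbrakk>A \<in> bridges; B \<in> bridges; A \<noteq> B; side A = side B; i < j; j < k; k < l;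
     i \<in> feet A; k \<in> feet A; j \<in> feet B; l \<in> feet B\<rbrakk> \<Longrightarrow> False"
begin

definition F :: "bool \<Rightarrow> nat set set" where "F s = feet ` {B \<in> bridges. side B = s}"
text \<open>Bridges on one side with the same feet are merged by \<open>F\<close>; any
  representative will do, since a tour uses each pair \<open>(s, A)\<close> at most once.\<close>

definition br :: "bool \<times> nat set \<Rightarrow> 'a set" where
  "br = (\<lambda>(s, A). SOME B. B \<in> bridges \<and> side B = s \<and> feet B = A)"

lemma br: assumes "A \<in> F s" shows "br (s, A) \<in> bridges" "side (br (s, A)) = s" "feet (br (s, A)) = A"
proof -
  have "\<exists>B. B \<in> bridges \<and> side B = s \<and> feet B = A" using assms by (auto simp: F_def)
  from someI_ex[OF this] show "br (s, A) \<in> bridges" "side (br (s, A)) = s" "feet (br (s, A)) = A" by (auto simp: br_def)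
qed

fun item_verts :: "item \<Rightarrow> 'a set" where
  "item_verts (Inl i) = {ys ! i}"
| "item_verts (Inr t) = br t"

fun valid_item :: "item \<Rightarrow> bool" where
  "valid_item (Inl i) \<longleftrightarrow> i < n"
| "valid_item (Inr (s, A)) \<longleftrightarrow> A \<in> F s"

lemma item_verts_disjoint: assumes "valid_item x" "valid_item y" "x \<noteq> y" shows "item_verts x \<inter> item_verts y = {}"
proof -
  have bb: "br t \<in> bridges" if "valid_item (Inr t)" for t using br(1) that by (cases t) auto
  show ?thesis
  proof (cases x; cases y)
    fix i j assume "x = Inl i" "y = Inl j"
    then show ?thesis using assms dist by (auto simp: nth_eq_iff_index_eq)
  next
    fix i t assume "x = Inl i" "y = Inr t"
    then show ?thesis using assms bridge_subset[OF bb[of t]] by auto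
  next
    fix i t assume "x = Inr t" "y = Inl i"
    then show ?thesis using assms bridge_subset[OF bb[of t]] by auto
  next
    fix t t' assume xy: "x = Inr t" "y = Inr t'"
    obtain s A s' A' where t: "t = (s, A)" "t' = (s', A')" by (cases t; cases t') auto
    have A: "A \<in> F s" "A' \<in> F s'" using assms(1,2) xy t by simp_all
    have ne: "br t \<noteq> br t'"
    proof
      assume "br t = br t'"
      then have "s = s'" "A = A'" using br(2,3)[OF A(1)] br(2,3)[OF A(2)] t by metis+
      then show False using assms(3) xy t by simp
    qed
    have "br t \<in> bridges" "br t' \<in> bridges" using br(1)[OF A(1)] br(1)[OF A(2)] t by simp_all
    then have "br t \<inter> br t' = {}" using bridges_disjoint ne by blast
    then show ?thesis using xy by simp
  qed
qed

lemma item_adj_valid: "item_adj n F x y \<Longrightarrow> valid_item x \<and> valid_item y"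
  by (cases "(n, F, x, y)" rule: item_adj.cases) (auto simp: F_def feet_def)

lemma item_adj_cyc: assumes "item_adj n F (Inl i) (Inl j)" shows "{ys ! i, ys ! j} \<in> edges G"
proof -
  have l: "i < n" "j < n" and "j = Suc i mod n \<or> i = Suc j mod n"
    using assms by (auto simp: mod_Suc)
  then have "{ys ! i, ys ! j} \<in> cyc_edges ys" by (auto simp: cyc_edges_def insert_commute)
  then show ?thesis using cyc by blast
qed

text \<open>Each bridge item is expanded to a nonempty path inside the bridge, so the length does
  not drop. Distinctness is asked of \<open>butlast\<close> because the lemma serves closed tours,
  whose last position repeats the first.\<close>

lemma lift:
  assumes "zs \<noteq> []" "hd zs = Inl i" "last zs = Inl j" "successively (item_adj n F) zs" "distinct (butlast zs)"
    "\<forall>z\<in>set zs. valid_item z"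
  shows "\<exists>vs. vs \<noteq> [] \<and> hd vs = ys ! i \<and> last vs = ys ! j \<and> successively (\<lambda>x y. {x, y} \<in> edges G) vs \<and>
     distinct (butlast vs) \<and> length zs \<le> length vs \<and> set (butlast vs) \<subseteq> (\<Union>z\<in>set (butlast zs). item_verts z)"
  using assms
proof (induction "length zs" arbitrary: zs i rule: less_induct)
  case less
  obtain rs where zs: "zs = Inl i # rs" using less(2,3) by (cases zs) auto
  show ?case
  proof (cases rs)
    case Nil
    then show ?thesis using zs less by (intro exI[of _ "[ys ! i]"]) auto
  next
    case (Cons r rs')
    show ?thesis
    proof (cases r)
      case (Inl k)
      have "\<exists>vs. vs \<noteq> [] \<and> hd vs = ys ! k \<and> last vs = ys ! j \<and> successively (\<lambda>x y. {x, y} \<in> edges G) vs \<and>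
         distinct (butlast vs) \<and> length rs \<le> length vs \<and> set (butlast vs) \<subseteq> (\<Union>z\<in>set (butlast rs). item_verts z)"
        using less zs Cons Inl by (intro less(1)) (auto simp: successively_Cons split: if_splits)
      then obtain vs where vs: "vs \<noteq> []" "hd vs = ys ! k" "last vs = ys ! j" "successively (\<lambda>x y. {x, y} \<in> edges G) vs"
         "distinct (butlast vs)" "length rs \<le> length vs" "set (butlast vs) \<subseteq> (\<Union>z\<in>set (butlast rs). item_verts z)" by blast
      have "{ys ! i, ys ! k} \<in> edges G" using less zs Cons Inl item_adj_cyc by (auto simp: successively_Cons)
      moreover have "ys ! i \<notin> set (butlast vs)"
      proof
        assume "ys ! i \<in> set (butlast vs)"
        then obtain z where z: "z \<in> set (butlast rs)" "ys ! i \<in> item_verts z" using vs(7) by blast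
        then have "z \<noteq> Inl i" using less(6) zs Cons by auto
        moreover have "valid_item z" "valid_item (Inl i)" using z less(7) zs by (auto dest: in_set_butlastD)
        ultimately show False using item_verts_disjoint[of z "Inl i"] z by auto
      qed
      moreover have "set (butlast (ys ! i # vs)) \<subseteq> (\<Union>z\<in>set (butlast zs). item_verts z)"
      proof -
        have "butlast zs = Inl i # butlast rs" "butlast (ys ! i # vs) = ys ! i # butlast vs" using zs Cons vs(1) by simp_all
        then show ?thesis using vs(7) by auto
      qed
      ultimately show ?thesis using vs(1-6) zs
        by (intro exI[of _ "ys ! i # vs"]) (auto simp: successively_Cons)
    next
      \<comment> \<open>A bridge is always followed by a position, so two items are consumed at
        once.\<close>
      case (Inr t)
      obtain s A where t: "t = (s, A)" by (cases t)
      have "rs' \<noteq> []" using less(4) zs Cons Inr by auto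
      then obtain q rs2 where rs': "rs' = q # rs2" by (cases rs') auto
      have aq: "item_adj n F (Inr t) q" and ai: "item_adj n F (Inl i) (Inr t)" using less(5) zs Cons Inr rs' by (auto simp: successively_Cons)
      then obtain k where q: "q = Inl k" using t by (cases q) auto
      have A: "A \<in> F s" "i \<in> A" "k \<in> A" using aq ai q t by auto
      note b = br[OF A(1)]
      obtain u v where u: "u \<in> br t" "{ys ! i, u} \<in> edges G" and v: "v \<in> br t" "{ys ! k, v} \<in> edges G"
      proof -
        have "i \<in> feet (br t)" "k \<in> feet (br t)" using A b t by simp_all
        then show ?thesis using that unfolding feet_def by blast
      qed
      obtain ps where ps: "ps \<noteq> []" "distinct ps" "hd ps = u" "last ps = v" "successively (\<lambda>x y. {x, y} \<in> edges G) ps" "set ps \<subseteq> br t"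
        using bridge_list[of "br t" u v] b t u v by blast
      have "\<exists>vs. vs \<noteq> [] \<and> hd vs = ys ! k \<and> last vs = ys ! j \<and> successively (\<lambda>x y. {x, y} \<in> edges G) vs \<and>
         distinct (butlast vs) \<and> length rs' \<le> length vs \<and> set (butlast vs) \<subseteq> (\<Union>z\<in>set (butlast rs'). item_verts z)"
        using less zs Cons Inr q rs' by (intro less(1)) (auto simp: successively_Cons split: if_splits)
      then obtain vs where vs: "vs \<noteq> []" "hd vs = ys ! k" "last vs = ys ! j" "successively (\<lambda>x y. {x, y} \<in> edges G) vs"
         "distinct (butlast vs)" "length rs' \<le> length vs" "set (butlast vs) \<subseteq> (\<Union>z\<in>set (butlast rs'). item_verts z)" by blast
      have nin: "item_verts x \<inter> set (butlast vs) = {}" if "x = Inl i \<or> x = Inr t" for x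
      proof (rule ccontr)
        assume "\<not> ?thesis"
        then obtain z w where z: "z \<in> set (butlast rs')" "w \<in> item_verts z" "w \<in> item_verts x" using vs(7) by blast
        then have "z \<noteq> x" using less(6) zs Cons rs' Inr that by auto
        moreover have "valid_item z" "valid_item x" using z less(7) zs Cons Inr that by (auto dest: in_set_butlastD)
        ultimately show False using item_verts_disjoint[of z x] z by auto
      qed
      have "ys ! i \<notin> br t" using item_verts_disjoint[of "Inl i" "Inr t"] less(7) zs Cons Inr by auto
      moreover have "{last ps, hd vs} \<in> edges G" using ps v vs by (simp add: insert_commute)
      moreover have "{ys ! i, hd ps} \<in> edges G" using ps u by simp
      moreover have "1 \<le> length ps" using ps by (cases ps) auto
      moreover have bl: "butlast (ys ! i # ps @ vs) = ys ! i # ps @ butlast vs" using vs(1) by (simp add: butlast_append)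
      moreover have "set (butlast (ys ! i # ps @ vs)) \<subseteq> (\<Union>z\<in>set (butlast zs). item_verts z)"
      proof -
        have "butlast zs = Inl i # Inr t # butlast rs'" using zs Cons Inr rs' by simp
        then show ?thesis unfolding bl using vs(7) ps(6) by auto
      qed
      moreover have "distinct (ys ! i # ps @ butlast vs)"
      proof -
        have "set ps \<inter> set (butlast vs) = {}" "ys ! i \<notin> set (butlast vs)" using nin[of "Inl i"] nin[of "Inr t"] ps(6) by auto
        then show ?thesis using ps(2,6) vs(5) \<open>ys ! i \<notin> br t\<close> by auto
      qed
      moreover have "successively (\<lambda>x y. {x, y} \<in> edges G) (ys ! i # ps @ vs)"
        using \<open>{last ps, hd vs} \<in> edges G\<close> \<open>{ys ! i, hd ps} \<in> edges G\<close> ps(1,5) vs(1,4)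
        by (simp add: successively_Cons successively_append_iff hd_append)
      moreover have "length zs \<le> length (ys ! i # ps @ vs)" using \<open>1 \<le> length ps\<close> vs(6) zs Cons by simp
      ultimately show ?thesis using vs(1,3) by (intro exI[of _ "ys ! i # ps @ vs"]) simp
    qed
  qed
qed

lemma no_long_cycle:
  assumes zs: "zs = Inl i # zs'" and s: "successively (item_adj n F) zs" and l: "item_adj n F (last zs) (Inl i)"
    and d: "distinct zs" and m: "3 \<le> length zs"
  shows "length zs \<le> n"
proof -
  let ?zs = "zs @ [Inl i]"
  have "\<forall>z\<in>set ?zs. valid_item z"
  proof
    fix z assume "z \<in> set ?zs"
    then have "z \<in> set zs" using zs by auto
    then obtain k where k: "k < length zs" "z = zs ! k" by (auto simp: in_set_conv_nth)
    show "valid_item z"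
    proof (cases "Suc k < length zs")
      case True
      then show ?thesis using successively_nth[OF s True] k item_adj_valid by blast
    next
      case False
      then have "z = last zs" using k zs by (metis Suc_lessI last_conv_nth length_0_conv list.distinct(1) diff_Suc_1)
      then show ?thesis using l item_adj_valid by blast
    qed
  qed
  then have "\<exists>vs. vs \<noteq> [] \<and> hd vs = ys ! i \<and> last vs = ys ! i \<and> successively (\<lambda>x y. {x, y} \<in> edges G) vs \<and>
     distinct (butlast vs) \<and> length ?zs \<le> length vs \<and> set (butlast vs) \<subseteq> (\<Union>z\<in>set (butlast ?zs). item_verts z)"
  proof (intro lift)
    show "successively (item_adj n F) ?zs" unfolding successively_append_iff using s l by simp
    show "distinct (butlast ?zs)" using d by (simp add: butlast_append)
  qed (use zs in auto)
  then obtain vs where vs: "vs \<noteq> []" "hd vs = ys ! i" "last vs = ys ! i" "successively (\<lambda>x y. {x, y} \<in> edges G) vs"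
     "distinct (butlast vs)" "length ?zs \<le> length vs" by blast
  define ws where "ws = butlast vs"
  have vw: "vs = ws @ [ys ! i]" using vs(1,3) by (metis append_butlast_last_id ws_def)
  have wl: "length zs \<le> length ws" using vs(6) vw by simp
  then have w0: "ws \<noteq> []" "3 \<le> length ws" using m by auto
  have "hd ws = ys ! i" using vs(2) vw w0 by (simp add: hd_append)
  then have h: "ws ! 0 = ys ! i" using w0 by (simp add: hd_conv_nth)
  have "cyc_edges ws \<subseteq> edges G"
  proof
    fix e assume "e \<in> cyc_edges ws"
    then obtain k where k: "k < length ws" "e = {ws ! k, ws ! (Suc k mod length ws)}" by (auto simp: cyc_edges_def)
    have "{vs ! k, vs ! Suc k} \<in> edges G" using successively_nth[OF vs(4), of k] k vw by simp
    moreover have "vs ! k = ws ! k" using vw k by (simp add: nth_append)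
    moreover have "vs ! Suc k = ws ! (Suc k mod length ws)"
      using vw k h by (cases "Suc k = length ws") (auto simp: nth_append)
    ultimately show "e \<in> edges G" using k by simp
  qed
  then have "length ws \<le> n" using longest[of ws] vs(5) w0 ws_def by blast
  then show ?thesis using wl by simp
qed

lemma no_sided_cycle: False
proof -
  interpret ring_items n F
  proof
    fix s B A a b x y v xs i zs
    show "finite (F s)" using finite_bridges by (simp add: F_def)
    show "B \<in> F s \<Longrightarrow> B \<subseteq> {..<n}" by (auto simp: F_def feet_def)
    show "B \<in> F s \<Longrightarrow> 3 \<le> card B" using three_feet by (auto simp: F_def)
    show "3 \<le> n" by (rule len)
    show "\<exists>s. \<exists>B\<in>F s. v \<in> B" if v: "v < n"
    proof -
      obtain B where "B \<in> bridges" "v \<in> feet B" using foot_exists[OF v] by blast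
      then have "feet B \<in> F (side B)" "v \<in> feet B" by (auto simp: F_def)
      then show ?thesis by blast
    qed
    show "\<lbrakk>xs = Inl i # zs; successively (item_adj n F) xs; item_adj n F (last xs) (Inl i); distinct xs; 3 \<le> length xs\<rbrakk>
       \<Longrightarrow> length xs \<le> n" by (rule no_long_cycle)
    assume h: "A \<in> F s" "B \<in> F s" "A \<noteq> B" "a \<in> A" "b \<in> A" "x \<in> B" "y \<in> B" "a < x" "x < b"
    obtain P Q where PQ: "P \<in> bridges" "side P = s" "feet P = A" "Q \<in> bridges" "side Q = s" "feet Q = B" using h(1,2) by (auto simp: F_def)
    have ne: "P \<noteq> Q" using PQ h(3) by auto
    show "a \<le> y \<and> y \<le> b"
    proof (rule ccontr)
      assume "\<not> (a \<le> y \<and> y \<le> b)"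
      then consider "y < a" | "b < y" by linarith
      then show False
      proof cases
        case 1
        then show False using crossing[of Q P y a x b] PQ ne h by simp
      next
        case 2
        then show False using crossing[of P Q a x b y] PQ ne h by simp
      qed
    qed
  qed
  show False by (rule no_ring_items)
qed

end

section \<open>Crossing arcs in the plane\<close>

lemma loop_of_arcs:
  assumes "arc c1" "arc c2" "pathstart c1 = a" "pathfinish c1 = b" "pathstart c2 = a" "pathfinish c2 = b"
    "path_image c1 \<inter> path_image c2 = {a, b}"
  shows "simple_path (c1 +++ reversepath c2)" "pathfinish (c1 +++ reversepath c2) = pathstart (c1 +++ reversepath c2)"
    "path_image (c1 +++ reversepath c2) = path_image c1 \<union> path_image c2"
  using assms by (auto simp: simple_path_join_loop_eq arc_reversepath path_image_join)

lemma connected_in_side: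
  fixes g :: "real \<Rightarrow> complex"
  assumes "simple_path g" "pathfinish g = pathstart g" "connected K" "K \<inter> path_image g = {}"
  shows "K \<inter> inside (path_image g) \<noteq> {} \<Longrightarrow> K \<subseteq> inside (path_image g)"
    and "K \<inter> outside (path_image g) \<noteq> {} \<Longrightarrow> K \<subseteq> outside (path_image g)"
proof -
  note J = Jordan_inside_outside[OF assms(1,2)]
  have sub: "K \<subseteq> inside (path_image g) \<union> outside (path_image g)" using assms(4) unfolding inside_Un_outside by blast
  have "K \<inter> inside (path_image g) = {} \<or> K \<inter> outside (path_image g) = {}"
    using connectedD[OF assms(3), of "inside (path_image g)" "outside (path_image g)"] J sub by blast
  then show "K \<inter> inside (path_image g) \<noteq> {} \<Longrightarrow> K \<subseteq> inside (path_image g)"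
    "K \<inter> outside (path_image g) \<noteq> {} \<Longrightarrow> K \<subseteq> outside (path_image g)" using sub by blast+
qed

text \<open>The arc \<open>c\<close> cuts the inside into two regions, bounded by \<open>c1\<close>
  with \<open>c\<close> and by \<open>c2\<close> with \<open>c\<close>. Without its ends
  \<open>d\<close> is connected and avoids \<open>c\<close>, so it stays in one region; but one of
  its ends lies outside the curve that bounds this region.\<close>

lemma no_crossing_inside:
  fixes c :: "real \<Rightarrow> complex"
  assumes arcs: "arc c1" "arc c2" "arc c" "arc d"
    and c1: "pathstart c1 = a" "pathfinish c1 = b" and c2: "pathstart c2 = a" "pathfinish c2 = b"
    and c: "pathstart c = a" "pathfinish c = b" and d: "pathstart d = x" "pathfinish d = y"
    and ab: "a \<noteq> b" and c12: "path_image c1 \<inter> path_image c2 = {a, b}"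
    and cJ: "path_image c \<inter> (path_image c1 \<union> path_image c2) = {a, b}"
    and dJ: "path_image d \<inter> (path_image c1 \<union> path_image c2) = {x, y}"
    and cd: "path_image c \<inter> path_image d = {}"
    and x: "x \<in> path_image c1" "x \<noteq> a" "x \<noteq> b" and y: "y \<in> path_image c2" "y \<noteq> a" "y \<noteq> b"
    and ci: "path_image c \<inter> inside (path_image c1 \<union> path_image c2) \<noteq> {}"
    and di: "path_image d \<inter> inside (path_image c1 \<union> path_image c2) \<noteq> {}"
  shows False
proof -
  let ?J = "path_image c1 \<union> path_image c2"
  note sp = arcs[THEN arc_imp_simple_path]
  have c1c: "path_image c1 \<inter> path_image c = {a, b}" and c2c: "path_image c2 \<inter> path_image c = {a, b}"
  proof -
    have "{a, b} \<subseteq> path_image c1" "{a, b} \<subseteq> path_image c2" using c12 by blast+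
    then show "path_image c1 \<inter> path_image c = {a, b}" "path_image c2 \<inter> path_image c = {a, b}" using cJ by blast+
  qed
  have split: "inside (path_image c1 \<union> path_image c) \<inter> inside (path_image c2 \<union> path_image c) = {}"
    "inside (path_image c1 \<union> path_image c) \<union> inside (path_image c2 \<union> path_image c) \<union> (path_image c - {a, b}) = inside ?J"
    using split_inside_simple_closed_curve[OF sp(1) c1 sp(2) c2 sp(3) c ab c12 c1c c2c ci] by blast+
  let ?U1 = "inside (path_image c1 \<union> path_image c)" and ?U2 = "inside (path_image c2 \<union> path_image c)"
  let ?V1 = "outside (path_image c1 \<union> path_image c)" and ?V2 = "outside (path_image c2 \<union> path_image c)"
  note l1 = loop_of_arcs[OF arcs(1,3) c1 c c1c] and l2 = loop_of_arcs[OF arcs(2,3) c2 c c2c] and l = loop_of_arcs[OF arcs(1,2) c1 c2 c12]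
  note J1 = Jordan_inside_outside[OF l1(1,2), unfolded l1(3)] and J2 = Jordan_inside_outside[OF l2(1,2), unfolded l2(3)]
  have cont: "continuous_on {0..1} d" using arcs(4) by (auto simp: arc_def path_def)
  let ?K = "path_image d - {x, y}"
  have K: "connected ?K" using connected_simple_path_endless[OF sp(4)] d by simp
  have xyJ: "{x, y} \<inter> inside ?J = {}" using x y inside_no_overlap[of ?J] by blast
  have "?K \<inter> inside ?J \<noteq> {}" using di xyJ by blast
  then have KJ: "?K \<subseteq> inside ?J"
    using connected_in_side(1)[OF l(1,2) K] dJ unfolding l(3) by blast
  have KU: "?K \<subseteq> ?U1 \<union> ?U2" using KJ split(2) cd by blast
  have op: "open ?U1" "open ?U2" "open ?V1" "open ?V2" using J1 J2 by simp_all
  have dis: "?U1 \<inter> ?V1 = {}" "?U2 \<inter> ?V2 = {}" using J1 J2 by simp_all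
  have "?U1 \<inter> ?U2 \<inter> ?K = {}" using split(1) by blast
  from connectedD[OF K op(1,2) this KU] have KK: "?K \<inter> ?U1 = {} \<or> ?K \<inter> ?U2 = {}" by blast
  \<comment> \<open>The interior of \<open>d\<close> together with just one end is still connected;
    this is what links the chosen region to an end beyond its boundary.\<close>
  have conn: "connected (d ` {0<..1})" "connected (d ` {0..<1})"
    by (intro connected_continuous_image continuous_on_subset[OF cont]; auto)+
  have inj: "inj_on d {0..1}" using arcs(4) by (simp add: arc_def)
  have d01: "d 0 = x" "d 1 = y" using d by (auto simp: pathstart_def pathfinish_def)
  have I: "d ` {0<..<1} = ?K"
  proof -
    have "d ` {0<..<1} = d ` ({0..1} - {0, 1})" by (intro arg_cong[of _ _ "image d"]) auto
    also have "\<dots> = d ` {0..1} - d ` {0, 1}" by (rule inj_on_image_set_diff[OF inj]) auto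
    finally show ?thesis using d01 by (simp add: path_image_def)
  qed
  have Iy: "d ` {0<..1} = insert y ?K"
  proof -
    have "{0<..1} = insert 1 {0<..<1::real}" by auto
    then show ?thesis using I d01 by simp
  qed
  have Ix: "d ` {0..<1} = insert x ?K"
  proof -
    have "{0..<1} = insert 0 {0<..<1::real}" by auto
    then show ?thesis using I d01 by simp
  qed
  have Kne: "?K \<noteq> {}" using \<open>?K \<inter> inside ?J \<noteq> {}\<close> by blast
  have xd: "x \<in> path_image d" "y \<in> path_image d" using d pathstart_in_path_image pathfinish_in_path_image by blast+
  show False
  proof (cases "?K \<inter> ?U2 = {}")
    case True
    then have K1: "?K \<subseteq> ?U1" using KU by blast
    have "y \<notin> path_image c1" using c12 y by blast
    moreover have "y \<notin> path_image c" using cd xd by blast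
    moreover have "y \<notin> ?U1" using split(2) xyJ by blast
    ultimately have yV: "y \<in> ?V1" using inside_Un_outside[of "path_image c1 \<union> path_image c"] by blast
    have "?U1 \<inter> ?V1 \<inter> insert y ?K = {}" "insert y ?K \<subseteq> ?U1 \<union> ?V1" using dis(1) yV K1 by blast+
    from connectedD[OF conn(1)[unfolded Iy] op(1,3) this] show False using yV Kne K1 by blast
  next
    case False
    then have K1: "?K \<subseteq> ?U2" using KU KK by blast
    have "x \<notin> path_image c2" using c12 x by blast
    moreover have "x \<notin> path_image c" using cd xd by blast
    moreover have "x \<notin> ?U2" using split(2) xyJ by blast
    ultimately have xV: "x \<in> ?V2" using inside_Un_outside[of "path_image c2 \<union> path_image c"] by blast
    have "?U2 \<inter> ?V2 \<inter> insert x ?K = {}" "insert x ?K \<subseteq> ?U2 \<union> ?V2" using dis(2) xV K1 by blast+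
    from connectedD[OF conn(2)[unfolded Ix] op(2,4) this] show False using xV Kne K1 by blast
  qed
qed

text \<open>Reduces arcs outside the curve to arcs inside, as the splitting theorem of the library covers only these.\<close>

lemma inversion_outside:
  fixes g :: "real \<Rightarrow> complex"
  assumes g: "simple_path g" "pathfinish g = pathstart g" and z0: "z0 \<in> inside (path_image g)"
  defines "f \<equiv> \<lambda>z. inverse (z - z0)"
  shows "f ` outside (path_image g) \<subseteq> inside (path_image (f \<circ> g))"
proof -
  let ?J = "path_image g" and ?J' = "path_image (f \<circ> g)"
  note J = Jordan_inside_outside[OF g]
  have z0J: "z0 \<notin> ?J" "z0 \<notin> outside ?J" using z0 J inside_no_overlap[of ?J] by blast+
  have cont: "continuous_on S f" if "z0 \<notin> S" for S using that unfolding f_def by (intro continuous_intros) auto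
  \<comment> \<open>By the convention \<open>inverse 0 = 0\<close>, \<open>f\<close> is injective on
    the whole plane, \<open>z0\<close> included.\<close>
  have inj: "inj f" by (auto simp: inj_def f_def)
  have J': "?J' = f ` ?J" by (simp add: path_image_compose)
  have g': "simple_path (f \<circ> g)"
    using simple_path_continuous_image[OF g(1) cont[OF z0J(1)] inj_on_subset[OF inj]] by simp
  have g'': "pathfinish (f \<circ> g) = pathstart (f \<circ> g)" using g(2) by (simp add: pathfinish_def pathstart_def)
  note JJ = Jordan_inside_outside[OF g' g'']
  have c1: "connected (f ` outside ?J)" using J cont[OF z0J(2)] by (intro connected_continuous_image) auto
  have c2: "connected (f ` (inside ?J - {z0}))"
    using J by (intro connected_continuous_image cont connected_open_delete) auto
  have d1: "f ` outside ?J \<inter> ?J' = {}" unfolding J' image_Int[OF inj, symmetric] by (simp add: outside_no_overlap)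
  have d2: "f ` (inside ?J - {z0}) \<inter> ?J' = {}" unfolding J' image_Int[OF inj, symmetric] using inside_no_overlap[of ?J] by blast
  \<comment> \<open>Near \<open>z0\<close> the values are unbounded, so the image of the punctured
    inside cannot lie in the bounded new inside; being connected, it misses the latter
    altogether.\<close>
  have unb: "\<not> bounded (f ` (inside ?J - {z0}))"
  proof
    assume "bounded (f ` (inside ?J - {z0}))"
    then obtain M where M: "0 < M" "\<And>z. z \<in> inside ?J - {z0} \<Longrightarrow> norm (f z) \<le> M" by (auto simp: bounded_pos)
    have "open (inside ?J)" using J by simp
    then obtain e where e: "0 < e" "ball z0 e \<subseteq> inside ?J" using z0 by (rule openE)
    define \<delta> where "\<delta> = min (e / 2) (inverse (M + 1))"
    have \<delta>: "0 < \<delta>" "\<delta> < e" "\<delta> \<le> inverse (M + 1)" using e M by (auto simp: \<delta>_def)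
    have "z0 + of_real \<delta> \<in> inside ?J - {z0}" using e \<delta> by (auto simp: dist_norm)
    then have "norm (f (z0 + of_real \<delta>)) \<le> M" using M by blast
    moreover have "norm (f (z0 + of_real \<delta>)) = inverse \<delta>" using \<delta> by (simp add: f_def norm_inverse)
    moreover have "M + 1 \<le> inverse \<delta>" using \<delta> M by (metis add_pos_pos inverse_inverse_eq le_imp_inverse_le zero_less_one)
    ultimately show False by simp
  qed
  have "\<not> f ` (inside ?J - {z0}) \<subseteq> inside ?J'" using unb JJ bounded_subset by blast
  then have "f ` (inside ?J - {z0}) \<inter> inside ?J' = {}" using connected_in_side(1)[OF g' g'' c2 d2] by blast
  \<comment> \<open>The value 0 has to be avoided because \<open>f\<close> takes it at
    \<open>z0\<close> only. The preimage of any other point of the new inside is neither on the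
    curve nor inside it, hence outside.\<close>
  moreover obtain w where w: "w \<in> inside ?J'" "w \<noteq> 0"
  proof -
    have "\<not> inside ?J' \<subseteq> {0}"
    proof
      assume "inside ?J' \<subseteq> {0}"
      then have "inside ?J' = {0}" using JJ by blast
      then show False using JJ not_open_singleton[of "0 :: complex"] by simp
    qed
    then show ?thesis using that by blast
  qed
  moreover have "w = f (z0 + inverse w)" by (simp add: f_def)
  moreover have "z0 + inverse w \<noteq> z0" using w by simp
  moreover have "w \<notin> ?J'" using w inside_no_overlap by blast
  ultimately have "z0 + inverse w \<in> outside ?J" using J unfolding J'
    by (metis Diff_iff IntI UnE Compl_iff empty_iff imageI singletonD)
  then have "f ` outside ?J \<inter> inside ?J' \<noteq> {}" using w \<open>w = f (z0 + inverse w)\<close> by (metis IntI empty_iff imageI)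
  then show ?thesis using connected_in_side(1)[OF g' g'' c1 d1] by blast
qed

lemma no_crossing_outside:
  fixes c :: "real \<Rightarrow> complex"
  assumes arcs: "arc c1" "arc c2" "arc c" "arc d"
    and c1: "pathstart c1 = a" "pathfinish c1 = b" and c2: "pathstart c2 = a" "pathfinish c2 = b"
    and c: "pathstart c = a" "pathfinish c = b" and d: "pathstart d = x" "pathfinish d = y"
    and ab: "a \<noteq> b" and c12: "path_image c1 \<inter> path_image c2 = {a, b}"
    and cJ: "path_image c \<inter> (path_image c1 \<union> path_image c2) = {a, b}"
    and dJ: "path_image d \<inter> (path_image c1 \<union> path_image c2) = {x, y}"
    and cd: "path_image c \<inter> path_image d = {}"
    and x: "x \<in> path_image c1" "x \<noteq> a" "x \<noteq> b" and y: "y \<in> path_image c2" "y \<noteq> a" "y \<noteq> b"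
    and ci: "path_image c \<inter> outside (path_image c1 \<union> path_image c2) \<noteq> {}"
    and di: "path_image d \<inter> outside (path_image c1 \<union> path_image c2) \<noteq> {}"
  shows False
proof -
  let ?J = "path_image c1 \<union> path_image c2"
  note l = loop_of_arcs[OF arcs(1,2) c1 c2 c12]
  note J = Jordan_inside_outside[OF l(1,2), unfolded l(3)]
  obtain z0 where z0: "z0 \<in> inside ?J" using J by blast
  define f where "f = (\<lambda>z. inverse (z - z0))"
  have inj: "inj f" by (auto simp: inj_def f_def)
  have cont: "continuous_on S f" if "z0 \<notin> S" for S using that unfolding f_def by (intro continuous_intros) auto
  have z0J: "z0 \<notin> ?J" using z0 inside_no_overlap[of ?J] by blast
  have out: "K - {u, v} \<subseteq> outside ?J" if "K \<inter> ?J = {u, v}" "connected (K - {u, v})" "K \<inter> outside ?J \<noteq> {}" "u \<in> ?J" "v \<in> ?J" for K u v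
  proof -
    have "(K - {u, v}) \<inter> outside ?J \<noteq> {}" using that(3,4,5) outside_no_overlap[of ?J] by blast
    then show ?thesis using connected_in_side(2)[OF l(1,2) that(2)] that(1) unfolding l(3) by blast
  qed
  have c_out: "path_image c - {a, b} \<subseteq> outside ?J"
    using out[OF cJ _ ci] connected_simple_path_endless[OF arc_imp_simple_path[OF arcs(3)]] c cJ by auto
  have d_out: "path_image d - {x, y} \<subseteq> outside ?J"
    using out[OF dJ _ di] connected_simple_path_endless[OF arc_imp_simple_path[OF arcs(4)]] d dJ by auto
  have "z0 \<notin> outside ?J" using z0 J by blast
  moreover have "{a, b} \<subseteq> ?J" "{x, y} \<subseteq> ?J" using cJ dJ by blast+
  ultimately have z0c: "z0 \<notin> path_image c" "z0 \<notin> path_image d" using c_out d_out z0J by (metis DiffI subsetD)+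
  have "f ` outside ?J \<subseteq> inside (path_image (f \<circ> (c1 +++ reversepath c2)))"
    using inversion_outside[OF l(1,2)] z0 unfolding l(3) f_def by blast
  then have fo: "f ` outside ?J \<subseteq> inside (f ` path_image c1 \<union> f ` path_image c2)"
    by (simp only: path_image_compose l(3) image_Un)
  have A: "arc (f \<circ> h)" if "arc h" "z0 \<notin> path_image h" for h
    using that(1) path_continuous_image[OF arc_imp_path[OF that(1)] cont[OF that(2)]] inj
    by (auto simp: arc_def intro!: comp_inj_on inj_on_subset[OF inj])
  have im: "f ` S \<inter> f ` T = f ` (S \<inter> T)" for S T using image_Int[OF inj] by blast
  show False
  proof (rule no_crossing_inside[of "f \<circ> c1" "f \<circ> c2" "f \<circ> c" "f \<circ> d" "f a" "f b" "f x" "f y"])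
    show "arc (f \<circ> c1)" "arc (f \<circ> c2)" "arc (f \<circ> c)" "arc (f \<circ> d)" using A arcs z0J z0c by auto
    show "path_image (f \<circ> c) \<inter> inside (path_image (f \<circ> c1) \<union> path_image (f \<circ> c2)) \<noteq> {}"
      using ci fo unfolding path_image_compose by blast
    show "path_image (f \<circ> d) \<inter> inside (path_image (f \<circ> c1) \<union> path_image (f \<circ> c2)) \<noteq> {}"
      using di fo unfolding path_image_compose by blast
    show "path_image (f \<circ> c1) \<inter> path_image (f \<circ> c2) = {f a, f b}"
      unfolding path_image_compose im c12 by simp
    show "path_image (f \<circ> c) \<inter> (path_image (f \<circ> c1) \<union> path_image (f \<circ> c2)) = {f a, f b}"
      unfolding path_image_compose im image_Un[symmetric] cJ by simp
    show "path_image (f \<circ> d) \<inter> (path_image (f \<circ> c1) \<union> path_image (f \<circ> c2)) = {f x, f y}"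
      unfolding path_image_compose im image_Un[symmetric] dJ by simp
    show "path_image (f \<circ> c) \<inter> path_image (f \<circ> d) = {}"
      unfolding path_image_compose im cd by simp
  qed (use c1 c2 c d ab x y inj in \<open>auto simp: pathstart_compose pathfinish_compose path_image_compose inj_eq\<close>)
qed

section \<open>Bridges in a plane embedding\<close>

fun path_edges :: "'a list \<Rightarrow> 'a set set" where
  "path_edges (x # y # xs) = insert {x, y} (path_edges (y # xs))"
| "path_edges _ = {}"

lemma path_edges_nth: "path_edges xs = (\<lambda>i. {xs ! i, xs ! Suc i}) ` {i. Suc i < length xs}"
proof (induction xs rule: path_edges.induct)
  case (1 x y xs)
  have "{i. Suc i < length (x # y # xs)} = insert 0 (Suc ` {i. Suc i < length (y # xs)})"
    by (auto simp: image_iff gr0_conv_Suc intro: Suc_pred[symmetric]) (metis Suc_less_eq not0_implies_Suc)+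
  then show ?case using 1 by (simp add: image_image)
qed auto

lemma Union_path_edges: "2 \<le> length xs \<Longrightarrow> \<Union>(path_edges xs) = set xs"
proof (induction xs rule: path_edges.induct)
  case (1 x y xs)
  then show ?case by (cases xs) auto
qed auto

lemma path_edges_subset: "successively (\<lambda>x y. {x, y} \<in> E) xs \<Longrightarrow> path_edges xs \<subseteq> E"
  by (induction xs rule: path_edges.induct) auto

context
  fixes G :: "'a ugraph" and p :: "'a \<Rightarrow> complex" and \<gamma> :: "'a set \<Rightarrow> real \<Rightarrow> complex"
  assumes simple: "simple_graph G" and emb: "plane_embedding G p \<gamma>"
begin

definition drawing :: "'a set set \<Rightarrow> complex set" where "drawing E = (\<Union>e\<in>E. path_image (\<gamma> e))"

lemma drawing_Un: "drawing (E \<union> E') = drawing E \<union> drawing E'" by (auto simp: drawing_def)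

lemma p_inj: "\<lbrakk>u \<in> verts G; v \<in> verts G; p u = p v\<rbrakk> \<Longrightarrow> u = v"
  using emb by (auto simp: plane_embedding_def inj_on_def)

lemma edge_arc: assumes "e \<in> edges G"
  shows "arc (\<gamma> e)" "{pathstart (\<gamma> e), pathfinish (\<gamma> e)} = p ` e" "path_image (\<gamma> e) \<inter> p ` verts G \<subseteq> p ` e"
  using emb assms unfolding plane_embedding_def by blast+

lemma edge_ends: assumes "e \<in> edges G" shows "p ` e \<subseteq> path_image (\<gamma> e)"
  unfolding edge_arc(2)[OF assms, symmetric] using pathstart_in_path_image pathfinish_in_path_image by fast

lemma drawing_disjoint:
  assumes "E \<subseteq> edges G" "E' \<subseteq> edges G" "E \<inter> E' = {}"
  shows "drawing E \<inter> drawing E' \<subseteq> p ` (\<Union>E \<inter> \<Union>E')"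
proof
  fix z assume "z \<in> drawing E \<inter> drawing E'"
  then obtain e f where ef: "e \<in> E" "f \<in> E'" "z \<in> path_image (\<gamma> e) \<inter> path_image (\<gamma> f)" by (auto simp: drawing_def)
  then have "e \<noteq> f" "e \<in> edges G" "f \<in> edges G" using assms by auto
  then have "z \<in> p ` (e \<inter> f)" using emb ef(3) unfolding plane_embedding_def by blast
  then show "z \<in> p ` (\<Union>E \<inter> \<Union>E')" using ef by blast
qed

lemma ends_drawing: "E \<subseteq> edges G \<Longrightarrow> p ` \<Union>E \<subseteq> drawing E"
  using edge_ends by (fastforce simp: drawing_def)

lemma vertex_drawing: "\<lbrakk>E \<subseteq> edges G; v \<in> verts G; p v \<in> drawing E\<rbrakk> \<Longrightarrow> v \<in> \<Union>E"
proof -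
  assume h: "E \<subseteq> edges G" "v \<in> verts G" "p v \<in> drawing E"
  then obtain e where e: "e \<in> E" "p v \<in> path_image (\<gamma> e)" by (auto simp: drawing_def)
  then have "p v \<in> p ` e" using edge_arc(3)[of e] h by blast
  moreover have "e \<subseteq> verts G" using simple e h by (auto simp: simple_graph_def)
  ultimately show "v \<in> \<Union>E" using p_inj h e by blast
qed

lemma oriented_arc:
  assumes "{x, y} \<in> edges G"
  shows "\<exists>g. arc g \<and> pathstart g = p x \<and> pathfinish g = p y \<and> path_image g = path_image (\<gamma> {x, y})"
proof -
  have "{pathstart (\<gamma> {x, y}), pathfinish (\<gamma> {x, y})} = {p x, p y}" using edge_arc(2)[OF assms] by simp
  then consider "pathstart (\<gamma> {x, y}) = p x" "pathfinish (\<gamma> {x, y}) = p y"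
    | "pathstart (\<gamma> {x, y}) = p y" "pathfinish (\<gamma> {x, y}) = p x" by (auto simp: doubleton_eq_iff)
  then show ?thesis
  proof cases
    case 1 then show ?thesis using edge_arc(1)[OF assms] by blast
  next
    case 2 then show ?thesis using edge_arc(1)[OF assms]
      by (intro exI[of _ "reversepath (\<gamma> {x, y})"]) (simp add: arc_reversepath)
  qed
qed

text \<open>Different edges meet only in common ends and \<open>x\<close> does not recur, so the
  first edge meets the rest of the drawing at most in \<open>y\<close>; hence the join is again an
  arc.\<close>

lemma path_arc:
  assumes "distinct xs" "2 \<le> length xs" "path_edges xs \<subseteq> edges G"
  shows "\<exists>g. arc g \<and> pathstart g = p (hd xs) \<and> pathfinish g = p (last xs) \<and> path_image g = drawing (path_edges xs)"
  using assms
proof (induction xs rule: path_edges.induct)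
  case (1 x y xs)
  obtain g1 where g1: "arc g1" "pathstart g1 = p x" "pathfinish g1 = p y" "path_image g1 = path_image (\<gamma> {x, y})"
    using oriented_arc[of x y] 1 by auto
  show ?case
  proof (cases xs)
    case Nil
    then show ?thesis using g1 by (auto simp: drawing_def)
  next
    case (Cons z zs)
    obtain g2 where g2: "arc g2" "pathstart g2 = p y" "pathfinish g2 = p (last (y # xs))" "path_image g2 = drawing (path_edges (y # xs))"
      using 1 Cons by auto
    have U: "\<Union>(path_edges (y # xs)) = set (y # xs)" using Cons by (intro Union_path_edges) simp
    have "{x, y} \<notin> path_edges (y # xs)" using U 1 by auto
    then have "drawing {{x, y}} \<inter> drawing (path_edges (y # xs)) \<subseteq> p ` (\<Union>{{x, y}} \<inter> \<Union>(path_edges (y # xs)))"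
      using 1 by (intro drawing_disjoint) auto
    also have "\<dots> \<subseteq> {p y}" unfolding U using 1 by auto
    finally have "path_image g1 \<inter> path_image g2 \<subseteq> {pathstart g2}" using g1 g2 by (simp add: drawing_def)
    then have "arc (g1 +++ g2)" using arc_join g1 g2 by metis
    moreover have "path_image (g1 +++ g2) = drawing (path_edges (x # y # xs))"
      using g1 g2 path_image_join[of g1 g2] by (simp add: drawing_def)
    ultimately show ?thesis using g1 g2 by (intro exI[of _ "g1 +++ g2"]) auto
  qed
qed auto

end

context chordless_cycle
begin

text \<open>The second list passes over the cut from \<open>n - 1\<close> to \<open>0\<close>, so it
  runs from \<open>k\<close> to \<open>i\<close>, and the edge of index \<open>j\<close> in it is
  the circuit edge of index \<open>(k + j) mod n\<close>.\<close>

lemma arcs_of_cycle: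
  assumes "i < k" "k < n"
  defines "xs \<equiv> map ((!) ys) [i..<Suc k]" and "zs \<equiv> map ((!) ys) ([k..<n] @ [0..<Suc i])"
  shows "path_edges xs \<union> path_edges zs = cyc_edges ys" "path_edges xs \<inter> path_edges zs = {}"
    "distinct xs" "distinct zs" "2 \<le> length xs" "2 \<le> length zs"
    "hd xs = ys ! i" "last xs = ys ! k" "hd zs = ys ! k" "last zs = ys ! i"
    "set xs = (\<lambda>j. ys ! j) ` {i..k}" "set zs = (\<lambda>j. ys ! j) ` ({k..<n} \<union> {0..i})"
proof -
  let ?e = "\<lambda>i. {ys ! i, ys ! (Suc i mod n)}"
  have inj: "inj_on ((!) ys) {..<n}" using dist by (auto simp: inj_on_def nth_eq_iff_index_eq)
  have 1: "path_edges xs = ?e ` {i..<k}"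
  proof -
    have "{j. Suc j < length xs} = {..<k - i}" using assms by (auto simp: xs_def)
    then have "path_edges xs = (\<lambda>j. {xs ! j, xs ! Suc j}) ` {..<k - i}" by (simp add: path_edges_nth)
    also have "\<dots> = (\<lambda>j. ?e (i + j)) ` {..<k - i}" using assms by (intro image_cong) (auto simp: xs_def nth_append simp del: upt_Suc)
    also have "\<dots> = ?e ` ((+) i ` {..<k - i})" by (simp add: image_image)
    also have "(+) i ` {..<k - i} = {i..<k}" using assms(1) by (simp add: lessThan_atLeast0)
    finally show ?thesis .
  qed
  have 2: "path_edges zs = ?e ` ({k..<n} \<union> {0..<i})"
  proof -
    have l: "length zs = n - k + Suc i" using assms by (simp add: zs_def)
    have nth: "zs ! j = ys ! ((k + j) mod n)" if "j < n - k + Suc i" for j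
      using that assms by (auto simp: zs_def nth_append mod_if add.commute simp del: upt_Suc)
    have "path_edges zs = (\<lambda>j. {zs ! j, zs ! Suc j}) ` {..<n - k + i}" unfolding path_edges_nth l by (intro image_cong) auto
    also have "\<dots> = (\<lambda>j. ?e ((k + j) mod n)) ` {..<n - k + i}"
      using nth by (intro image_cong) (auto simp: mod_Suc_eq)
    also have "\<dots> = ?e ` ((\<lambda>j. (k + j) mod n) ` {..<n - k + i})" by (simp add: image_image)
    also have "(\<lambda>j. (k + j) mod n) ` {..<n - k + i} = {k..<n} \<union> {0..<i}"
    proof (intro set_eqI iffI)
      fix x assume "x \<in> (\<lambda>j. (k + j) mod n) ` {..<n - k + i}"
      then obtain j where j: "j < n - k + i" "x = (k + j) mod n" by blast
      show "x \<in> {k..<n} \<union> {0..<i}"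
      proof (cases "k + j < n")
        case False
        then have "x = k + j - n" using j assms(1,2) by (simp add: le_mod_geq)
        moreover have "k + j - n < i" using j(1) False assms(1,2) by linarith
        ultimately show ?thesis by simp
      qed (use j in simp)
    next
      fix x assume "x \<in> {k..<n} \<union> {0..<i}"
      then show "x \<in> (\<lambda>j. (k + j) mod n) ` {..<n - k + i}"
      proof
        assume "x \<in> {k..<n}" then show ?thesis by (intro image_eqI[of _ _ "x - k"]) auto
      next
        assume "x \<in> {0..<i}" then show ?thesis using assms(1,2) by (intro image_eqI[of _ _ "n - k + x"]) auto
      qed
    qed
    finally show ?thesis .
  qed
  have "{i..<k} \<union> ({k..<n} \<union> {0..<i}) = {..<n}" using assms by auto
  then show "path_edges xs \<union> path_edges zs = cyc_edges ys" unfolding 1 2 cyc_edges_def image_Un[symmetric] by simp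
  have e: "{i..<k} \<inter> ({k..<n} \<union> {0..<i}) = {}" by auto
  have "{i..<k} \<subseteq> {..<n}" "{k..<n} \<union> {0..<i} \<subseteq> {..<n}" using assms(1,2) by auto
  from inj_on_image_Int[OF inj_on_cyc_edges[OF dist len] this]
  show "path_edges xs \<inter> path_edges zs = {}" unfolding 1 2 e by simp
  show "distinct xs" "distinct zs" unfolding xs_def zs_def distinct_map
    using assms(1,2) by (auto intro!: inj_on_subset[OF inj] simp del: upt_Suc)
  show "2 \<le> length xs" "2 \<le> length zs" using assms by (auto simp: xs_def zs_def)
  show "hd xs = ys ! i" "last xs = ys ! k" "hd zs = ys ! k" "last zs = ys ! i"
    using assms by (auto simp: xs_def zs_def hd_map hd_append last_map simp del: upt_Suc)
  show "set xs = (\<lambda>j. ys ! j) ` {i..k}" "set zs = (\<lambda>j. ys ! j) ` ({k..<n} \<union> {0..i})"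
    unfolding xs_def zs_def set_map set_append set_upt atLeastLessThanSuc_atLeastAtMost by blast+
qed

lemma bridge_path:
  assumes B: "B \<in> bridges" and i: "i \<in> feet B" and k: "k \<in> feet B" and ik: "i \<noteq> k"
  shows "\<exists>vs u. distinct vs \<and> 2 \<le> length vs \<and> path_edges vs \<subseteq> edges G \<and> hd vs = ys ! i \<and> last vs = ys ! k \<and>
    u \<in> set vs \<and> u \<in> B \<and> set vs \<subseteq> insert (ys ! i) (insert (ys ! k) B) \<and> path_edges vs \<inter> cyc_edges ys = {}"
proof -
  have l: "i < n" "k < n" using i k by (auto simp: feet_def)
  obtain u v where u: "u \<in> B" "{ys ! i, u} \<in> edges G" and v: "v \<in> B" "{ys ! k, v} \<in> edges G"
    using i k by (auto simp: feet_def)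
  obtain ps where ps: "ps \<noteq> []" "distinct ps" "hd ps = u" "last ps = v" "successively (\<lambda>x y. {x, y} \<in> edges G) ps" "set ps \<subseteq> B"
    using bridge_list[OF B u(1) v(1)] by blast
  let ?vs = "ys ! i # ps @ [ys ! k]"
  have Bys: "B \<inter> set ys = {}" using bridge_subset[OF B] by blast
  have "successively (\<lambda>x y. {x, y} \<in> edges G) ?vs" using ps u v
    by (auto simp: successively_Cons successively_append_iff hd_append insert_commute)
  then have e: "path_edges ?vs \<subseteq> edges G" by (rule path_edges_subset)
  have d: "distinct ?vs" using ps Bys l ik dist by (auto simp: nth_eq_iff_index_eq)
  have "path_edges ?vs \<inter> cyc_edges ys = {}"
  proof (rule ccontr)
    assume "\<not> ?thesis"
    then obtain e where e: "e \<in> path_edges ?vs" "e \<in> cyc_edges ys" by blast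
    have ys: "e \<subseteq> set ys"
    proof -
      have "Suc j mod n < n" for j using len by (intro mod_less_divisor) linarith
      then show ?thesis using e(2) by (auto simp: cyc_edges_def)
    qed
    obtain j where j: "Suc j < length ?vs" "e = {?vs ! j, ?vs ! Suc j}" using e(1) unfolding path_edges_nth by blast
    have lp: "1 \<le> length ps" using ps by (cases ps) auto
    \<comment> \<open>All inner vertices of the path are in \<open>B\<close>, so each of its edges
      has an end off the circuit.\<close>
    have mid: "?vs ! r \<in> B" if "1 \<le> r" "r \<le> length ps" for r
    proof -
      have "?vs ! r = ps ! (r - 1)" using that by (auto simp: nth_Cons' nth_append)
      moreover have "ps ! (r - 1) \<in> set ps" using that by simp
      ultimately show ?thesis using ps(6) by auto
    qed
    have "?vs ! j \<in> B \<or> ?vs ! Suc j \<in> B"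
      using mid[of j] mid[of "Suc j"] j(1) lp by (cases j) auto
    then show False using ys j Bys by auto
  qed
  then show ?thesis using e d ps u by (intro exI[of _ ?vs] exI[of _ u]) auto
qed

end

section \<open>The two sides of the embedded circuit\<close>

locale embedded_cycle = chordless_cycle +
  fixes p :: "'a \<Rightarrow> complex" and \<gamma> :: "'a set \<Rightarrow> real \<Rightarrow> complex"
  assumes emb: "plane_embedding G p \<gamma>"
begin

abbreviation "IM \<equiv> drawing \<gamma>"
text \<open>One vertex suffices: the edges within a bridge never meet the curve, so by
  \<open>inside_all\<close> all its vertices are inside.\<close>

definition inside_bridge :: "'a set \<Rightarrow> bool" where "inside_bridge B \<longleftrightarrow> (\<exists>u\<in>B. p u \<in> inside (IM (cyc_edges ys)))"

lemma Union_cyc: "\<Union>(cyc_edges ys) = set ys"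
proof -
  have "Suc j mod n < n" for j using len by (intro mod_less_divisor) linarith
  then show ?thesis by (fastforce simp: cyc_edges_def in_set_conv_nth)
qed

lemma cycle_arcs:
  assumes "i < k" "k < n"
  obtains c1 c2 where "arc c1" "arc c2" "pathstart c1 = p (ys ! i)" "pathfinish c1 = p (ys ! k)"
    "pathstart c2 = p (ys ! i)" "pathfinish c2 = p (ys ! k)"
    "path_image c1 \<inter> path_image c2 = {p (ys ! i), p (ys ! k)}"
    "path_image c1 \<union> path_image c2 = IM (cyc_edges ys)"
    "\<And>j. i \<le> j \<Longrightarrow> j \<le> k \<Longrightarrow> p (ys ! j) \<in> path_image c1"
    "\<And>j. k \<le> j \<Longrightarrow> j < n \<Longrightarrow> p (ys ! j) \<in> path_image c2"
proof -
  define xs where "xs = map ((!) ys) [i..<Suc k]"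
  define zs where "zs = map ((!) ys) ([k..<n] @ [0..<Suc i])"
  note a = arcs_of_cycle[OF assms, folded xs_def zs_def]
  have e: "path_edges xs \<subseteq> edges G" "path_edges zs \<subseteq> edges G" using a(1) cyc by blast+
  obtain c1 where c1: "arc c1" "pathstart c1 = p (hd xs)" "pathfinish c1 = p (last xs)" "path_image c1 = IM (path_edges xs)"
    using path_arc[OF simple emb a(3,5) e(1)] by blast
  obtain c2 where c2: "arc c2" "pathstart c2 = p (hd zs)" "pathfinish c2 = p (last zs)" "path_image c2 = IM (path_edges zs)"
    using path_arc[OF simple emb a(4,6) e(2)] by blast
  note U = Union_path_edges[OF a(5)] Union_path_edges[OF a(6)]
  have in1: "p ` set xs \<subseteq> path_image c1" and in2: "p ` set zs \<subseteq> path_image c2"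
    using ends_drawing[OF simple emb e(1)] ends_drawing[OF simple emb e(2)] c1 c2 U by simp_all
  have "path_image c1 \<inter> path_image c2 \<subseteq> p ` (set xs \<inter> set zs)"
    using drawing_disjoint[OF simple emb e a(2)] c1 c2 U by simp
  also have "set xs \<inter> set zs \<subseteq> {ys ! i, ys ! k}"
  proof
    fix w assume "w \<in> set xs \<inter> set zs"
    then obtain j j' where "w = ys ! j" "i \<le> j" "j \<le> k" "w = ys ! j'" "k \<le> j' \<and> j' < n \<or> j' \<le> i" unfolding a(11,12) by force
    moreover from this have "j = j'" using dist assms nth_eq_iff_index_eq[of ys j j'] by auto
    ultimately show "w \<in> {ys ! i, ys ! k}" by (metis insertCI le_antisym)
  qed
  finally have s: "path_image c1 \<inter> path_image c2 \<subseteq> {p (ys ! i), p (ys ! k)}" by auto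
  have "{p (ys ! i), p (ys ! k)} \<subseteq> path_image c1 \<inter> path_image c2" using in1 in2 a(11,12) assms by auto
  with s have int: "path_image c1 \<inter> path_image c2 = {p (ys ! i), p (ys ! k)}" by blast
  have un: "path_image c1 \<union> path_image c2 = IM (cyc_edges ys)" using c1 c2 a(1) drawing_Un[OF simple emb] by metis
  \<comment> \<open>The second arc is reversed so that both run from position \<open>i\<close> to
    position \<open>k\<close>, as the theta-curve lemmas expect.\<close>
  show ?thesis
  proof (rule that[of c1 "reversepath c2"])
    show "\<And>j. i \<le> j \<Longrightarrow> j \<le> k \<Longrightarrow> p (ys ! j) \<in> path_image c1" using in1 a(11) by auto
    show "\<And>j. k \<le> j \<Longrightarrow> j < n \<Longrightarrow> p (ys ! j) \<in> path_image (reversepath c2)" using in2 a(12) by auto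
  qed (use c1 c2 a int un in \<open>auto simp: arc_reversepath\<close>)
qed

lemma cycle_curve:
  obtains g where "simple_path g" "pathfinish g = pathstart g" "path_image g = IM (cyc_edges ys)"
proof -
  have "(0::nat) < 1" "1 < n" using len by auto
  from cycle_arcs[OF this] obtain c1 c2 where c: "arc c1" "arc c2" "pathstart c1 = p (ys ! 0)" "pathfinish c1 = p (ys ! 1)"
    "pathstart c2 = p (ys ! 0)" "pathfinish c2 = p (ys ! 1)" "path_image c1 \<inter> path_image c2 = {p (ys ! 0), p (ys ! 1)}"
    "path_image c1 \<union> path_image c2 = IM (cyc_edges ys)" by metis
  from loop_of_arcs[OF c(1-7)] show ?thesis using that c(8) by metis
qed

lemma off_cycle: "\<lbrakk>u \<in> verts G; u \<notin> set ys\<rbrakk> \<Longrightarrow> p u \<notin> IM (cyc_edges ys)"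
  using vertex_drawing[OF simple emb cyc] Union_cyc by blast

lemma inside_step:
  assumes "{u, v} \<in> edges G" "u \<notin> set ys" "v \<notin> set ys" "p u \<in> inside (IM (cyc_edges ys))"
  shows "p v \<in> inside (IM (cyc_edges ys))"
proof -
  obtain g where g: "simple_path g" "pathfinish g = pathstart g" "path_image g = IM (cyc_edges ys)" using cycle_curve .
  let ?K = "path_image (\<gamma> {u, v})"
  have "{u, v} \<notin> cyc_edges ys" using assms Union_cyc by blast
  then have "IM {{u, v}} \<inter> IM (cyc_edges ys) \<subseteq> p ` (\<Union>{{u, v}} \<inter> \<Union>(cyc_edges ys))"
    using assms cyc by (intro drawing_disjoint[OF simple emb]) auto
  then have dj: "?K \<inter> path_image g = {}" using assms Union_cyc g by (auto simp: drawing_def[OF simple emb])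
  have conn: "connected ?K" using edge_arc(1)[OF simple emb assms(1)] by (rule connected_arc_image)
  have "p ` {u, v} \<subseteq> ?K" using edge_ends[OF simple emb assms(1)] .
  then have uv: "p u \<in> ?K" "p v \<in> ?K" by auto
  then have "?K \<inter> inside (path_image g) \<noteq> {}" using assms(4) g by auto
  from connected_in_side(1)[OF g(1,2) conn dj this] uv g show ?thesis by auto
qed

lemma inside_all:
  assumes B: "B \<in> bridges" and u: "u \<in> B" "inside_bridge B" shows "p u \<in> inside (IM (cyc_edges ys))"
proof -
  obtain v where v: "v \<in> B" "p v \<in> inside (IM (cyc_edges ys))" using u by (auto simp: inside_bridge_def)
  have "(v, u) \<in> (adjacency (delete_verts G (set ys)))\<^sup>*" using bridge_component[OF B v(1)] u by (simp add: component_def)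
  then show ?thesis using v(2)
    by (induction rule: rtrancl_induct) (auto simp: adj_H intro: inside_step)
qed

text \<open>The circuit is split at \<open>i\<close> and \<open>k\<close>. Paths through
  \<open>A\<close> and \<open>B\<close> give disjoint arcs on the same side of the curve whose ends
  alternate on it, which \<open>no_crossing_inside\<close> and \<open>no_crossing_outside\<close>
  exclude.\<close>

lemma crossing:
  assumes A: "A \<in> bridges" and B: "B \<in> bridges" and ne: "A \<noteq> B" and side: "inside_bridge A = inside_bridge B"
    and ijkl: "i < j" "j < k" "k < l" and f: "i \<in> feet A" "k \<in> feet A" "j \<in> feet B" "l \<in> feet B"
  shows False
proof -
  let ?J = "IM (cyc_edges ys)"
  have ln: "l < n" using f by (simp add: feet_def)
  have ik: "i < k" "k < n" "j < n" "i < n" using ijkl ln by auto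
  obtain c1 c2 where c: "arc c1" "arc c2" "pathstart c1 = p (ys ! i)" "pathfinish c1 = p (ys ! k)"
    "pathstart c2 = p (ys ! i)" "pathfinish c2 = p (ys ! k)" "path_image c1 \<inter> path_image c2 = {p (ys ! i), p (ys ! k)}"
    "path_image c1 \<union> path_image c2 = ?J" "\<And>j. i \<le> j \<Longrightarrow> j \<le> k \<Longrightarrow> p (ys ! j) \<in> path_image c1"
    "\<And>j. k \<le> j \<Longrightarrow> j < n \<Longrightarrow> p (ys ! j) \<in> path_image c2" using cycle_arcs[OF ik(1,2)] by metis
  obtain vs u where vs: "distinct vs" "2 \<le> length vs" "path_edges vs \<subseteq> edges G" "hd vs = ys ! i" "last vs = ys ! k"
    "u \<in> set vs" "u \<in> A" "set vs \<subseteq> insert (ys ! i) (insert (ys ! k) A)" "path_edges vs \<inter> cyc_edges ys = {}"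
    using bridge_path[OF A f(1,2)] ijkl by auto
  obtain ws w where ws: "distinct ws" "2 \<le> length ws" "path_edges ws \<subseteq> edges G" "hd ws = ys ! j" "last ws = ys ! l"
    "w \<in> set ws" "w \<in> B" "set ws \<subseteq> insert (ys ! j) (insert (ys ! l) B)" "path_edges ws \<inter> cyc_edges ys = {}"
    using bridge_path[OF B f(3,4)] ijkl by auto
  obtain c' where c': "arc c'" "pathstart c' = p (ys ! i)" "pathfinish c' = p (ys ! k)" "path_image c' = IM (path_edges vs)"
    using path_arc[OF simple emb vs(1-3)] vs(4,5) by auto
  obtain d where d: "arc d" "pathstart d = p (ys ! j)" "pathfinish d = p (ys ! l)" "path_image d = IM (path_edges ws)"
    using path_arc[OF simple emb ws(1-3)] ws(4,5) by auto
  have V: "\<Union>(path_edges vs) = set vs" "\<Union>(path_edges ws) = set ws" using Union_path_edges vs(2) ws(2) by auto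
  have sA: "A \<inter> set ys = {}" "A \<subseteq> verts G" and sB: "B \<inter> set ys = {}" "B \<subseteq> verts G" using bridge_subset[OF A] bridge_subset[OF B] by auto
  have AB: "A \<inter> B = {}" using bridges_disjoint[OF A B] ne by blast
  have yV: "ys ! r \<in> verts G" if "r < n" for r using verts_ys that nth_mem by blast
  have pne: "p (ys ! r) \<noteq> p (ys ! q)" if "r < n" "q < n" "r \<noteq> q" for r q
    using p_inj[OF simple emb yV[OF that(1)] yV[OF that(2)]] that dist nth_eq_iff_index_eq by blast
  have "path_image c' \<inter> ?J \<subseteq> p ` (set vs \<inter> set ys)"
    using drawing_disjoint[OF simple emb vs(3) cyc vs(9)] c'(4) V Union_cyc by simp
  also have "\<dots> \<subseteq> {p (ys ! i), p (ys ! k)}" using vs(8) sA by auto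
  finally have cJ1: "path_image c' \<inter> ?J \<subseteq> {p (ys ! i), p (ys ! k)}" .
  have cJ: "path_image c' \<inter> (path_image c1 \<union> path_image c2) = {p (ys ! i), p (ys ! k)}"
    using cJ1 c(7,8) c'(2,3) pathstart_in_path_image[of c'] pathfinish_in_path_image[of c'] by auto
  have "path_image d \<inter> ?J \<subseteq> p ` (set ws \<inter> set ys)"
    using drawing_disjoint[OF simple emb ws(3) cyc ws(9)] d(4) V Union_cyc by simp
  also have "\<dots> \<subseteq> {p (ys ! j), p (ys ! l)}" using ws(8) sB by auto
  finally have dJ1: "path_image d \<inter> ?J \<subseteq> {p (ys ! j), p (ys ! l)}" .
  have x: "p (ys ! j) \<in> path_image c1" using c(9) ijkl by simp
  have y: "p (ys ! l) \<in> path_image c2" using c(10) ijkl ln by simp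
  have dJ: "path_image d \<inter> (path_image c1 \<union> path_image c2) = {p (ys ! j), p (ys ! l)}"
    using dJ1 c(8) x y d(2,3) pathstart_in_path_image[of d] pathfinish_in_path_image[of d] by auto
  have sd: "set vs \<inter> set ws = {}"
  proof -
    have "ys ! r \<noteq> ys ! q" if "r < n" "q < n" "r \<noteq> q" for r q using pne[OF that] by auto
    then have "{ys ! i, ys ! k} \<inter> {ys ! j, ys ! l} = {}" using ijkl ik ln by auto
    moreover have "ys ! i \<in> set ys" "ys ! k \<in> set ys" "ys ! j \<in> set ys" "ys ! l \<in> set ys" using ik ln by auto
    ultimately show ?thesis using vs(8) ws(8) sA sB AB by blast
  qed
  have "path_edges vs \<inter> path_edges ws = {}"
  proof (rule ccontr)
    assume "\<not> ?thesis"
    then obtain e where e: "e \<in> path_edges vs" "e \<in> path_edges ws" by blast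
    then have "e \<subseteq> set vs \<inter> set ws" using V by blast
    then have "e = {}" using sd by simp
    moreover have "card e = 2" using e vs(3) simple by (auto simp: simple_graph_def)
    ultimately show False by simp
  qed
  then have cd: "path_image c' \<inter> path_image d = {}"
    using drawing_disjoint[OF simple emb vs(3) ws(3)] c'(4) d(4) V sd by auto
  have "u \<in> verts G" "u \<notin> set ys" "w \<in> verts G" "w \<notin> set ys" using vs(7) ws(7) sA sB by blast+
  then have uw: "p u \<notin> ?J" "p w \<notin> ?J" using off_cycle by blast+
  have u: "p u \<in> path_image c'" "p u \<notin> ?J" using ends_drawing[OF simple emb vs(3)] V c'(4) vs(6) uw by auto
  have w: "p w \<in> path_image d" "p w \<notin> ?J" using ends_drawing[OF simple emb ws(3)] V d(4) ws(6) uw by auto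
  have neq: "p (ys ! i) \<noteq> p (ys ! k)" "p (ys ! j) \<noteq> p (ys ! i)" "p (ys ! j) \<noteq> p (ys ! k)" "p (ys ! l) \<noteq> p (ys ! i)" "p (ys ! l) \<noteq> p (ys ! k)"
    using pne ijkl ik ln by simp_all
  show False
  proof (cases "inside_bridge A")
    case True
    then have "p u \<in> inside ?J" "p w \<in> inside ?J" using inside_all A B vs(7) ws(7) side by auto
    then have "path_image c' \<inter> inside (path_image c1 \<union> path_image c2) \<noteq> {}" "path_image d \<inter> inside (path_image c1 \<union> path_image c2) \<noteq> {}"
      using u w c(8) by auto
    from no_crossing_inside[OF c(1,2) c'(1) d(1) c(3-6) c'(2,3) d(2,3) neq(1) c(7) cJ dJ cd x neq(2,3) y neq(4,5) this]
    show False .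
  next
    case False
    then have "p u \<notin> inside ?J" "p w \<notin> inside ?J" using vs(7) ws(7) side by (auto simp: inside_bridge_def)
    then have "p u \<in> outside ?J" "p w \<in> outside ?J" using u w inside_Un_outside[of ?J] by blast+
    then have "path_image c' \<inter> outside (path_image c1 \<union> path_image c2) \<noteq> {}" "path_image d \<inter> outside (path_image c1 \<union> path_image c2) \<noteq> {}"
      using u w c(8) by auto
    from no_crossing_outside[OF c(1,2) c'(1) d(1) c(3-6) c'(2,3) d(2,3) neq(1) c(7) cJ dJ cd x neq(2,3) y neq(4,5) this]
    show False .
  qed
qed

end

theorem corollary3:
  fixes G C :: "'a ugraph"
  assumes "simple_graph G"
    and "planar G"
    and "three_connected G"
    and "longest_circuit G C"
  shows "\<exists>e. chord G C e"
proof (rule ccontr)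
  assume no: "\<nexists>e. chord G C e"
  obtain p \<gamma> where emb: "plane_embedding G p \<gamma>" using assms(2) by (auto simp: planar_def)
  have C: "circuit G C" and mx: "\<And>D. circuit G D \<Longrightarrow> card (edges D) \<le> card (edges C)"
    using assms(4) by (auto simp: longest_circuit_def)
  obtain ys where ys: "distinct ys" "3 \<le> length ys" "set ys = verts C" "cyc_edges ys = edges C"
    using list_of_circuit[OF C] .
  interpret embedded_cycle G ys p \<gamma>
  proof
    show "cyc_edges ys \<subseteq> edges G" using C ys(4) by (simp add: circuit_def subgraph_def)
    show "length zs \<le> length ys" if "distinct zs" "3 \<le> length zs" "cyc_edges zs \<subseteq> edges G" for zs
      using mx[OF circuit_of_list[OF assms(1) that]] card_cyc_edges[OF that(1,2)] card_cyc_edges[OF ys(1,2)] ys(4) by simp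
    show "e \<in> cyc_edges ys" if "e \<in> edges G" "e \<subseteq> set ys" for e
      using no that ys by (auto simp: chord_def)
  qed (fact assms emb ys)+
  interpret sided_cycle G ys inside_bridge
    by unfold_locales (fact crossing)
  show False by (rule no_sided_cycle)
qed

end
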